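(* Let $1\le r<2n$ and let $\chi$ and $\mu$ be characters of $G_r$ and $G_{2n-r}$ respectively. Then, as $\Delta G_n$-modules, $$(\chi\times\mu)_{N,\psi}\simeq\begin{cases}0&\text{if } r\ne n,\\ \chi\otimes\mu&\text{if } r=n.\end{cases}$$
   Context: $F$ is a non-archimedean local field, $\mathcal M_n$ is the space of $n\times n$ matrices over $F$, $G_n=GL_n(F)$. A character of an $\ell$-group is a smooth one-dimensional complex representation. $P_{r,2n-r}$ is the standard block upper triangular parabolic of $G_{2n}$ with Levi $M_{r,2n-r}\cong G_r\times G_{2n-r}$ and unipotent radical $N_{r,2n-r}$. $\chi\times\mu=i_{P_{r,2n-r}}^{G_{2n}}(\chi\otimes\mu)$ is the normalized parabolically induced representation (right translation on smooth functions $f$ with $f(pg)=\delta_{P_{r,2n-r}}^{1/2}(p)(\chi\otimes\mu)(p)f(g)$, $\chi\otimes\mu$ extended trivially on $N_{r,2n-r}$). $N=\left\{\begin{pmatrix} I_n&x\\0&I_n\end{pmatrix}:x\in\mathcal M_n\right\}\subset G_{2n}$, $\psi_0$ is a fixed non-trivial additive character of $F$, $\psi\begin{pmatrix} I_n&x\\0&I_n\end{pmatrix}=\psi_0(\mathrm{tr}(x))$. $\Delta G_n=\left\{\begin{pmatrix}g&0\\0&g\end{pmatrix}:g\in G_n\right\}$ normalizes $N$ and $\psi$. For a smooth representation $(\pi,V)$ of $G_{2n}$, $\pi_{N,\psi}$ is the natural representation of $\Delta G_n$ on $V/\langle\pi(u)v-\psi(u)v:u\in N,v\in V\rangle$. When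 $r=n$, $\chi\otimes\mu$ as a $\Delta G_n$-module is the character $\begin{pmatrix}g&0\\0&g\end{pmatrix}\mapsto\chi(g)\mu(g)$. *)

theory Defs
  imports
    "HOL-Analysis.Function_Topology"
    "HOL-Analysis.Measure_Space"
    "HOL-Algebra.Coset"
    "HOL-Algebra.AbelCoset"
    "Jordan_Normal_Form.VS_Connect"
begin

section \<open>Non-archimedean local fields\<close>

text \<open>The metric comes from a non-trivial multiplicative ultrametric absolute value and is locally
  compact; the characteristic is arbitrary. Definiteness and non-negativity of the absolute value
  follow from the metric axioms. The absolute value need not be the normalized one: it is only used
  to generate the topology.\<close>

class nonarch_local_field = field + metric_space +
  fixes absv :: "'a \<Rightarrow> real"
  assumes dist_absv: "dist x y = absv (x - y)"
    and absv_mult: "absv (x * y) = absv x * absv y"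
    and absv_ultrametric: "absv (x + y) \<le> max (absv x) (absv y)"
    and absv_nontrivial: "\<exists>x. x \<noteq> 0 \<and> absv x \<noteq> 1"
    and locally_compact: "\<exists>U C. open U \<and> 0 \<in> U \<and> U \<subseteq> C \<and> compact C"

definition additive_group :: "'a::ab_group_add monoid" where
  "additive_group = \<lparr>carrier = UNIV, mult = (+), one = 0\<rparr>"


section \<open>General linear groups and their subgroups\<close>

definition GL :: "nat \<Rightarrow> 'a::field mat monoid" where
  "GL n = units_of (ring_mat TYPE('a) n ())"

text \<open>The subspace topology from the space of \<open>n \<times> n\<close> matrices; over a topological field it is
  already a group topology.\<close>

definition GL_topology :: "nat \<Rightarrow> 'a::{field,topological_space} mat topology" where
  "GL_topology n = pullback_topology (carrier (GL n)) (\<lambda>A. \<lambda>ij\<in>{..<n} \<times> {..<n}. A $$ ij)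
     (product_topology (\<lambda>_. euclidean) ({..<n} \<times> {..<n}))"

definition parabolic :: "nat \<Rightarrow> nat \<Rightarrow> 'a::field mat set" where
  "parabolic r s = {four_block_mat a x (0\<^sub>m s r) d | a x d.
     a \<in> carrier (GL r) \<and> x \<in> carrier_mat r s \<and> d \<in> carrier (GL s)}"

definition N_subgroup :: "nat \<Rightarrow> 'a::field mat set" where
  "N_subgroup n = {four_block_mat (1\<^sub>m n) x (0\<^sub>m n n) (1\<^sub>m n) | x. x \<in> carrier_mat n n}"

definition Delta_GL :: "nat \<Rightarrow> 'a::field mat set" where
  "Delta_GL n = {four_block_mat g (0\<^sub>m n n) (0\<^sub>m n n) g | g. g \<in> carrier (GL n)}"

text \<open>On \<open>N_subgroup n\<close> this is \<open>(1 x; 0 1) \<mapsto> \<psi>\<^sub>0 (tr x)\<close>.\<close>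

definition psi_N :: "nat \<Rightarrow> ('a::field \<Rightarrow> complex) \<Rightarrow> 'a mat \<Rightarrow> complex" where
  "psi_N n \<psi>\<^sub>0 u = (case split_block u n n of (_, x, _, _) \<Rightarrow> \<psi>\<^sub>0 (\<Sum>i<n. x $$ (i, i)))"

text \<open>The function \<open>(a x; 0 d) \<mapsto> chi a * mu d\<close> with \<open>a\<close> of size \<open>r \<times> r\<close>. On the parabolic it is
  \<open>chi \<otimes> mu\<close> extended trivially on the unipotent radical, and on \<open>Delta_GL r\<close> it is
  \<open>diag(g, g) \<mapsto> chi g * mu g\<close>.\<close>

definition levi_char ::
    "nat \<Rightarrow> ('a mat \<Rightarrow> complex) \<Rightarrow> ('a mat \<Rightarrow> complex) \<Rightarrow> 'a mat \<Rightarrow> complex" where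
  "levi_char r chi mu p = (case split_block p r r of (a, _, _, d) \<Rightarrow> chi a * mu d)"


section \<open>Smooth complex representations\<close>

abbreviation complex_ring :: "complex ring" where
  "complex_ring \<equiv> class_ring"

type_synonym ('g, 'v) rep = "(complex, 'v) module \<times> ('g \<Rightarrow> 'v \<Rightarrow> 'v)"

definition smooth_rep :: "'g monoid \<Rightarrow> 'g topology \<Rightarrow> ('g, 'v) rep \<Rightarrow> bool" where
  "smooth_rep G T = (\<lambda>(V, \<pi>). group G \<and> module complex_ring V \<and>
     (\<forall>g\<in>carrier G. \<pi> g \<in> module_hom complex_ring V V) \<and>
     (\<forall>v\<in>carrier V. \<pi> \<one>\<^bsub>G\<^esub> v = v) \<and>
     (\<forall>g\<in>carrier G. \<forall>h\<in>carrier G. \<forall>v\<in>carrier V. \<pi> (g \<otimes>\<^bsub>G\<^esub> h) v = \<pi> g (\<pi> h v)) \<and>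
     (\<forall>v\<in>carrier V. openin T {g \<in> carrier G. \<pi> g v = v}))"

definition complex_line :: "(complex, complex) module" where
  "complex_line = \<lparr>carrier = UNIV, mult = (*), one = 1, zero = 0, add = (+), smult = (*)\<rparr>"

definition char_rep :: "('g \<Rightarrow> complex) \<Rightarrow> ('g, complex) rep" where
  "char_rep chi = (complex_line, \<lambda>g z. chi g * z)"

definition zero_rep :: "('g, complex) rep" where
  "zero_rep = (complex_line\<lparr>carrier := {0}\<rparr>, \<lambda>g z. z)"

definition smooth_character :: "'g monoid \<Rightarrow> 'g topology \<Rightarrow> ('g \<Rightarrow> complex) \<Rightarrow> bool" where
  "smooth_character G T chi \<longleftrightarrow> smooth_rep G T (char_rep chi)"

definition rep_iso :: "'g set \<Rightarrow> ('g, 'v) rep \<Rightarrow> ('g, 'w) rep \<Rightarrow> bool" where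
  "rep_iso H = (\<lambda>(V, \<pi>) (W, \<sigma>). \<exists>\<Phi> \<in> module_hom complex_ring V W.
     bij_betw \<Phi> (carrier V) (carrier W) \<and>
     (\<forall>h\<in>H. \<forall>v\<in>carrier V. \<Phi> (\<pi> h v) = \<sigma> h (\<Phi> v)))"


section \<open>The modulus character\<close>

text \<open>No regularity condition is imposed: it is automatic on the second countable locally compact
  groups to which this is applied.\<close>

definition left_haar :: "'g monoid \<Rightarrow> 'g topology \<Rightarrow> 'g measure \<Rightarrow> bool" where
  "left_haar G T M \<longleftrightarrow>
     sets M = sigma_sets (topspace T) {U. openin T U} \<and>
     (\<forall>g\<in>carrier G. \<forall>A\<in>sets M. emeasure M (g <#\<^bsub>G\<^esub> A) = emeasure M A) \<and>
     (\<forall>C. compactin T C \<longrightarrow> emeasure M C < \<infinity>) \<and>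
     (\<forall>U. openin T U \<and> U \<noteq> {} \<longrightarrow> 0 < emeasure M U)"

text \<open>With \<open>m\<close> a left Haar measure, \<open>\<delta>(g)\<close> is defined by \<open>m(A g\<inverse>) = m(g A g\<inverse>) = \<delta>(g) m(A)\<close>.
  This is the convention for which, on a parabolic, \<open>\<delta>(p)\<close> is the factor by which
  \<open>u \<mapsto> p u p\<inverse>\<close> scales the Haar measure of the unipotent radical, as normalized induction from the
  left requires: the value at \<open>(a x; 0 d)\<close> in \<open>parabolic r s\<close> is
  \<open>\<bar>det a\<bar> ^ s / \<bar>det d\<bar> ^ r\<close> for the normalized absolute value.\<close>

definition modulus :: "'g monoid \<Rightarrow> 'g topology \<Rightarrow> 'g \<Rightarrow> real" where
  "modulus G T g = (THE c. 0 < c \<and> (\<forall>M. left_haar G T M \<longrightarrow>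
     (\<forall>A\<in>sets M. emeasure M (A #>\<^bsub>G\<^esub> inv\<^bsub>G\<^esub> g) = ennreal c * emeasure M A)))"


section \<open>Normalized induction\<close>

text \<open>Functions are extensional, i.e. \<open>undefined\<close> off \<open>carrier G\<close>. Smoothness is right invariance
  under some open subgroup, as usual for induced representations of \<open>\<ell>\<close>-groups.\<close>

definition ind_space ::
    "'g monoid \<Rightarrow> 'g topology \<Rightarrow> 'g set \<Rightarrow> ('g \<Rightarrow> complex) \<Rightarrow> ('g \<Rightarrow> complex) set" where
  "ind_space G T P \<sigma> = {f \<in> carrier G \<rightarrow>\<^sub>E UNIV.
     (\<forall>p\<in>P. \<forall>g\<in>carrier G. f (p \<otimes>\<^bsub>G\<^esub> g) =
        of_real (sqrt (modulus (G\<lparr>carrier := P\<rparr>) (subtopology T P) p)) * \<sigma> p * f g) \<and>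
     (\<exists>K. subgroup K G \<and> openin T K \<and> (\<forall>g\<in>carrier G. \<forall>k\<in>K. f (g \<otimes>\<^bsub>G\<^esub> k) = f g))}"

definition normalized_ind ::
    "'g monoid \<Rightarrow> 'g topology \<Rightarrow> 'g set \<Rightarrow> ('g \<Rightarrow> complex) \<Rightarrow> ('g, 'g \<Rightarrow> complex) rep" where
  "normalized_ind G T P \<sigma> =
     ((ring.func_space complex_ring (carrier G))\<lparr>carrier := ind_space G T P \<sigma>\<rparr>,
      \<lambda>g f. \<lambda>x\<in>carrier G. f (x \<otimes>\<^bsub>G\<^esub> g))"

definition parabolic_ind :: "nat \<Rightarrow> nat \<Rightarrow> ('a mat \<Rightarrow> complex) \<Rightarrow> ('a mat \<Rightarrow> complex) \<Rightarrow>
    ('a::nonarch_local_field mat, 'a mat \<Rightarrow> complex) rep" where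
  "parabolic_ind r s chi mu =
     normalized_ind (GL (r + s)) (GL_topology (r + s)) (parabolic r s) (levi_char r chi mu)"


section \<open>Twisted Jacquet modules\<close>

definition quotient_module :: "(complex, 'v) module \<Rightarrow> 'v set \<Rightarrow> (complex, 'v set) module" where
  "quotient_module V W = \<lparr>carrier = a_rcosets\<^bsub>V\<^esub> W, mult = undefined, one = undefined,
     zero = W, add = (<+>\<^bsub>V\<^esub>), smult = (\<lambda>c X. \<Union>v\<in>X. W +>\<^bsub>V\<^esub> (c \<odot>\<^bsub>V\<^esub> v))\<rparr>"

definition twisted_span :: "('g, 'v) rep \<Rightarrow> 'g set \<Rightarrow> ('g \<Rightarrow> complex) \<Rightarrow> 'v set" where
  "twisted_span = (\<lambda>(V, \<pi>) N \<psi>. LinearCombinations.module.span complex_ring V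
     {\<pi> u v \<ominus>\<^bsub>V\<^esub> \<psi> u \<odot>\<^bsub>V\<^esub> v | u v. u \<in> N \<and> v \<in> carrier V})"

text \<open>The action sends the coset of \<open>v\<close> to the coset of \<open>\<pi> h v\<close>; the union over all
  representatives avoids a choice.\<close>

definition twisted_jacquet ::
    "('g, 'v) rep \<Rightarrow> 'g set \<Rightarrow> ('g \<Rightarrow> complex) \<Rightarrow> ('g, 'v set) rep" where
  "twisted_jacquet R N \<psi> = (case R of (V, \<pi>) \<Rightarrow>
     let W = twisted_span R N \<psi> in
     (quotient_module V W, \<lambda>h X. \<Union>v\<in>X. W +>\<^bsub>V\<^esub> \<pi> h v))"

end

theory Submission
  imports Defs "HOL-Analysis.Elementary_Metric_Spaces" "HOL-Analysis.Caratheodory"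
begin

lemma absv_eq_dist: "absv x = dist x (0::'a::nonarch_local_field)"
  by (simp add: dist_absv)

lemma absv_nonneg [simp]: "0 \<le> absv (x::'a::nonarch_local_field)"
  by (simp add: absv_eq_dist)

lemma absv_0 [simp]: "absv (0::'a::nonarch_local_field) = 0"
  by (simp add: absv_eq_dist)

lemma absv_eq_0_iff [simp]: "absv x = 0 \<longleftrightarrow> x = (0::'a::nonarch_local_field)"
  by (simp add: absv_eq_dist)

lemma absv_pos_iff [simp]: "0 < absv x \<longleftrightarrow> x \<noteq> (0::'a::nonarch_local_field)"
  by (simp add: absv_eq_dist)

lemma absv_1 [simp]: "absv (1::'a::nonarch_local_field) = 1"
proof -
  have "absv (1::'a) * absv (1::'a) = absv (1::'a)"
    by (simp flip: absv_mult)
  moreover have "absv (1::'a) \<noteq> 0" by simp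
  ultimately show ?thesis by (metis mult_cancel_right1)
qed

lemma absv_minus [simp]: "absv (- x) = absv (x::'a::nonarch_local_field)"
  using dist_commute[of x "0::'a"] by (simp add: dist_absv)

lemma absv_diff_commute: "absv (x - y) = absv (y - (x::'a::nonarch_local_field))"
  using dist_commute[of x y] by (simp add: dist_absv)

lemma absv_divide: "absv (x / y) = absv x / absv (y::'a::nonarch_local_field)"
proof (cases "y = 0")
  case False
  have "absv (x / y) * absv y = absv x" using False by (simp flip: absv_mult)
  then show ?thesis using False by (simp add: field_simps)
qed simp

lemma absv_add_le: "absv x \<le> c \<Longrightarrow> absv y \<le> c \<Longrightarrow> absv (x + y) \<le> c"
  for x y :: "'a::nonarch_local_field"
  using absv_ultrametric[of x y] by linarith

lemma absv_diff_le: "absv x \<le> c \<Longrightarrow> absv y \<le> c \<Longrightarrow> absv (x - y) \<le> c"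
  for x y :: "'a::nonarch_local_field"
  using absv_add_le[of x c "- y"] by simp

lemma absv_sum_le:
  fixes f :: "'b \<Rightarrow> 'a::nonarch_local_field"
  assumes "\<And>i. i \<in> I \<Longrightarrow> absv (f i) \<le> c" and "0 \<le> c"
  shows "absv (sum f I) \<le> c"
  using assms by (induction I rule: infinite_finite_induct) (auto intro: absv_add_le)

lemma absv_power: "absv (x ^ k) = absv x ^ k" for x :: "'a::nonarch_local_field"
  by (induction k) (auto simp: absv_mult)

lemma absv_small_exists: "\<exists>x::'a::nonarch_local_field. x \<noteq> 0 \<and> absv x < 1"
proof -
  obtain x :: 'a where x: "x \<noteq> 0" "absv x \<noteq> 1" using absv_nontrivial by blast
  show ?thesis
  proof (cases "absv x < 1")
    case False
    with x show ?thesis by (intro exI[of _ "1 / x"]) (simp add: absv_divide)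
  qed (use x in blast)
qed

lemma absv_unbounded: "\<exists>x::'a::nonarch_local_field. absv x > c"
proof -
  obtain y :: 'a where y: "y \<noteq> 0" "absv y < 1" using absv_small_exists by blast
  then have "1 / absv y > 1" by (simp add: field_simps)
  then obtain k where "(1 / absv y) ^ k > c" using real_arch_pow by blast
  then show ?thesis by (intro exI[of _ "(1 / y) ^ k"]) (simp add: absv_power absv_divide)
qed

lemma unit_ne_1_exists: "\<exists>l::'a::nonarch_local_field. l \<noteq> 0 \<and> l \<noteq> 1"
  using absv_small_exists by force

lemma compact_absv_ball: "compact {x::'a::nonarch_local_field. absv x \<le> R}"
proof -
  obtain U C :: "'a set" where U: "open U" "0 \<in> U" "U \<subseteq> C" "compact C"
    using locally_compact by blast
  then obtain e where e: "e > 0" "ball 0 e \<subseteq> U" using open_contains_ball by blast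
  have cb: "cball 0 r = {x::'a. absv x \<le> r}" for r
    by (auto simp: absv_eq_dist dist_commute)
  have "cball (0::'a) (e/2) \<subseteq> ball 0 e" using e by auto
  then have "cball (0::'a) (e/2) = C \<inter> cball 0 (e/2)" using e U by blast
  then have cpt: "compact (cball (0::'a) (e/2))"
    by (metis U(4) closed_cball compact_Int_closed)
  obtain a :: 'a where a: "absv a > max 1 (R / (e/2))" using absv_unbounded by blast
  then have a0: "a \<noteq> 0" by auto
  have "continuous_on (cball (0::'a) (e/2)) (\<lambda>x. a * x)"
  proof (rule continuous_onI)
    fix x and ee :: real assume "0 < ee"
    then show "\<exists>d>0. \<forall>x'\<in>cball 0 (e/2). dist x' x < d \<longrightarrow> dist (a * x') (a * x) \<le> ee"
      using a0 by (intro exI[of _ "ee / absv a"])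
        (auto simp: dist_absv absv_mult field_simps simp flip: absv_mult right_diff_distrib)
  qed
  then have img: "compact ((\<lambda>x. a * x) ` cball (0::'a) (e/2))" using cpt compact_continuous_image by blast
  have "{x. absv x \<le> R} \<subseteq> (\<lambda>x. a * x) ` cball (0::'a) (e/2)"
  proof
    fix x assume "x \<in> {x::'a. absv x \<le> R}"
    then have "absv (x / a) \<le> e / 2" using a e a0
      by (simp add: absv_divide field_simps)
    then show "x \<in> (\<lambda>x. a * x) ` cball (0::'a) (e/2)"
      using a0 by (intro image_eqI[of _ _ "x / a"]) (auto simp: cb)
  qed
  then have "{x. absv x \<le> R} = ((\<lambda>x. a * x) ` cball (0::'a) (e/2)) \<inter> cball 0 R"
    by (auto simp: cb)
  then show ?thesis using img by (metis closed_cball compact_Int_closed)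
qed

lemma finite_net:
  assumes "0 < \<rho>"
  shows "\<exists>S::'a::nonarch_local_field set. finite S \<and> (\<forall>x. absv x \<le> R \<longrightarrow> (\<exists>s\<in>S. absv (x - s) \<le> \<rho>))"
proof -
  obtain S where S: "finite S" "{x::'a. absv x \<le> R} \<subseteq> (\<Union>x\<in>S. ball x \<rho>)"
    using compactE_image[OF compact_absv_ball[of R], of UNIV "\<lambda>x::'a. ball x \<rho>"] assms
    by (metis (no_types, lifting) UN_I UNIV_I centre_in_ball open_ball subsetI)
  then show ?thesis
    by (intro exI[of _ S]) (force simp: dist_absv absv_diff_commute)
qed

lemma countable_dense:
  "\<exists>Q::'a::nonarch_local_field set. countable Q \<and> 0 \<in> Q \<and> (\<forall>x e. 0 < e \<longrightarrow> (\<exists>q\<in>Q. absv (x - q) \<le> e))"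
proof -
  have "\<exists>S::'a set. finite S \<and> (\<forall>x. absv x \<le> real m \<longrightarrow> (\<exists>s\<in>S. absv (x - s) \<le> 1 / real (Suc k)))" for m k
    by (rule finite_net) simp
  then obtain S :: "nat \<Rightarrow> nat \<Rightarrow> 'a set" where S: "\<And>m k. finite (S m k)"
    "\<And>m k x. absv x \<le> real m \<Longrightarrow> \<exists>s\<in>S m k. absv (x - s) \<le> 1 / real (Suc k)"
    by metis
  show ?thesis
  proof (intro exI[of _ "insert 0 (\<Union>m. \<Union>k. S m k)"] conjI allI impI)
    show "countable (insert 0 (\<Union>m. \<Union>k. S m k))"
      by (auto intro!: countable_UN countable_finite[OF S(1)])
    fix x :: 'a and e :: real assume "0 < e"
    then obtain k where k: "1 / real (Suc k) < e" using nat_approx_posE by blast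
    obtain m where "absv x \<le> real m" using real_arch_simple by blast
    from S(2)[OF this, of k] k show "\<exists>q\<in>insert 0 (\<Union>m. \<Union>k. S m k). absv (x - q) \<le> e"
      by force
  qed simp
qed

section \<open>Entrywise bounds\<close>

definition mbound :: "'a::nonarch_local_field mat \<Rightarrow> real \<Rightarrow> bool" where
  "mbound A c \<longleftrightarrow> (\<forall>i<dim_row A. \<forall>j<dim_col A. absv (A $$ (i,j)) \<le> c)"

lemma mboundD: "mbound A c \<Longrightarrow> A \<in> carrier_mat m n \<Longrightarrow> i < m \<Longrightarrow> j < n \<Longrightarrow> absv (A $$ (i,j)) \<le> c"
  by (auto simp: mbound_def)

lemma mbound_mono: "mbound A c \<Longrightarrow> c \<le> d \<Longrightarrow> mbound A d"
  unfolding mbound_def by (meson order_trans)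

lemma mbound_add: "mbound A c \<Longrightarrow> mbound B c \<Longrightarrow> A \<in> carrier_mat m n \<Longrightarrow> B \<in> carrier_mat m n \<Longrightarrow> mbound (A + B) c"
  by (auto simp: mbound_def intro: absv_add_le)

lemma mbound_diff: "mbound A c \<Longrightarrow> mbound B c \<Longrightarrow> A \<in> carrier_mat m n \<Longrightarrow> B \<in> carrier_mat m n \<Longrightarrow> mbound (A - B) c"
  by (auto simp: mbound_def intro: absv_diff_le)

lemma mbound_uminus [simp]: "mbound (- A) c \<longleftrightarrow> mbound A c"
  by (auto simp: mbound_def)

lemma mbound_zero [simp]: "0 \<le> c \<Longrightarrow> mbound (0\<^sub>m m n) c"
  by (auto simp: mbound_def)

lemma mbound_one: "1 \<le> c \<Longrightarrow> mbound (1\<^sub>m n) c"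
  by (auto simp: mbound_def)

lemma mbound_diff_commute: "A \<in> carrier_mat m n \<Longrightarrow> B \<in> carrier_mat m n \<Longrightarrow> mbound (A - B) c \<longleftrightarrow> mbound (B - A) c"
  by (auto simp: mbound_def absv_diff_commute)

lemma mbound_mult:
  assumes "mbound A a" "mbound B b" "0 \<le> a" "0 \<le> b" "A \<in> carrier_mat m n" "B \<in> carrier_mat n l"
  shows "mbound (A * B) (a * b)"
  unfolding mbound_def
proof (intro allI impI)
  fix i j assume ij: "i < dim_row (A * B)" "j < dim_col (A * B)"
  have "absv ((A * B) $$ (i,j)) = absv (\<Sum>k = 0..<n. A $$ (i,k) * B $$ (k,j))"
    using assms ij by (simp add: scalar_prod_def)
  also have "\<dots> \<le> a * b"
    using assms ij by (intro absv_sum_le) (auto simp: absv_mult mbound_def intro!: mult_mono)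
  finally show "absv ((A * B) $$ (i,j)) \<le> a * b" .
qed

lemma mbound_mult1:
  assumes "mbound A 1" "mbound B b" "0 \<le> b" "A \<in> carrier_mat m n" "B \<in> carrier_mat n l"
  shows "mbound (A * B) b"
  using mbound_mult[OF assms(1,2) _ assms(3-5)] by simp

lemma mbound_mult2:
  assumes "mbound A a" "mbound B 1" "0 \<le> a" "A \<in> carrier_mat m n" "B \<in> carrier_mat n l"
  shows "mbound (A * B) a"
  using mbound_mult[OF assms(1,2,3) _ assms(4-5)] by simp

lemma mbound_exists: "\<exists>c. 1 \<le> c \<and> mbound A c"
proof -
  let ?S = "insert 1 ((\<lambda>ij. absv (A $$ ij)) ` ({..<dim_row A} \<times> {..<dim_col A}))"
  have "finite ?S" by simp
  then have "mbound A (Max ?S)" unfolding mbound_def by (auto intro!: Max_ge)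
  moreover have "1 \<le> Max ?S" by (intro Max_ge) auto
  ultimately show ?thesis by blast
qed

lemma mbound_from_near_1:
  assumes "A \<in> carrier_mat n n" "mbound (A - 1\<^sub>m n) c" "c \<le> 1"
  shows "mbound A 1"
proof -
  have "mbound ((A - 1\<^sub>m n) + 1\<^sub>m n) 1"
    using assms by (intro mbound_add[of _ _ _ n n] mbound_mono[OF assms(2,3)] mbound_one) auto
  moreover have "(A - 1\<^sub>m n) + 1\<^sub>m n = A" using assms by auto
  ultimately show ?thesis by simp
qed

lemma mbound_small:
  assumes "finite S" 
  shows "\<exists>c\<ge>1. \<forall>A\<in>S. mbound A c"
  using assms
proof (induction S)
  case empty
  then show ?case by (intro exI[of _ 1]) simp
next
  case (insert A S)
  then obtain c where "c \<ge> 1" "\<forall>A\<in>S. mbound A c" by blast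
  moreover obtain d where "d \<ge> 1" "mbound A d" using mbound_exists by blast
  ultimately show ?case by (intro exI[of _ "max c d"]) (auto intro: mbound_mono)
qed

section \<open>General linear groups\<close>

lemma ring_mat_monoid: "Group.monoid (ring_mat TYPE('a::field) n ())"
proof -
  interpret ring "ring_mat TYPE('a) n ()" by (rule ring_mat)
  show ?thesis by (rule monoid_axioms)
qed

lemma GL_group [simp]: "group (GL n :: 'a::field mat monoid)"
  unfolding GL_def by (rule monoid.units_group) (rule ring_mat_monoid)

lemma GL_mult [simp]: "A \<otimes>\<^bsub>GL n\<^esub> B = A * B"
  by (simp add: GL_def units_of_def ring_mat_def)

lemma GL_one [simp]: "\<one>\<^bsub>GL n\<^esub> = 1\<^sub>m n"
  by (simp add: GL_def units_of_def ring_mat_def)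

lemma GL_carrier: "carrier (GL n) = {A \<in> carrier_mat n n. det A \<noteq> (0::'a::field)}"
  unfolding GL_def units_of_carrier
  using det_non_zero_imp_unit[where ?'a='a and b="()" and n=n] unit_imp_det_non_zero[where ?'a='a and b="()" and n=n]
  by (auto simp: Units_def ring_mat_def)

lemma GL_memI: "A \<in> carrier_mat n n \<Longrightarrow> det A \<noteq> 0 \<Longrightarrow> A \<in> carrier (GL n)"
  by (simp add: GL_carrier)

lemma GL_det: "A \<in> carrier (GL n) \<Longrightarrow> det A \<noteq> 0"
  by (simp add: GL_carrier)

lemma GL_carrier_mat [simp]: "A \<in> carrier (GL n) \<Longrightarrow> A \<in> carrier_mat n n"
  by (simp add: GL_carrier)

lemma GL_mult_closed [simp]: "A \<in> carrier (GL n) \<Longrightarrow> B \<in> carrier (GL n) \<Longrightarrow> A * B \<in> carrier (GL n)"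
  using group.is_monoid[OF GL_group] monoid.m_closed by fastforce

lemma GL_one_closed [simp]: "1\<^sub>m n \<in> carrier (GL n)"
  by (simp add: GL_memI)

abbreviation GLinv :: "nat \<Rightarrow> 'a::field mat \<Rightarrow> 'a mat" where
  "GLinv n A \<equiv> inv\<^bsub>GL n\<^esub> A"

lemma GL_inv [simp]:
  assumes "A \<in> carrier (GL n)"
  shows "GLinv n A \<in> carrier (GL n)" "GLinv n A * A = 1\<^sub>m n" "A * GLinv n A = 1\<^sub>m n" "GLinv n A \<in> carrier_mat n n"
  using group.inv_closed[OF GL_group assms] group.l_inv[OF GL_group assms] group.r_inv[OF GL_group assms]
  by auto

lemma GL_intro:
  assumes "A \<in> carrier_mat n n" "B \<in> carrier_mat n n" "A * B = 1\<^sub>m n"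
  shows "A \<in> carrier (GL n)" "B \<in> carrier (GL n)" "GLinv n A = B"
proof -
  have "det A * det B = 1" using assms det_mult[of A n B] by simp
  then have "det A \<noteq> 0" "det B \<noteq> 0" by auto
  then show A: "A \<in> carrier (GL n)" and B: "B \<in> carrier (GL n)" using assms(1,2) by (auto intro: GL_memI)
  have "B * A = 1\<^sub>m n" by (rule mat_mult_left_right_inverse[OF assms])
  then show "GLinv n A = B"
    by (intro group.inv_equality[OF GL_group _ A B]) simp
qed

lemma GL_near_1:
  assumes A: "A \<in> carrier_mat n n" and b: "mbound (A - 1\<^sub>m n) c" and c: "c < 1" "0 \<le> c"
  shows "A \<in> carrier (GL n)" "mbound (GLinv n A - 1\<^sub>m n) c"
proof -
  have "det A \<noteq> 0"
  proof
    assume "det A = 0"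
    then have "\<exists>v. v \<in> carrier_vec n \<and> v \<noteq> 0\<^sub>v n \<and> A *\<^sub>v v = 0\<^sub>v n"
      by (rule iffD1[OF det_0_iff_vec_prod_zero[OF A]])
    then obtain v where v: "v \<in> carrier_vec n" "v \<noteq> 0\<^sub>v n" "A *\<^sub>v v = 0\<^sub>v n" by blast
    have "\<exists>i<n. v $ i \<noteq> 0"
    proof (rule ccontr)
      assume "\<not> ?thesis"
      then have "v = 0\<^sub>v n" using v(1) by (intro eq_vecI) auto
      with v(2) show False by blast
    qed
    then obtain i where i: "i < n" "v $ i \<noteq> 0" by blast
    define S where "S = (\<lambda>i. absv (v $ i)) ` {..<n}"
    have S: "finite S" "S \<noteq> {}" using i by (auto simp: S_def)
    obtain k where k: "k < n" "absv (v $ k) = Max S" using Max_in[OF S] by (auto simp: S_def)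
    have le: "absv (v $ j) \<le> absv (v $ k)" if "j < n" for j
      unfolding k(2) using S that by (auto simp: S_def intro!: Max_ge)
    have k0: "absv (v $ k) > 0" using le[OF i(1)] i(2) by (meson absv_pos_iff less_le_trans)
    have "(A - 1\<^sub>m n) *\<^sub>v v = A *\<^sub>v v - 1\<^sub>m n *\<^sub>v v"
      by (rule minus_mult_distrib_mat_vec[OF A _ v(1)]) simp
    also have "\<dots> = - v" unfolding v(3) using v(1) by (intro eq_vecI) auto
    finally have "- v $ k = ((A - 1\<^sub>m n) *\<^sub>v v) $ k" using k v by auto
    also have "\<dots> = (\<Sum>j = 0..<n. (A - 1\<^sub>m n) $$ (k,j) * v $ j)"
      using k v A by (simp add: scalar_prod_def)
    finally have "absv (v $ k) = absv (\<Sum>j = 0..<n. (A - 1\<^sub>m n) $$ (k,j) * v $ j)"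
      by (metis absv_minus)
    also have "\<dots> \<le> c * absv (v $ k)"
    proof (intro absv_sum_le)
      fix j assume j: "j \<in> {0..<n}"
      have "absv ((A - 1\<^sub>m n) $$ (k,j)) \<le> c"
        using b k j by (intro mboundD[OF b]) auto
      with le[of j] j c show "absv ((A - 1\<^sub>m n) $$ (k,j) * v $ j) \<le> c * absv (v $ k)"
        unfolding absv_mult by (intro mult_mono) auto
    qed (use c in auto)
    also have "\<dots> < absv (v $ k)" using k0 c by simp
    finally show False by simp
  qed
  then show AG: "A \<in> carrier (GL n)" using A by (simp add: GL_memI)
  let ?I = "GLinv n A"
  have I: "?I \<in> carrier_mat n n" using AG by simp
  have A1: "A - 1\<^sub>m n \<in> carrier_mat n n" by (rule minus_carrier_mat) simp
  obtain m where m: "1 \<le> m" "mbound ?I m" using mbound_exists by blast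
  have eq: "?I - 1\<^sub>m n = - (?I * (A - 1\<^sub>m n))"
    unfolding mult_minus_distrib_mat[OF I A one_carrier_mat] right_mult_one_mat[OF I] GL_inv(2)[OF AG]
    using I by (intro eq_matI) auto
  \<comment> \<open>The least bound of the inverse cannot exceed 1: bootstrapping the identity above.\<close>
  have step: "mbound ?I (max 1 (m * c ^ k))" for k
  proof (induction k)
    case 0 then show ?case using m by (auto intro: mbound_mono)
  next
    case (Suc k)
    have "mbound (?I - 1\<^sub>m n) (max 1 (m * c ^ k) * c)"
      unfolding eq mbound_uminus by (rule mbound_mult[OF Suc b _ c(2) I A1]) simp
    moreover have "max 1 (m * c ^ k) * c \<le> max 1 (m * c ^ Suc k)"
      using c by (auto simp: max_def mult_ac)
    ultimately have "mbound (?I - 1\<^sub>m n) (max 1 (m * c ^ Suc k))" by (rule mbound_mono)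
    moreover have "mbound (1\<^sub>m n) (max 1 (m * c ^ Suc k))" by (rule mbound_one) simp
    moreover have "?I = (?I - 1\<^sub>m n) + 1\<^sub>m n" using I by (intro eq_matI) auto
    ultimately show ?case using mbound_add[of "?I - 1\<^sub>m n" _ "1\<^sub>m n" n n] by (metis minus_carrier_mat one_carrier_mat)
  qed
  have "(\<lambda>k. m * c ^ k) \<longlonglongrightarrow> m * 0" using c by (intro tendsto_intros LIMSEQ_realpow_zero) auto
  then have "eventually (\<lambda>k. m * c ^ k < 1) sequentially"
    using order_tendstoD(2)[of "\<lambda>k. m * c ^ k" 0 sequentially 1] by simp
  then obtain k where "m * c ^ k < 1" by (auto simp: eventually_sequentially)
  then have "mbound ?I 1" using step[of k] by (auto intro: mbound_mono)
  then show "mbound (?I - 1\<^sub>m n) c" unfolding eq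
    using mbound_mult1[OF _ b c(2) I A1] by simp
qed

locale locally_profinite_group = group G for G :: "'a monoid" (structure) +
  fixes T :: "'a topology" and K :: "nat \<Rightarrow> 'a set"
  assumes openin_iff: "openin T U \<longleftrightarrow> U \<subseteq> carrier G \<and> (\<forall>x\<in>U. \<exists>i. x <# K i \<subseteq> U)"
    and K_subgroup: "subgroup (K i) G"
    and K_decreasing: "decseq K"
    and K_conj: "g \<in> carrier G \<Longrightarrow> \<exists>j. \<forall>k\<in>K j. inv g \<otimes> k \<otimes> g \<in> K i"
    and K_compact: "compactin T (K 0)"
    and K_countable: "countable ((\<lambda>x. x <# K i) ` carrier G)"
begin

definition lcs :: "nat \<Rightarrow> 'a set set" where
  "lcs i = (\<lambda>x. x <# K i) ` carrier G"

definition sub_lcs :: "nat \<Rightarrow> 'a set \<Rightarrow> 'a set set" where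
  "sub_lcs i S = {X \<in> lcs i. X \<subseteq> S}"

lemma open_sub: "openin T U \<Longrightarrow> U \<subseteq> carrier G"
  using openin_iff[of U] by simp

lemma openE: "openin T U \<Longrightarrow> x \<in> U \<Longrightarrow> (\<And>i. x <# K i \<subseteq> U \<Longrightarrow> thesis) \<Longrightarrow> thesis"
  using openin_iff[of U] by auto

lemma K_sub: "K i \<subseteq> carrier G"
  using K_subgroup by (rule subgroup.subset)

lemma K_one: "\<one> \<in> K i"
  using K_subgroup by (rule subgroup.one_closed)

lemma lcs_sub: "X \<in> lcs i \<Longrightarrow> X \<subseteq> carrier G"
  unfolding lcs_def using l_coset_subset_G[OF K_sub] by blast

lemma lcs_self: "x \<in> carrier G \<Longrightarrow> x \<in> x <# K i"
  using K_one by (force simp: l_coset_def)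

lemma lcs_nonempty: "X \<in> lcs i \<Longrightarrow> X \<noteq> {}"
  unfolding lcs_def using lcs_self by blast

lemma lcs_eq: "X \<in> lcs i \<Longrightarrow> y \<in> X \<Longrightarrow> X = y <# K i"
  unfolding lcs_def using l_repr_independence[OF _ _ K_subgroup] by blast

lemma sub_lcsE:
  assumes "X \<in> sub_lcs i S" obtains x where "X \<in> lcs i" "x \<in> X" "x \<in> S"
proof -
  have X: "X \<in> lcs i" "X \<subseteq> S" using assms by (simp_all add: sub_lcs_def)
  then obtain x where "x \<in> X" using lcs_nonempty by blast
  then show thesis using X that by blast
qed

lemma sub_lcsD: "X \<in> sub_lcs i S \<Longrightarrow> X \<subseteq> S"
  by (simp add: sub_lcs_def)

lemma K_lcs: "K i \<in> lcs i"
  unfolding lcs_def by (rule image_eqI[of _ _ \<one>]) (simp_all add: lcos_mult_one K_sub)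

lemma lcs_mono: "i \<le> j \<Longrightarrow> x <# K j \<subseteq> x <# K i"
  using decseqD[OF K_decreasing] by (auto simp: l_coset_def)

lemma lcs_nested:
  assumes "X \<in> lcs i" "Y \<in> lcs j" "i \<le> j" "X \<inter> Y \<noteq> {}"
  shows "Y \<subseteq> X"
proof -
  obtain y where y: "y \<in> X" "y \<in> Y" using assms by blast
  show ?thesis using lcs_eq[OF assms(1) y(1)] lcs_eq[OF assms(2) y(2)] lcs_mono[OF assms(3)] by metis
qed

lemma lcs_disjoint: "X \<in> lcs i \<Longrightarrow> Y \<in> lcs i \<Longrightarrow> X \<inter> Y \<noteq> {} \<Longrightarrow> X = Y"
  by (intro equalityI lcs_nested[of Y i X i] lcs_nested[of X i Y i]) (auto simp: Int_commute)

lemma lcs_translate: "g \<in> carrier G \<Longrightarrow> X \<in> lcs i \<Longrightarrow> g <# X \<in> lcs i"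
  by (auto simp: lcs_def lcos_m_assoc[OF K_sub])

lemma lcs_open:
  assumes X: "X \<in> lcs i" shows "openin T X"
proof -
  have "x <# K i \<subseteq> X" if "x \<in> X" for x using lcs_eq[OF X that] by simp
  then show ?thesis unfolding openin_iff using lcs_sub[OF X] by blast
qed

lemma topspace_eq: "topspace T = carrier G"
proof
  show "topspace T \<subseteq> carrier G" by (rule open_sub) simp
  have "openin T (carrier G)"
    unfolding openin_iff using l_coset_subset_G[OF K_sub] by simp
  then show "carrier G \<subseteq> topspace T" by (rule openin_subset)
qed

lemma in_lcs: "x \<in> carrier G \<Longrightarrow> \<exists>X\<in>lcs i. x \<in> X"
  using lcs_self by (auto simp: lcs_def)

lemma Union_lcs: "\<Union>(lcs i) = carrier G"
proof
  show "\<Union>(lcs i) \<subseteq> carrier G" using lcs_sub by (rule Union_least)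
  show "carrier G \<subseteq> \<Union>(lcs i)" using in_lcs by blast
qed

lemma continuous_left: 
  assumes "g \<in> carrier G" shows "continuous_map T T (\<lambda>x. g \<otimes> x)"
  unfolding continuous_map_def topspace_eq
proof (intro conjI allI impI)
  show "(\<lambda>x. g \<otimes> x) \<in> carrier G \<rightarrow> carrier G" using assms by auto
  fix U assume U: "openin T U"
  show "openin T {x \<in> carrier G. g \<otimes> x \<in> U}"
    unfolding openin_iff
  proof (intro conjI ballI)
    fix x assume x: "x \<in> {x \<in> carrier G. g \<otimes> x \<in> U}"
    then obtain i where i: "(g \<otimes> x) <# K i \<subseteq> U" using openE[OF U] by blast
    have "x <# K i \<subseteq> {x \<in> carrier G. g \<otimes> x \<in> U}"
    proof
      fix y assume "y \<in> x <# K i"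
      then obtain k where k: "k \<in> K i" "y = x \<otimes> k" by (auto simp: l_coset_def)
      then have "g \<otimes> y = (g \<otimes> x) \<otimes> k" using assms x subsetD[OF K_sub k(1)] by (auto simp: m_assoc)
      then have "g \<otimes> y \<in> (g \<otimes> x) <# K i" using k by (auto simp: l_coset_def)
      then show "y \<in> {x \<in> carrier G. g \<otimes> x \<in> U}" using i k x K_sub by auto
    qed
    then show "\<exists>i. x <# K i \<subseteq> {x \<in> carrier G. g \<otimes> x \<in> U}" by (intro exI[of _ i])
  qed (rule Collect_restrict)
qed

lemma continuous_right: 
  assumes g: "g \<in> carrier G" shows "continuous_map T T (\<lambda>x. x \<otimes> g)"
  unfolding continuous_map_def topspace_eq
proof (intro conjI allI impI)
  show "(\<lambda>x. x \<otimes> g) \<in> carrier G \<rightarrow> carrier G" using g by auto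
  fix U assume U: "openin T U"
  show "openin T {x \<in> carrier G. x \<otimes> g \<in> U}"
    unfolding openin_iff
  proof (intro conjI ballI)
    fix x assume x: "x \<in> {x \<in> carrier G. x \<otimes> g \<in> U}"
    then obtain i where i: "(x \<otimes> g) <# K i \<subseteq> U" using openE[OF U] by blast
    obtain j where j: "\<And>k. k \<in> K j \<Longrightarrow> inv g \<otimes> k \<otimes> g \<in> K i" using K_conj[OF g] by blast
    have "x <# K j \<subseteq> {x \<in> carrier G. x \<otimes> g \<in> U}"
    proof
      fix y assume "y \<in> x <# K j"
      then obtain k where k: "k \<in> K j" "y = x \<otimes> k" by (auto simp: l_coset_def)
      then have kc: "k \<in> carrier G" using K_sub by blast
      have "g \<otimes> (inv g \<otimes> (k \<otimes> g)) = k \<otimes> g" using g kc by (simp flip: m_assoc)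
      then have "y \<otimes> g = (x \<otimes> g) \<otimes> (inv g \<otimes> k \<otimes> g)" using g x k(2) kc
        by (simp add: m_assoc)
      then have "y \<otimes> g \<in> (x \<otimes> g) <# K i" using j[OF k(1)] by (auto simp: l_coset_def)
      then show "y \<in> {x \<in> carrier G. x \<otimes> g \<in> U}" using i k kc x by auto
    qed
    then show "\<exists>i. x <# K i \<subseteq> {x \<in> carrier G. x \<otimes> g \<in> U}" by (intro exI[of _ j])
  qed (rule Collect_restrict)
qed

definition level :: "nat \<Rightarrow> 'a set \<Rightarrow> bool" where
  "level i S \<longleftrightarrow> finite (sub_lcs i S) \<and> S = \<Union>(sub_lcs i S)"

lemma level_dichotomy:
  assumes S: "level i S" and X: "X \<in> lcs i" "X \<inter> S \<noteq> {}" shows "X \<subseteq> S"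
proof -
  obtain x where x: "x \<in> X" "x \<in> S" using X by blast
  then obtain Y where Y: "Y \<in> lcs i" "Y \<subseteq> S" "x \<in> Y"
    using S unfolding level_def sub_lcs_def by blast
  then show ?thesis using lcs_disjoint[OF X(1), of Y] x by blast
qed

lemma levelI:
  assumes "finite C" "C \<subseteq> lcs i" shows "level i (\<Union>C)"
proof -
  have "sub_lcs i (\<Union>C) = C"
  proof
    show "sub_lcs i (\<Union>C) \<subseteq> C"
    proof
      fix X assume X: "X \<in> sub_lcs i (\<Union>C)"
      then obtain x where x: "X \<in> lcs i" "x \<in> X" "x \<in> \<Union>C" by (rule sub_lcsE)
      then obtain Y where Y: "Y \<in> C" "x \<in> Y" by blast
      then have "X = Y" using x assms(2) by (intro lcs_disjoint[of X i Y]) auto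
      then show "X \<in> C" using Y by simp
    qed
  qed (use assms in \<open>auto simp: sub_lcs_def\<close>)
  then show ?thesis using assms by (simp add: level_def)
qed

lemma finite_sub_lcs_K: "finite (sub_lcs j (K 0))"
proof -
  have "\<forall>X\<in>lcs j. openin T X" using lcs_open by blast
  moreover have "K 0 \<subseteq> \<Union>(lcs j)" using Union_lcs K_sub by blast
  ultimately obtain F where F: "finite F" "F \<subseteq> lcs j" "K 0 \<subseteq> \<Union>F"
    using K_compact unfolding compactin_def by metis
  have "sub_lcs j (K 0) \<subseteq> F"
  proof
    fix X assume X: "X \<in> sub_lcs j (K 0)"
    then obtain x where x: "X \<in> lcs j" "x \<in> X" "x \<in> K 0" by (rule sub_lcsE)
    then obtain Y where Y: "Y \<in> F" "x \<in> Y" using F by blast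
    then have "X = Y" using x F(2) by (intro lcs_disjoint[of X j Y]) auto
    then show "X \<in> F" using Y by simp
  qed
  then show ?thesis using F finite_subset by blast
qed

lemma level_lcs_refine:
  assumes X: "X \<in> lcs i" and ij: "i \<le> j"
  shows "level j X" "card (sub_lcs j X) = card (sub_lcs j (K i))"
proof -
  obtain x where x: "x \<in> carrier G" "X = x <# K i" using X by (auto simp: lcs_def)
  have un: "Y = \<Union>(sub_lcs j Y)" if "Y \<in> lcs i" for Y
  proof
    show "Y \<subseteq> \<Union>(sub_lcs j Y)"
    proof
      fix y assume y: "y \<in> Y"
      then have "y \<in> carrier G" using lcs_sub[OF that] by blast
      then obtain Z where Z: "Z \<in> lcs j" "y \<in> Z" using in_lcs by blast
      then have "Z \<subseteq> Y" using y by (intro lcs_nested[OF that Z(1) ij]) blast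
      then show "y \<in> \<Union>(sub_lcs j Y)" using Z by (auto simp: sub_lcs_def)
    qed
  qed (auto simp: sub_lcs_def)
  have bij: "bij_betw (\<lambda>Y. x <# Y) (sub_lcs j (K i)) (sub_lcs j X)"
  proof (rule bij_betw_byWitness[where f' = "\<lambda>Y. inv x <# Y"])
    show "\<forall>a\<in>sub_lcs j (K i). inv x <# (x <# a) = a" "\<forall>a'\<in>sub_lcs j X. x <# (inv x <# a') = a'"
      using x lcs_sub by (auto simp: sub_lcs_def lcos_m_assoc lcos_mult_one)
    show "(\<lambda>Y. x <# Y) ` sub_lcs j (K i) \<subseteq> sub_lcs j X"
      using x lcs_translate by (auto simp: sub_lcs_def l_coset_def)
    have "inv x <# X = K i" using x K_sub by (simp add: lcos_m_assoc lcos_mult_one)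
    then have "inv x <# Y \<subseteq> K i" if "Y \<subseteq> X" for Y
      using that unfolding l_coset_def by blast
    then show "(\<lambda>Y. inv x <# Y) ` sub_lcs j X \<subseteq> sub_lcs j (K i)"
      using x(1) lcs_translate[of "inv x"] by (auto simp: sub_lcs_def)
  qed
  have "K i \<subseteq> K 0" using decseqD[OF K_decreasing] by blast
  then have "finite (sub_lcs j (K i))"
    by (intro finite_subset[OF _ finite_sub_lcs_K]) (auto simp: sub_lcs_def)
  then show "level j X" using bij bij_betw_finite un[OF X] by (auto simp: level_def)
  show "card (sub_lcs j X) = card (sub_lcs j (K i))" using bij by (metis bij_betw_same_card)
qed

definition idx :: "nat \<Rightarrow> nat \<Rightarrow> nat" where
  "idx i j = card (sub_lcs j (K i))"

lemma idx_pos: "i \<le> j \<Longrightarrow> 0 < idx i j"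
  unfolding idx_def using level_lcs_refine(1)[OF K_lcs, of i j] K_one[of i]
  by (auto simp: level_def card_gt_0_iff)

lemma sub_lcs_refine:
  assumes S: "level i S" and ij: "i \<le> j"
  shows "sub_lcs j S = (\<Union>X\<in>sub_lcs i S. sub_lcs j X)"
proof
  show "sub_lcs j S \<subseteq> (\<Union>X\<in>sub_lcs i S. sub_lcs j X)"
  proof
    fix Y assume Y: "Y \<in> sub_lcs j S"
    then obtain y where y: "y \<in> Y" "y \<in> S" by (rule sub_lcsE)
    then obtain X where X: "X \<in> sub_lcs i S" "y \<in> X" using S by (auto simp: level_def)
    then have "Y \<subseteq> X" using lcs_nested[OF _ _ ij, of X Y] Y y by (auto simp: sub_lcs_def)
    then show "Y \<in> (\<Union>X\<in>sub_lcs i S. sub_lcs j X)" using X Y by (auto simp: sub_lcs_def)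
  qed
qed (auto simp: sub_lcs_def)

lemma level_refine:
  assumes S: "level i S" and ij: "i \<le> j"
  shows "level j S" "card (sub_lcs j S) = card (sub_lcs i S) * idx i j"
proof -
  have fin: "finite (sub_lcs i S)" and un: "S = \<Union>(sub_lcs i S)" using S by (auto simp: level_def)
  have lev: "level j X" "card (sub_lcs j X) = idx i j" if "X \<in> sub_lcs i S" for X
    using level_lcs_refine[OF _ ij, of X] that by (auto simp: idx_def sub_lcs_def)
  have finX: "finite (sub_lcs j X)" if "X \<in> sub_lcs i S" for X
    using lev(1)[OF that] by (simp add: level_def)
  have "\<Union>(sub_lcs j S) = (\<Union>X\<in>sub_lcs i S. \<Union>(sub_lcs j X))"
    unfolding sub_lcs_refine[OF assms] by blast
  also have "\<dots> = (\<Union>X\<in>sub_lcs i S. X)"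
    using lev(1) by (intro SUP_cong) (auto simp: level_def)
  finally have "\<Union>(sub_lcs j S) = S" using un by simp
  then show "level j S" using fin finX unfolding level_def sub_lcs_refine[OF assms] by auto
  have "card (\<Union>X\<in>sub_lcs i S. sub_lcs j X) = (\<Sum>X\<in>sub_lcs i S. card (sub_lcs j X))"
  proof (rule card_UN_disjoint[OF fin])
    show "\<forall>i\<in>sub_lcs i S. finite (sub_lcs j i)" using finX by blast
    show "\<forall>ia\<in>sub_lcs i S. \<forall>ja\<in>sub_lcs i S. ia \<noteq> ja \<longrightarrow> sub_lcs j ia \<inter> sub_lcs j ja = {}"
    proof (intro ballI impI Int_emptyI)
      fix X Y Z assume "X \<in> sub_lcs i S" "Y \<in> sub_lcs i S" "X \<noteq> Y" "Z \<in> sub_lcs j X" "Z \<in> sub_lcs j Y"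
      then have XY: "X \<in> lcs i" "Y \<in> lcs i" "X \<noteq> Y" "Z \<subseteq> X" "Z \<subseteq> Y" "Z \<noteq> {}"
        using lcs_nonempty[of Z j] by (auto simp: sub_lcs_def)
      then show False using lcs_disjoint[of X i Y] by blast
    qed
  qed
  then show "card (sub_lcs j S) = card (sub_lcs i S) * idx i j"
    unfolding sub_lcs_refine[OF assms] using lev(2) by simp
qed

definition vol :: "'a set \<Rightarrow> real" where
  "vol S = (let i = (LEAST i. level i S) in real (card (sub_lcs i S)) / real (idx 0 i))"

lemma vol_eq:
  assumes "level i S" shows "vol S = real (card (sub_lcs i S)) / real (idx 0 i)"
proof -
  define m where "m = (LEAST i. level i S)"
  have m: "level m S" "m \<le> i" unfolding m_def using assms by (auto intro: LeastI Least_le)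
  have "idx 0 i = idx 0 m * idx m i"
    using level_refine(2)[OF level_lcs_refine(1)[OF K_lcs, of 0 m] m(2)] by (simp add: idx_def)
  moreover have "card (sub_lcs i S) = card (sub_lcs m S) * idx m i" by (rule level_refine(2)[OF m])
  ultimately show ?thesis using idx_pos[of m i] m(2) by (simp add: vol_def Let_def flip: m_def)
qed

lemma idx_self: "idx i i = 1"
proof -
  have "sub_lcs i (K i) = {K i}"
  proof
    show "sub_lcs i (K i) \<subseteq> {K i}"
    proof
      fix Y assume "Y \<in> sub_lcs i (K i)"
      then obtain y where "Y \<in> lcs i" "y \<in> Y" "y \<in> K i" by (rule sub_lcsE)
      then show "Y \<in> {K i}" using lcs_disjoint[OF _ K_lcs, of Y i] by blast
    qed
  qed (use K_lcs in \<open>auto simp: sub_lcs_def\<close>)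
  then show ?thesis by (simp add: idx_def)
qed

definition cring :: "'a set set" where
  "cring = {S. \<exists>i. level i S}"

lemma cring_common:
  assumes "A \<in> cring" "B \<in> cring" obtains i where "level i A" "level i B"
proof -
  obtain a b where "level a A" "level b B" using assms by (auto simp: cring_def)
  then have "level (max a b) A" "level (max a b) B" using level_refine(1) by auto
  then show thesis by (rule that)
qed

lemma level_Un:
  assumes "level i A" "level i B"
  shows "level i (A \<union> B)" "sub_lcs i (A \<union> B) = sub_lcs i A \<union> sub_lcs i B"
proof -
  show eq: "sub_lcs i (A \<union> B) = sub_lcs i A \<union> sub_lcs i B"
    using level_dichotomy[OF assms(1)] level_dichotomy[OF assms(2)] lcs_nonempty
    unfolding sub_lcs_def by blast
  show "level i (A \<union> B)" using assms eq by (auto simp: level_def)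
qed

lemma level_Diff:
  assumes "level i A" "level i B" shows "level i (A - B)"
proof -
  have "\<Union>(sub_lcs i A - sub_lcs i B) = A - B"
    using assms level_dichotomy[OF assms(2)] unfolding level_def sub_lcs_def by blast
  moreover have "level i (\<Union>(sub_lcs i A - sub_lcs i B))"
    using assms by (intro levelI) (auto simp: level_def sub_lcs_def)
  ultimately show ?thesis by simp
qed

lemma ring_of_sets_cring: "ring_of_sets (carrier G) cring"
  unfolding ring_of_sets_iff
proof (intro conjI ballI)
  show "cring \<subseteq> Pow (carrier G)"
  proof
    fix S assume "S \<in> cring"
    then obtain i where "S = \<Union>(sub_lcs i S)" by (auto simp: cring_def level_def)
    moreover have "\<Union>(sub_lcs i S) \<subseteq> carrier G"
      using lcs_sub by (intro Union_least) (auto simp: sub_lcs_def)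
    ultimately show "S \<in> Pow (carrier G)" by simp
  qed
  show "{} \<in> cring" using levelI[of "{}" 0] by (auto simp: cring_def)
  fix A B assume "A \<in> cring" "B \<in> cring"
  then obtain i where "level i A" "level i B" by (rule cring_common)
  then show "A \<union> B \<in> cring" "A - B \<in> cring"
    using level_Un(1)[of i A B] level_Diff[of i A B] unfolding cring_def by blast+
qed

lemma lcs_in_cring: "X \<in> lcs i \<Longrightarrow> X \<in> cring"
  using levelI[of "{X}" i] by (auto simp: cring_def)

lemma compact_cring:
  assumes "S \<in> cring" shows "compactin T S"
proof -
  obtain i where "level i S" using assms by (auto simp: cring_def)
  then have S: "finite (sub_lcs i S)" "S = \<Union>(sub_lcs i S)" by (auto simp: level_def)
  have "compactin T (K i)"
  proof (rule closed_compactin[OF K_compact])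
    show "K i \<subseteq> K 0" using decseqD[OF K_decreasing] by blast
    have "carrier G - K i = \<Union>(lcs i - {K i})"
    proof
      show "carrier G - K i \<subseteq> \<Union>(lcs i - {K i})"
        using Union_lcs[of i] by blast
      show "\<Union>(lcs i - {K i}) \<subseteq> carrier G - K i"
      proof
        fix x assume "x \<in> \<Union>(lcs i - {K i})"
        then obtain X where X: "X \<in> lcs i" "X \<noteq> K i" "x \<in> X" by blast
        then show "x \<in> carrier G - K i" using lcs_disjoint[OF K_lcs X(1)] lcs_sub[OF X(1)] by blast
      qed
    qed
    moreover have "openin T (\<Union>(lcs i - {K i}))" using lcs_open by (intro openin_Union) auto
    ultimately show "closedin T (K i)" unfolding closedin_def topspace_eq using K_sub by auto
  qed
  then have "compactin T X" if "X \<in> lcs i" for X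
  proof -
    obtain x where x: "x \<in> carrier G" "X = x <# K i" using \<open>X \<in> lcs i\<close> by (auto simp: lcs_def)
    have "X = (\<lambda>y. x \<otimes> y) ` K i" unfolding x(2) l_coset_def by blast
    then show ?thesis using image_compactin[OF \<open>compactin T (K i)\<close> continuous_left[OF x(1)]] by simp
  qed
  then have "\<forall>X\<in>sub_lcs i S. compactin T X" by (simp add: sub_lcs_def)
  then show ?thesis using S compactin_Union[of "sub_lcs i S" T] by metis
qed

lemma open_cring: "S \<in> cring \<Longrightarrow> openin T S"
proof -
  assume "S \<in> cring"
  then obtain i where "S = \<Union>(sub_lcs i S)" by (auto simp: cring_def level_def)
  moreover have "openin T (\<Union>(sub_lcs i S))"
    by (intro openin_Union) (auto simp: sub_lcs_def intro: lcs_open)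
  ultimately show "openin T S" by simp
qed

lemma closed_cring:
  assumes "S \<in> cring" shows "openin T (carrier G - S)"
proof -
  obtain i where S: "level i S" using assms by (auto simp: cring_def)
  have "carrier G - S = \<Union>{X \<in> lcs i. X \<inter> S = {}}"
  proof
    show "carrier G - S \<subseteq> \<Union>{X \<in> lcs i. X \<inter> S = {}}"
    proof
      fix x assume x: "x \<in> carrier G - S"
      then obtain X where X: "X \<in> lcs i" "x \<in> X" using in_lcs[of x i] by blast
      then have "X \<inter> S = {}" using level_dichotomy[OF S X(1)] x by blast
      then show "x \<in> \<Union>{X \<in> lcs i. X \<inter> S = {}}" using X by blast
    qed
    show "\<Union>{X \<in> lcs i. X \<inter> S = {}} \<subseteq> carrier G - S" using lcs_sub[of _ i] by auto
  qed
  moreover have "openin T (\<Union>{X \<in> lcs i. X \<inter> S = {}})"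
    by (intro openin_Union) (auto intro: lcs_open)
  ultimately show ?thesis by simp
qed

lemma vol_additive:
  assumes "A \<in> cring" "B \<in> cring" "A \<inter> B = {}" shows "vol (A \<union> B) = vol A + vol B"
proof -
  obtain i where i: "level i A" "level i B" using assms cring_common by blast
  have "sub_lcs i A \<inter> sub_lcs i B = {}"
  proof (rule Int_emptyI)
    fix X assume X: "X \<in> sub_lcs i A" "X \<in> sub_lcs i B"
    obtain x where "x \<in> X" "x \<in> A" using X(1) by (rule sub_lcsE)
    then show False using sub_lcsD[OF X(2)] assms(3) by blast
  qed
  then have "card (sub_lcs i (A \<union> B)) = card (sub_lcs i A) + card (sub_lcs i B)"
    using i by (simp add: level_Un card_Un_disjoint level_def)
  then show ?thesis using vol_eq i level_Un(1)[OF i] by (simp add: add_divide_distrib)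
qed

lemma vol_nonneg: "0 \<le> vol S"
  by (simp add: vol_def Let_def)

lemma vol_lcs: "X \<in> lcs i \<Longrightarrow> vol X = 1 / real (idx 0 i)"
proof -
  assume X: "X \<in> lcs i"
  have "sub_lcs i X = {X}"
  proof
    show "sub_lcs i X \<subseteq> {X}"
    proof
      fix Y assume "Y \<in> sub_lcs i X"
      then obtain y where "Y \<in> lcs i" "y \<in> Y" "y \<in> X" by (rule sub_lcsE)
      then show "Y \<in> {X}" using lcs_disjoint[OF _ X, of Y] by blast
    qed
  qed (use X in \<open>auto simp: sub_lcs_def\<close>)
  moreover have "level i X" using level_lcs_refine(1)[OF X] by simp
  ultimately show ?thesis using vol_eq by simp
qed


definition borel_sets :: "'a set set" where
  "borel_sets = sigma_sets (carrier G) {U. openin T U}"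

lemma open_Pow: "{U. openin T U} \<subseteq> Pow (carrier G)"
  using open_sub by blast

lemma countable_lcs: "countable (lcs i)"
  unfolding lcs_def by (rule K_countable)

lemma open_countable_Union:
  assumes "openin T U" shows "\<exists>C. countable C \<and> C \<subseteq> (\<Union>i. lcs i) \<and> U = \<Union>C"
proof (intro exI conjI)
  let ?C = "{X \<in> (\<Union>i. lcs i). X \<subseteq> U}"
  show "countable ?C"
    by (rule countable_subset[of _ "\<Union>i. lcs i"]) (auto intro: countable_lcs)
  show "U = \<Union>?C"
  proof
    show "U \<subseteq> \<Union>?C"
    proof
      fix x assume x: "x \<in> U"
      then obtain i where "x <# K i \<subseteq> U" using openE[OF assms] by blast
      moreover have "x \<in> carrier G" using open_sub[OF assms] x by blast
      then have "x <# K i \<in> lcs i" "x \<in> x <# K i" using lcs_self by (auto simp: lcs_def)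
      ultimately show "x \<in> \<Union>?C" by blast
    qed
  qed blast
qed blast

lemma borel_sets_eq:
  assumes "(\<Union>i. lcs i) \<subseteq> E" "\<And>S. S \<in> E \<Longrightarrow> openin T S"
  shows "borel_sets = sigma_sets (carrier G) E"
  unfolding borel_sets_def
proof (rule sigma_sets_eqI)
  fix U assume "U \<in> {U. openin T U}"
  then obtain C where C: "countable C" "C \<subseteq> (\<Union>i. lcs i)" "U = \<Union>C"
    using open_countable_Union by blast
  have "E \<subseteq> Pow (carrier G)" using assms(2) open_sub by blast
  then interpret sigma_algebra "carrier G" "sigma_sets (carrier G) E"
    by (rule sigma_algebra_sigma_sets)
  have "C \<subseteq> sigma_sets (carrier G) E" using C assms(1) by (auto intro: sigma_sets.Basic)
  then show "U \<in> sigma_sets (carrier G) E" unfolding C(3) using C(1) by (intro countable_Union)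
next
  fix S assume "S \<in> E"
  then show "S \<in> sigma_sets (carrier G) {U. openin T U}" using assms(2) by (intro sigma_sets.Basic) simp
qed

lemma measure_eqI_lcs:
  assumes M: "sets M = borel_sets" and N: "sets N = borel_sets"
    and eq: "\<And>i X. X \<in> lcs i \<Longrightarrow> emeasure M X = emeasure N X"
    and fin: "\<And>i X. X \<in> lcs i \<Longrightarrow> emeasure M X \<noteq> \<infinity>"
  shows "M = N"
proof -
  let ?E = "insert {} (\<Union>i. lcs i)"
  have E: "borel_sets = sigma_sets (carrier G) ?E"
    by (rule borel_sets_eq) (auto intro: lcs_open)
  show ?thesis
  proof (rule measure_eqI_generator_eq_countable[of ?E "carrier G" M N "lcs 0"])
    show "Int_stable ?E"
    proof (rule Int_stableI)
      fix A B assume AB: "A \<in> ?E" "B \<in> ?E"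
      show "A \<inter> B \<in> ?E"
      proof (cases "A \<inter> B = {}")
        case False
        then obtain i j where ij: "A \<in> lcs i" "B \<in> lcs j" using AB by auto
        have "B \<subseteq> A \<or> A \<subseteq> B"
          using lcs_nested[OF ij] lcs_nested[OF ij(2,1)] False by (metis Int_commute nle_le)
        then show ?thesis using AB by (metis Int_absorb1 Int_absorb2)
      qed simp
    qed
    show "?E \<subseteq> Pow (carrier G)" using lcs_sub by auto
    show "sets M = sigma_sets (carrier G) ?E" "sets N = sigma_sets (carrier G) ?E" using M N E by auto
    show "\<Union>(lcs 0) = carrier G" by (rule Union_lcs)
  qed (use eq fin countable_lcs in auto)
qed

lemma vol_continuous:
  assumes A: "range A \<subseteq> cring" "decseq A" "(\<Inter>i. A i) = {}"
  shows "\<exists>n. A n = {}"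
proof -
  have car: "A n \<subseteq> carrier G" for n using A(1) open_cring open_sub by blast
  have "compactin T (A 0)" using A(1) by (intro compact_cring) auto
  moreover have "\<forall>U\<in>range (\<lambda>n. carrier G - A n). openin T U"
    using A(1) closed_cring by auto
  moreover have "A 0 \<subseteq> \<Union>(range (\<lambda>n. carrier G - A n))"
  proof
    fix x assume "x \<in> A 0"
    moreover obtain n where "x \<notin> A n" using A(3) by blast
    ultimately show "x \<in> \<Union>(range (\<lambda>n. carrier G - A n))" using car by auto
  qed
  ultimately obtain F where F: "finite F" "F \<subseteq> range (\<lambda>n. carrier G - A n)" "A 0 \<subseteq> \<Union>F"
    unfolding compactin_def by metis
  then obtain N where N: "finite N" "F = (\<lambda>n. carrier G - A n) ` N"
    by (metis finite_subset_image)
  define m where "m = Max (insert 0 N)"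
  have "A m \<subseteq> A n" if "n \<in> N" for n
    using decseqD[OF A(2)] N(1) that unfolding m_def by (meson Max_ge finite_insert insertI2)
  then have "A m \<inter> \<Union>F = {}" unfolding N(2) by blast
  moreover have "A m \<subseteq> A 0" using decseqD[OF A(2)] by simp
  ultimately have "A m = {}" using F(3) by blast
  then show ?thesis ..
qed

lemma vol_translate:
  assumes g: "g \<in> carrier G" and X: "X \<in> lcs i" shows "vol (g <# X) = vol X"
  using vol_lcs[OF X] vol_lcs[OF lcs_translate[OF g X]] by simp

lemma translate_left_vimage:
  assumes "g \<in> carrier G" "A \<subseteq> carrier G"
  shows "(\<lambda>x. inv g \<otimes> x) -` A \<inter> carrier G = g <# A"
proof
  show "(\<lambda>x. inv g \<otimes> x) -` A \<inter> carrier G \<subseteq> g <# A"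
  proof
    fix x assume x: "x \<in> (\<lambda>x. inv g \<otimes> x) -` A \<inter> carrier G"
    then have "x = g \<otimes> (inv g \<otimes> x)" using assms by (simp flip: m_assoc)
    then show "x \<in> g <# A" using x unfolding l_coset_def by blast
  qed
  show "g <# A \<subseteq> (\<lambda>x. inv g \<otimes> x) -` A \<inter> carrier G"
  proof
    fix x assume "x \<in> g <# A"
    then obtain a where a: "a \<in> A" "x = g \<otimes> a" unfolding l_coset_def by blast
    then have "inv g \<otimes> x = a" using assms by (simp add: subsetD flip: m_assoc)
    then show "x \<in> (\<lambda>x. inv g \<otimes> x) -` A \<inter> carrier G" using a assms by auto
  qed
qed

lemma translate_right_vimage:
  assumes "g \<in> carrier G" "A \<subseteq> carrier G"
  shows "(\<lambda>x. x \<otimes> g) -` A \<inter> carrier G = A #> inv g"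
proof
  show "(\<lambda>x. x \<otimes> g) -` A \<inter> carrier G \<subseteq> A #> inv g"
  proof
    fix x assume x: "x \<in> (\<lambda>x. x \<otimes> g) -` A \<inter> carrier G"
    then have "x = (x \<otimes> g) \<otimes> inv g" using assms by (simp add: m_assoc)
    then show "x \<in> A #> inv g" using x unfolding r_coset_def by blast
  qed
  show "A #> inv g \<subseteq> (\<lambda>x. x \<otimes> g) -` A \<inter> carrier G"
  proof
    fix x assume "x \<in> A #> inv g"
    then obtain a where a: "a \<in> A" "x = a \<otimes> inv g" unfolding r_coset_def by blast
    then have "x \<otimes> g = a" using assms by (simp add: subsetD m_assoc)
    then show "x \<in> (\<lambda>x. x \<otimes> g) -` A \<inter> carrier G" using a assms by auto
  qed
qed

lemma space_borel: "sets M = borel_sets \<Longrightarrow> space M = carrier G"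
  using sets_eq_imp_space_eq[of M "sigma (carrier G) {U. openin T U}"] open_Pow
  by (simp add: borel_sets_def)

lemma continuous_measurable:
  assumes M: "sets M = borel_sets" and f: "continuous_map T T f"
  shows "f \<in> measurable M M"
proof (rule measurable_sigma_sets[OF M[unfolded borel_sets_def] open_Pow])
  show "f \<in> space M \<rightarrow> carrier G"
    using f unfolding space_borel[OF M] continuous_map_def topspace_eq by blast
  fix U assume "U \<in> {U. openin T U}"
  then have "openin T {x \<in> carrier G. f x \<in> U}"
    using f unfolding continuous_map_def topspace_eq by blast
  moreover have "f -` U \<inter> space M = {x \<in> carrier G. f x \<in> U}" using space_borel[OF M] by auto
  ultimately show "f -` U \<inter> space M \<in> sets M" unfolding M borel_sets_def by (simp add: sigma_sets.Basic)
qed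

lemma haar_sets: "left_haar G T M \<Longrightarrow> sets M = borel_sets"
  by (simp add: left_haar_def borel_sets_def topspace_eq)

lemma haar_exists: "\<exists>M. left_haar G T M \<and> emeasure M (K 0) = 1"
proof -
  interpret R: ring_of_sets "carrier G" cring by (rule ring_of_sets_cring)
  have "\<exists>\<mu>. (\<forall>S\<in>cring. \<mu> S = ennreal (vol S)) \<and> measure_space (carrier G) (sigma_sets (carrier G) cring) \<mu>"
  proof (rule R.caratheodory_empty_continuous)
    have v0: "vol {} = 0" using vol_additive[of "{}" "{}"] R.empty_sets by simp
    then show "positive cring (\<lambda>S. ennreal (vol S))" by (simp add: positive_def)
    show "additive cring (\<lambda>S. ennreal (vol S))"
      unfolding additive_def using vol_additive by (simp add: ennreal_plus[symmetric] vol_nonneg del: ennreal_plus)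
    show "ennreal (vol A) \<noteq> \<infinity>" for A by simp
    fix A assume A: "range A \<subseteq> cring" "decseq A" "(\<Inter>i. A i) = {}"
    then obtain n where n: "A n = {}" using vol_continuous by blast
    have "A m = {}" if "m \<ge> n" for m using decseqD[OF A(2) that] n by simp
    then have "eventually (\<lambda>m. ennreal (vol (A m)) = 0) sequentially"
      unfolding eventually_sequentially by (intro exI[of _ n]) (simp add: v0)
    then show "(\<lambda>i. ennreal (vol (A i))) \<longlonglongrightarrow> 0" by (rule tendsto_eventually)
  qed
  then obtain \<mu> where mu: "\<And>S. S \<in> cring \<Longrightarrow> \<mu> S = ennreal (vol S)"
    "measure_space (carrier G) (sigma_sets (carrier G) cring) \<mu>" by blast
  have bs: "borel_sets = sigma_sets (carrier G) cring"
    by (rule borel_sets_eq) (auto intro: lcs_in_cring open_cring)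
  define M where "M = measure_of (carrier G) cring \<mu>"
  have M: "sets M = borel_sets" unfolding M_def bs using R.space_closed by (simp add: sets_measure_of)
  have em: "emeasure M A = \<mu> A" if "A \<in> borel_sets" for A
    unfolding M_def using mu(2) that bs by (simp add: emeasure_measure_of_conv)
  have em_lcs: "emeasure M X = ennreal (1 / real (idx 0 i))" if "X \<in> lcs i" for i X
    using em[of X] mu(1)[OF lcs_in_cring[OF that]] vol_lcs[OF that] lcs_in_cring[OF that] bs
    by (simp add: sigma_sets.Basic)
  have fin: "emeasure M X \<noteq> \<infinity>" if "X \<in> lcs i" for i X
    using em_lcs[OF that] by simp
  have "left_haar G T M"
    unfolding left_haar_def
  proof (intro conjI ballI allI impI)
    show "sets M = sigma_sets (topspace T) {U. openin T U}"
      unfolding topspace_eq M borel_sets_def ..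
  next
    fix g A assume g: "g \<in> carrier G" and A: "A \<in> sets M"
    have A': "A \<subseteq> carrier G" using sets.sets_into_space[OF A] space_borel[OF M] by simp
    have meas: "(\<lambda>x. inv g \<otimes> x) \<in> measurable M M"
      by (rule continuous_measurable[OF M continuous_left[OF inv_closed[OF g]]])
    have dist: "emeasure (distr M M (\<lambda>x. inv g \<otimes> x)) B = emeasure M (g <# B)" if "B \<in> sets M" for B
    proof -
      have "B \<subseteq> carrier G" using sets.sets_into_space[OF that] space_borel[OF M] by simp
      then show ?thesis
        unfolding emeasure_distr[OF meas that] space_borel[OF M] by (simp only: translate_left_vimage[OF g])
    qed
    have "distr M M (\<lambda>x. inv g \<otimes> x) = M"
    proof (rule measure_eqI_lcs)
      fix i X assume X: "X \<in> lcs i"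
      have "X \<in> sets M" unfolding M borel_sets_def using lcs_open[OF X] by (simp add: sigma_sets.Basic)
      then show eq: "emeasure (distr M M (\<lambda>x. inv g \<otimes> x)) X = emeasure M X"
        using dist em_lcs[OF X] em_lcs[OF lcs_translate[OF g X]] by simp
      then show "emeasure (distr M M (\<lambda>x. inv g \<otimes> x)) X \<noteq> \<infinity>" using fin[OF X] by simp
    qed (simp_all add: M)
    then show "emeasure M (g <# A) = emeasure M A" using dist[OF A] by simp
  next
    fix C assume C: "compactin T C"
    have "\<forall>X\<in>lcs 0. openin T X" using lcs_open by blast
    moreover have "C \<subseteq> \<Union>(lcs 0)"
      using compactin_subset_topspace[OF C] unfolding topspace_eq Union_lcs .
    ultimately obtain F where F: "finite F" "F \<subseteq> lcs 0" "C \<subseteq> \<Union>F"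
      using C unfolding compactin_def by metis
    have Fs: "X \<in> sets M" if "X \<in> F" for X
      unfolding M borel_sets_def using lcs_open[of X 0] F(2) that by (auto intro: sigma_sets.Basic)
    have "emeasure M C \<le> emeasure M (\<Union>X\<in>F. X)"
      using F Fs by (intro emeasure_mono) auto
    also have "\<dots> \<le> (\<Sum>X\<in>F. emeasure M X)"
      using F(1) Fs by (intro emeasure_subadditive_finite) auto
    also have "\<dots> < \<infinity>"
      using F(1,2) fin by (auto simp: less_top)
    finally show "emeasure M C < \<infinity>" .
  next
    fix U assume U: "openin T U \<and> U \<noteq> {}"
    then obtain x where x: "x \<in> U" by blast
    obtain i where i: "x <# K i \<subseteq> U" using openE[OF _ x] U by blast
    have "x \<in> carrier G" using open_sub[of U] U x by blast
    then have X: "x <# K i \<in> lcs i" by (simp add: lcs_def)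
    have "0 < emeasure M (x <# K i)"
      unfolding em_lcs[OF X] using idx_pos[of 0 i] by simp
    also have "\<dots> \<le> emeasure M U"
      using i U unfolding M borel_sets_def by (intro emeasure_mono) (auto simp: M borel_sets_def intro: sigma_sets.Basic)
    finally show "0 < emeasure M U" .
  qed
  moreover have "emeasure M (K 0) = 1"
    using em_lcs[OF K_lcs, of 0] level_lcs_refine(1)[OF K_lcs, of 0 0] vol_lcs[OF K_lcs, of 0] idx_pos[of 0 0]
    by (simp add: idx_self)
  ultimately show ?thesis by blast
qed

lemma haar_lcs:
  assumes M: "left_haar G T M"
  obtains m where "0 < m" "\<And>i X. X \<in> lcs i \<Longrightarrow> emeasure M X = ennreal (m / real (idx 0 i))"
proof -
  note sM = haar_sets[OF M]
  have Xs: "X \<in> sets M" if "X \<in> lcs i" for i X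
    unfolding sM borel_sets_def using lcs_open[OF that] by (simp add: sigma_sets.Basic)
  have fin: "emeasure M (K i) \<noteq> \<infinity>" and pos: "emeasure M (K i) \<noteq> 0" for i
    using M compact_cring[OF lcs_in_cring[OF K_lcs[of i]]] lcs_open[OF K_lcs[of i]] lcs_nonempty[OF K_lcs[of i]]
    unfolding left_haar_def by (metis infinity_ennreal_def less_irrefl)+
  have tr: "emeasure M X = emeasure M (K i)" if "X \<in> lcs i" for i X
    using M Xs[OF K_lcs] that unfolding left_haar_def lcs_def by auto
  have cnt: "emeasure M (K 0) = of_nat (idx 0 i) * emeasure M (K i)" for i
  proof -
    have lev: "level i (K 0)" by (rule level_lcs_refine(1)[OF K_lcs]) simp
    then have "emeasure M (K 0) = emeasure M (\<Union>X\<in>sub_lcs i (K 0). X)" by (simp add: level_def)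
    also have "\<dots> = (\<Sum>X\<in>sub_lcs i (K 0). emeasure M X)"
    proof (rule sum_emeasure[symmetric])
      show "disjoint_family_on (\<lambda>X. X) (sub_lcs i (K 0))"
        using lcs_disjoint unfolding disjoint_family_on_def sub_lcs_def by blast
    qed (use lev Xs in \<open>auto simp: level_def sub_lcs_def\<close>)
    also have "\<dots> = (\<Sum>X\<in>sub_lcs i (K 0). emeasure M (K i))"
      by (intro sum.cong tr) (auto simp: sub_lcs_def)
    finally show ?thesis by (simp add: idx_def)
  qed
  define m where "m = measure M (K 0)"
  show thesis
  proof
    have m: "emeasure M (K 0) = ennreal m" unfolding m_def using fin[of 0] by (simp add: emeasure_eq_ennreal_measure)
    then show "0 < m" using pos[of 0] by (metis ennreal_eq_0_iff not_le)
    fix i X assume X: "X \<in> lcs i"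
    obtain a where a: "emeasure M (K i) = ennreal a" "0 \<le> a" using fin[of i] by (metis ennreal_cases infinity_ennreal_def)
    have "ennreal m = ennreal (real (idx 0 i) * a)"
      using cnt[of i] a m by (simp add: ennreal_mult ennreal_of_nat_eq_real_of_nat)
    then have "m = real (idx 0 i) * a" using a \<open>0 < m\<close> by (subst (asm) ennreal_inj) auto
    then show "emeasure M X = ennreal (m / real (idx 0 i))"
      using tr[OF X] a idx_pos[of 0 i] by simp
  qed
qed

lemma haar_unique:
  assumes M: "left_haar G T M" and N: "left_haar G T N"
  obtains c where "0 < c" "\<And>A. emeasure N A = ennreal c * emeasure M A"
proof -
  obtain m where m: "0 < m" "\<And>i X. X \<in> lcs i \<Longrightarrow> emeasure M X = ennreal (m / real (idx 0 i))"
    using haar_lcs[OF M] by blast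
  obtain n where n: "0 < n" "\<And>i X. X \<in> lcs i \<Longrightarrow> emeasure N X = ennreal (n / real (idx 0 i))"
    using haar_lcs[OF N] by blast
  have "N = scale_measure (ennreal (n / m)) M"
  proof (rule measure_eqI_lcs)
    fix i X assume X: "X \<in> lcs i"
    show "emeasure N X = emeasure (scale_measure (ennreal (n / m)) M) X"
      using m n X by (simp flip: ennreal_mult)
    show "emeasure N X \<noteq> \<infinity>" using n(2)[OF X] by simp
  qed (simp_all add: haar_sets[OF M] haar_sets[OF N])
  then have "emeasure N A = ennreal (n / m) * emeasure M A" for A by simp
  then show thesis using m(1) n(1) that[of "n / m"] by simp
qed

lemma haar_right_translate:
  assumes M: "left_haar G T M" and g: "g \<in> carrier G"
  shows "left_haar G T (distr M M (\<lambda>x. x \<otimes> g))"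
    and "A \<in> sets M \<Longrightarrow> emeasure (distr M M (\<lambda>x. x \<otimes> g)) A = emeasure M (A #> inv g)"
    and "A \<in> sets M \<Longrightarrow> A #> inv g \<in> sets M"
proof -
  note sM = haar_sets[OF M]
  have sub: "A \<subseteq> carrier G" if "A \<in> sets M" for A
    using sets.sets_into_space[OF that] space_borel[OF sM] by simp
  have meas: "(\<lambda>x. x \<otimes> g) \<in> measurable M M"
    by (rule continuous_measurable[OF sM continuous_right[OF g]])
  have dist: "emeasure (distr M M (\<lambda>x. x \<otimes> g)) A = emeasure M (A #> inv g)" if "A \<in> sets M" for A
    unfolding emeasure_distr[OF meas that] space_borel[OF sM] translate_right_vimage[OF g sub[OF that]] ..
  then show "A \<in> sets M \<Longrightarrow> emeasure (distr M M (\<lambda>x. x \<otimes> g)) A = emeasure M (A #> inv g)" .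
  have st: "A #> inv g \<in> sets M" if "A \<in> sets M" for A
    using measurable_sets[OF meas that] translate_right_vimage[OF g sub[OF that]] space_borel[OF sM] by simp
  then show "A \<in> sets M \<Longrightarrow> A #> inv g \<in> sets M" .
  have opn: "openin T (U #> inv g)" if "openin T U" for U
  proof -
    have "openin T {x \<in> carrier G. x \<otimes> g \<in> U}"
      using continuous_right[OF g] that unfolding continuous_map_def topspace_eq by blast
    moreover have "{x \<in> carrier G. x \<otimes> g \<in> U} = U #> inv g"
      using translate_right_vimage[OF g open_sub[OF that]] by auto
    ultimately show ?thesis by simp
  qed
  have opn_sets: "U \<in> sets M" if "openin T U" for U
    unfolding sM borel_sets_def using that by (simp add: sigma_sets.Basic)
  show "left_haar G T (distr M M (\<lambda>x. x \<otimes> g))"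
    unfolding left_haar_def
  proof (intro conjI ballI allI impI)
    show "sets (distr M M (\<lambda>x. x \<otimes> g)) = sigma_sets (topspace T) {U. openin T U}"
      using sM by (simp add: borel_sets_def topspace_eq)
  next
    fix h A assume h: "h \<in> carrier G" and "A \<in> sets (distr M M (\<lambda>x. x \<otimes> g))"
    then have A: "A \<in> sets M" by simp
    have hA: "h <# A \<in> sets M"
      using translate_left_vimage[OF h sub[OF A]] measurable_sets[OF continuous_measurable[OF sM continuous_left[of "inv h"]] A] h
      by (simp add: space_borel[OF sM])
    have "emeasure M (h <# (A #> inv g)) = emeasure M (A #> inv g)"
      using M st[OF A] h unfolding left_haar_def by blast
    then show "emeasure (distr M M (\<lambda>x. x \<otimes> g)) (h <# A) = emeasure (distr M M (\<lambda>x. x \<otimes> g)) A"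
      unfolding dist[OF A] dist[OF hA] using coset_assoc[OF h _ sub[OF A], of "inv g"] g by simp
  next
    fix C assume C: "compactin T C"
    have C': "C \<subseteq> carrier G" using compactin_subset_topspace[OF C] by (simp add: topspace_eq)
    have "compactin T (C #> inv g)"
    proof -
      have "C #> inv g = (\<lambda>x. x \<otimes> inv g) ` C" unfolding r_coset_def by blast
      then show ?thesis using image_compactin[OF C continuous_right[of "inv g"]] g by simp
    qed
    then have fin: "emeasure M (C #> inv g) < \<infinity>" using M unfolding left_haar_def by blast
    show "emeasure (distr M M (\<lambda>x. x \<otimes> g)) C < \<infinity>"
      using fin dist[of C] by (cases "C \<in> sets M") (simp_all add: emeasure_notin_sets)
  next
    fix U assume U: "openin T U \<and> U \<noteq> {}"
    then have "U #> inv g \<noteq> {}" by (auto simp: r_coset_def)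
    then have "0 < emeasure M (U #> inv g)"
      using M opn[of U] U unfolding left_haar_def by blast
    then show "0 < emeasure (distr M M (\<lambda>x. x \<otimes> g)) U" using dist[OF opn_sets[of U]] U by simp
  qed
qed

lemma modulus_props:
  assumes g: "g \<in> carrier G"
  shows modulus_pos: "0 < modulus G T g"
    and modulus_eq: "left_haar G T M \<Longrightarrow> A \<in> sets M \<Longrightarrow>
      emeasure M (A #> inv g) = ennreal (modulus G T g) * emeasure M A"
proof -
  let ?P = "\<lambda>c::real. 0 < c \<and> (\<forall>M. left_haar G T M \<longrightarrow>
     (\<forall>A\<in>sets M. emeasure M (A #> inv g) = ennreal c * emeasure M A))"
  obtain M0 where M0: "left_haar G T M0" "emeasure M0 (K 0) = 1" using haar_exists by blast
  obtain c where c: "0 < c" "\<And>A. emeasure (distr M0 M0 (\<lambda>x. x \<otimes> g)) A = ennreal c * emeasure M0 A"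
    using haar_unique[OF M0(1) haar_right_translate(1)[OF M0(1) g]] by blast
  have "?P c"
  proof (intro conjI allI impI ballI)
    fix M A assume M: "left_haar G T M" and A: "A \<in> sets M"
    obtain d where d: "0 < d" "\<And>A. emeasure M A = ennreal d * emeasure M0 A"
      using haar_unique[OF M0(1) M] by blast
    have "A \<in> sets M0" using A haar_sets[OF M] haar_sets[OF M0(1)] by simp
    then have "emeasure M0 (A #> inv g) = ennreal c * emeasure M0 A"
      using c(2)[of A] haar_right_translate(2)[OF M0(1) g] by simp
    then show "emeasure M (A #> inv g) = ennreal c * emeasure M A" by (simp add: d(2) mult_ac)
  qed (rule c)
  moreover have "c' = c" if "?P c'" for c'
  proof -
    have K0: "K 0 \<in> sets M0" unfolding haar_sets[OF M0(1)] borel_sets_def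
      using lcs_open[OF K_lcs] by (simp add: sigma_sets.Basic)
    have "emeasure M0 (K 0 #> inv g) = ennreal c'" using that M0 K0 by simp
    moreover have "emeasure M0 (K 0 #> inv g) = ennreal c" using \<open>?P c\<close> M0 K0 by simp
    ultimately have "ennreal c' = ennreal c" by simp
    then show ?thesis using that c(1) by (subst (asm) ennreal_inj) auto
  qed
  ultimately have "?P (modulus G T g)"
    unfolding modulus_def by (intro theI[of ?P c])
  then show "0 < modulus G T g"
    and "left_haar G T M \<Longrightarrow> A \<in> sets M \<Longrightarrow> emeasure M (A #> inv g) = ennreal (modulus G T g) * emeasure M A"
    by auto
qed

text \<open>Testing against the compact open set \<open>K 0\<close>, of finite non-zero measure, determines the modulus.\<close>

lemma modulus_eqI:
  assumes g: "g \<in> carrier G" and c: "0 \<le> c"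
    and eq: "\<And>M. left_haar G T M \<Longrightarrow> emeasure M (K 0 #> inv g) = ennreal c * emeasure M (K 0)"
  shows "modulus G T g = c"
proof -
  obtain M0 where M0: "left_haar G T M0" "emeasure M0 (K 0) = 1" using haar_exists by blast
  have K0: "K 0 \<in> sets M0" unfolding haar_sets[OF M0(1)] borel_sets_def
    using lcs_open[OF K_lcs] by (simp add: sigma_sets.Basic)
  have "ennreal (modulus G T g) = ennreal c"
    using eq[OF M0(1)] modulus_eq[OF g M0(1) K0] M0(2) by simp
  then show ?thesis using modulus_pos[OF g] c by (subst (asm) ennreal_inj) auto
qed

lemma modulus_mult:
  assumes g: "g \<in> carrier G" and h: "h \<in> carrier G"
  shows "modulus G T (g \<otimes> h) = modulus G T g * modulus G T h"
proof (rule modulus_eqI)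
  fix M assume M: "left_haar G T M"
  have K0: "K 0 \<in> sets M" unfolding haar_sets[OF M] borel_sets_def
    using lcs_open[OF K_lcs] by (simp add: sigma_sets.Basic)
  have "K 0 #> inv (g \<otimes> h) = (K 0 #> inv h) #> inv g"
    using g h K_sub by (simp add: inv_mult_group coset_mult_assoc)
  then show "emeasure M (K 0 #> inv (g \<otimes> h)) = ennreal (modulus G T g * modulus G T h) * emeasure M (K 0)"
    unfolding modulus_eq[OF g M haar_right_translate(3)[OF M h K0]] modulus_eq[OF h M K0]
      ennreal_mult[OF less_imp_le[OF modulus_pos[OF g]] less_imp_le[OF modulus_pos[OF h]]]
    by (simp only: modulus_eq[OF g M haar_right_translate(3)[OF M h K0]] modulus_eq[OF h M K0] mult.assoc)
qed (use g h modulus_pos[OF g] modulus_pos[OF h] in simp_all)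

lemma modulus_K:
  assumes k: "k \<in> K 0" shows "modulus G T k = 1"
proof (rule modulus_eqI)
  show "k \<in> carrier G" using subsetD[OF K_sub k] .
  have ik: "inv k \<in> K 0" using subgroup.m_inv_closed[OF K_subgroup k] .
  have "K 0 #> inv k = K 0" using coset_join2[OF subsetD[OF K_sub ik] K_subgroup ik] .
  then show "emeasure M (K 0 #> inv k) = ennreal 1 * emeasure M (K 0)" for M by simp
qed simp

lemma modulus_central:
  assumes g: "g \<in> carrier G" and comm: "\<And>x. x \<in> carrier G \<Longrightarrow> x \<otimes> inv g = inv g \<otimes> x"
  shows "modulus G T g = 1"
proof (rule modulus_eqI[OF g])
  fix M assume M: "left_haar G T M"
  have K0: "K 0 \<in> sets M" unfolding haar_sets[OF M] borel_sets_def
    using lcs_open[OF K_lcs] by (simp add: sigma_sets.Basic)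
  have "K 0 #> inv g = inv g <# K 0"
    using comm subsetD[OF K_sub] unfolding r_coset_def l_coset_def by simp
  then show "emeasure M (K 0 #> inv g) = ennreal 1 * emeasure M (K 0)"
    using M g K0 unfolding left_haar_def by simp
qed simp

end

abbreviation entries :: "nat \<Rightarrow> 'a mat \<Rightarrow> nat \<times> nat \<Rightarrow> 'a" where
  "entries n A \<equiv> (\<lambda>ij\<in>{..<n} \<times> {..<n}. A $$ ij)"

lemma openin_GL_topology:
  fixes U :: "'a::nonarch_local_field mat set"
  shows "openin (GL_topology n) U \<longleftrightarrow> U \<subseteq> carrier (GL n) \<and>
    (\<forall>x\<in>U. \<exists>e>0. \<forall>y\<in>carrier (GL n). mbound (y - x) e \<longrightarrow> y \<in> U)" (is "_ \<longleftrightarrow> ?R")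
proof
  let ?I = "{..<n} \<times> {..<n}"
  assume "openin (GL_topology n) U"
  then obtain V where V: "openin (product_topology (\<lambda>_. euclidean) ?I) V"
    "U = entries n -` V \<inter> carrier (GL n)"
    unfolding GL_topology_def openin_pullback_topology by blast
  show ?R
  proof (intro conjI ballI)
    show "U \<subseteq> carrier (GL n)" unfolding V(2) by blast
    fix x assume x: "x \<in> U"
    then have "entries n x \<in> V" using V(2) by blast
    then have "\<exists>W. finite {i \<in> ?I. W i \<noteq> topspace euclidean} \<and> (\<forall>i\<in>?I. openin euclidean (W i)) \<and>
        entries n x \<in> Pi\<^sub>E ?I W \<and> Pi\<^sub>E ?I W \<subseteq> V"
      by (rule V(1)[unfolded openin_product_topology_alt, THEN bspec])
    then obtain W where "finite {i \<in> ?I. W i \<noteq> topspace euclidean} \<and> (\<forall>i\<in>?I. openin euclidean (W i)) \<and>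
        entries n x \<in> Pi\<^sub>E ?I W \<and> Pi\<^sub>E ?I W \<subseteq> V" by (rule exE)
    note W' = conjunct2[OF this]
    have "openin euclidean (W i)" if "i \<in> ?I" for i
      using conjunct1[OF W'] that by (rule bspec)
    then have W: "\<And>i. i \<in> ?I \<Longrightarrow> open (W i)" "entries n x \<in> Pi\<^sub>E ?I W" "Pi\<^sub>E ?I W \<subseteq> V"
      using conjunct2[OF W'] unfolding open_openin[symmetric] by auto
    have "\<exists>e>0. \<forall>z. absv (z - x $$ ij) \<le> e \<longrightarrow> z \<in> W ij" if ij: "ij \<in> ?I" for ij
    proof -
      have "x $$ ij \<in> W ij" using W(2) ij by (auto simp: PiE_iff)
      then obtain e where e: "e > 0" "\<forall>z. dist z (x $$ ij) < e \<longrightarrow> z \<in> W ij"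
        using W(1)[OF ij] unfolding open_dist by blast
      then show ?thesis by (intro exI[of _ "e/2"]) (auto simp: dist_absv)
    qed
    then obtain e where e: "\<And>ij. ij \<in> ?I \<Longrightarrow> e ij > 0"
      "\<And>ij z. ij \<in> ?I \<Longrightarrow> absv (z - x $$ ij) \<le> e ij \<Longrightarrow> z \<in> W ij" by metis
    define m where "m = Min (insert 1 (e ` ?I))"
    have m0: "m > 0" unfolding m_def using e(1) by (subst Min_gr_iff) auto
    have m: "m \<le> e ij" if "ij \<in> ?I" for ij unfolding m_def using that by (intro Min_le) auto
    have "y \<in> U" if y: "y \<in> carrier (GL n)" "mbound (y - x) m" for y
    proof -
      have xc: "x \<in> carrier_mat n n" using x V(2) by simp
      have "y $$ ij \<in> W ij" if ij: "ij \<in> ?I" for ij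
      proof -
        obtain i j where [simp]: "ij = (i,j)" by (cases ij)
        have "absv ((y - x) $$ (i,j)) \<le> m"
          using ij xc by (intro mboundD[OF y(2), of n n]) auto
        then show ?thesis using e(2)[OF ij] m[OF ij] ij xc GL_carrier_mat[OF y(1)] by auto
      qed
      then have "entries n y \<in> Pi\<^sub>E ?I W" by (simp add: PiE_iff)
      then show ?thesis unfolding V(2) using W(3) y(1) by blast
    qed
    then show "\<exists>e>0. \<forall>y\<in>carrier (GL n). mbound (y - x) e \<longrightarrow> y \<in> U"
      by (intro exI[of _ m] conjI ballI impI m0)
  qed
next
  let ?I = "{..<n} \<times> {..<n}"
  assume R: ?R
  then obtain e where e: "\<And>x. x \<in> U \<Longrightarrow> e x > 0"
    "\<And>x y. x \<in> U \<Longrightarrow> y \<in> carrier (GL n) \<Longrightarrow> mbound (y - x) (e x) \<Longrightarrow> y \<in> U" by metis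
  define V where "V = (\<Union>x\<in>U. Pi\<^sub>E ?I (\<lambda>ij. ball (x $$ ij) (e x)))"
  have "openin (product_topology (\<lambda>_. euclidean) ?I) V"
    unfolding V_def by (intro openin_Union) (auto simp: openin_PiE simp flip: open_openin)
  moreover have "U = entries n -` V \<inter> carrier (GL n)"
  proof (rule equalityI)
    show "U \<subseteq> entries n -` V \<inter> carrier (GL n)"
    proof
      fix x assume x: "x \<in> U"
      then have "entries n x \<in> Pi\<^sub>E ?I (\<lambda>ij. ball (x $$ ij) (e x))" using e(1)[OF x] by auto
      then show "x \<in> entries n -` V \<inter> carrier (GL n)" using x R unfolding V_def by blast
    qed
    show "entries n -` V \<inter> carrier (GL n) \<subseteq> U"
    proof
      fix y assume y: "y \<in> entries n -` V \<inter> carrier (GL n)"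
      then have "entries n y \<in> V" by blast
      then obtain x where x: "x \<in> U" "entries n y \<in> Pi\<^sub>E ?I (\<lambda>ij. ball (x $$ ij) (e x))"
        unfolding V_def by (rule UN_E)
      have xc: "x \<in> carrier_mat n n" using x(1) R by auto
      have "mbound (y - x) (e x)"
        unfolding mbound_def using x(2) xc y
        by (auto simp: PiE_iff dist_absv absv_diff_commute intro: less_imp_le)
      then show "y \<in> U" using e(2)[OF x(1)] y by blast
    qed
  qed
  ultimately show "openin (GL_topology n) U"
    unfolding GL_topology_def openin_pullback_topology by blast
qed

lemma topspace_GL_topology: "topspace (GL_topology n) = (carrier (GL n) :: 'a::nonarch_local_field mat set)"
proof
  show "topspace (GL_topology n) \<subseteq> (carrier (GL n) :: 'a mat set)"
    using openin_topspace[of "GL_topology n :: 'a mat topology"] unfolding openin_GL_topology by blast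
  have "openin (GL_topology n) (carrier (GL n) :: 'a mat set)"
    unfolding openin_GL_topology by (auto intro: exI[of _ 1])
  then show "(carrier (GL n) :: 'a mat set) \<subseteq> topspace (GL_topology n)" by (rule openin_subset)
qed

lemma mbound_self: "0 \<le> e \<Longrightarrow> mbound (x - x) e"
  by (simp add: mbound_def)

lemma openin_GL_sub:
  fixes U P :: "'a::nonarch_local_field mat set"
  assumes P: "P \<subseteq> carrier (GL n)"
  shows "openin (subtopology (GL_topology n) P) U \<longleftrightarrow> U \<subseteq> P \<and>
    (\<forall>x\<in>U. \<exists>e>0. \<forall>y\<in>P. mbound (y - x) e \<longrightarrow> y \<in> U)" (is "_ \<longleftrightarrow> ?R")
proof
  assume "openin (subtopology (GL_topology n) P) U"
  then obtain V where V: "openin (GL_topology n) V" "U = V \<inter> P"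
    unfolding openin_subtopology by blast
  show ?R using P V(1) unfolding V(2) openin_GL_topology by blast
next
  assume R: ?R
  then obtain e where e: "\<And>x. x \<in> U \<Longrightarrow> e x > 0"
    "\<And>x y. x \<in> U \<Longrightarrow> y \<in> P \<Longrightarrow> mbound (y - x) (e x) \<Longrightarrow> y \<in> U" by metis
  define V where "V = {y \<in> carrier (GL n). \<exists>x\<in>U. mbound (y - x) (e x)}"
  have "openin (GL_topology n) V"
    unfolding openin_GL_topology
  proof (intro conjI ballI)
    fix y assume "y \<in> V"
    then obtain x where x: "y \<in> carrier (GL n)" "x \<in> U" "mbound (y - x) (e x)" by (auto simp: V_def)
    have xc: "x \<in> carrier (GL n)" using R P x(2) by blast
    have "z \<in> V" if z: "z \<in> carrier (GL n)" "mbound (z - y) (e x)" for z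
    proof -
      have c: "x \<in> carrier_mat n n" "y \<in> carrier_mat n n" "z \<in> carrier_mat n n"
        using x(1) xc z(1) by auto
      have "mbound ((z - y) + (y - x)) (e x)"
        using c by (intro mbound_add[OF z(2) x(3), of n n]) auto
      moreover have "(z - y) + (y - x) = z - x" using c by (intro eq_matI) auto
      ultimately show ?thesis using x(2) z(1) by (auto simp: V_def)
    qed
    then show "\<exists>ea>0. \<forall>z\<in>carrier (GL n). mbound (z - y) ea \<longrightarrow> z \<in> V" using e(1)[OF x(2)] by blast
  qed (auto simp: V_def)
  moreover have "U = V \<inter> P"
  proof
    show "U \<subseteq> V \<inter> P"
    proof
      fix x assume x: "x \<in> U"
      then have "mbound (x - x) (e x)" using less_imp_le[OF e(1)] by (intro mbound_self) blast
      then show "x \<in> V \<inter> P" using x R P by (auto simp: V_def)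
    qed
    show "V \<inter> P \<subseteq> U" using e(2) by (auto simp: V_def)
  qed
  ultimately show "openin (subtopology (GL_topology n) P) U" unfolding openin_subtopology by blast
qed

lemma compactin_pullback_topology:
  assumes "compactin T (f ` C)" "C \<subseteq> A"
  shows "compactin (pullback_topology A f T) C"
  unfolding compactin_def
proof (intro conjI allI impI)
  show "C \<subseteq> topspace (pullback_topology A f T)"
    unfolding topspace_pullback_topology using assms compactin_subset_topspace[OF assms(1)] by blast
  fix \<U> assume U: "Ball \<U> (openin (pullback_topology A f T)) \<and> C \<subseteq> \<Union>\<U>"
  define \<V> where "\<V> = {V. openin T V \<and> f -` V \<inter> A \<in> \<U>}"
  have "f ` C \<subseteq> \<Union>\<V>"
  proof
    fix y assume "y \<in> f ` C"
    then obtain x S where x: "x \<in> C" "y = f x" "x \<in> S" "S \<in> \<U>" using U by blast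
    then obtain V where "openin T V" "S = f -` V \<inter> A" using U unfolding openin_pullback_topology by blast
    then show "y \<in> \<Union>\<V>" using x unfolding \<V>_def by blast
  qed
  moreover have "Ball \<V> (openin T)" by (auto simp: \<V>_def)
  ultimately obtain F where F: "finite F" "F \<subseteq> \<V>" "f ` C \<subseteq> \<Union>F"
    using assms(1) unfolding compactin_def by metis
  show "\<exists>\<F>. finite \<F> \<and> \<F> \<subseteq> \<U> \<and> C \<subseteq> \<Union>\<F>"
  proof (intro exI conjI)
    show "finite ((\<lambda>V. f -` V \<inter> A) ` F)" using F(1) by simp
    show "(\<lambda>V. f -` V \<inter> A) ` F \<subseteq> \<U>" using F(2) by (auto simp: \<V>_def)
    show "C \<subseteq> \<Union>((\<lambda>V. f -` V \<inter> A) ` F)" using F(3) assms(2) by blast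
  qed
qed

lemma compact_absv_ball_around: "compact {z::'a::nonarch_local_field. absv (z - c) \<le> e}"
proof -
  have "{z. absv (z - c) \<le> e} = {z. absv z \<le> max e (absv c)} \<inter> cball c e"
  proof (intro equalityI subsetI)
    fix z assume z: "z \<in> {z. absv (z - c) \<le> e}"
    have "absv ((z - c) + c) \<le> max e (absv c)" using z by (intro absv_add_le) auto
    then show "z \<in> {z. absv z \<le> max e (absv c)} \<inter> cball c e"
      using z by (simp add: dist_absv absv_diff_commute)
  qed (simp add: dist_absv absv_diff_commute)
  then show ?thesis using compact_Int_closed[OF compact_absv_ball closed_cball] by simp
qed

section \<open>The parabolic subgroup\<close>

lemma parabolic_iff:
  fixes p :: "'a::field mat"
  shows "p \<in> parabolic r s \<longleftrightarrow> p \<in> carrier (GL (r + s)) \<and> (\<forall>i<s. \<forall>j<r. p $$ (i + r, j) = 0)"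
proof
  assume "p \<in> parabolic r s"
  then obtain a x d where p: "p = four_block_mat a x (0\<^sub>m s r) d" "a \<in> carrier (GL r)"
    "x \<in> carrier_mat r s" "d \<in> carrier (GL s)" unfolding parabolic_def by blast
  have c: "a \<in> carrier_mat r r" "d \<in> carrier_mat s s" using p by auto
  have "det p = det a * det d"
    unfolding p(1) by (rule det_four_block_mat_lower_left_zero[OF c(1) p(3) refl c(2)])
  moreover have "det a \<noteq> 0" "det d \<noteq> 0" using p GL_det by auto
  ultimately have "det p \<noteq> 0" by simp
  moreover have "p \<in> carrier_mat (r + s) (r + s)" unfolding p(1) using c by simp
  ultimately show "p \<in> carrier (GL (r + s)) \<and> (\<forall>i<s. \<forall>j<r. p $$ (i + r, j) = 0)"
    using c p(1) by (auto intro: GL_memI)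
next
  assume p: "p \<in> carrier (GL (r + s)) \<and> (\<forall>i<s. \<forall>j<r. p $$ (i + r, j) = 0)"
  have pc: "p \<in> carrier_mat (r + s) (r + s)" using p by simp
  obtain a x c d where sb: "split_block p r r = (a, x, c, d)" by (metis prod_cases4)
  note bl = split_block[OF sb, of s s]
  have dims: "dim_row p = r + s" "dim_col p = r + s" using pc by auto
  note bl = bl[OF dims]
  have c0: "c = 0\<^sub>m s r"
  proof (rule eq_matI)
    fix i j assume "i < dim_row (0\<^sub>m s r :: 'a mat)" "j < dim_col (0\<^sub>m s r :: 'a mat)"
    then have ij: "i < s" "j < r" by auto
    have "c $$ (i, j) = p $$ (i + r, j)" unfolding bl(5) using bl(1-4) ij by auto
    then show "c $$ (i, j) = 0\<^sub>m s r $$ (i, j)" using p ij by simp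
  qed (use bl in auto)
  have "det p = det a * det d"
    unfolding bl(5) by (rule det_four_block_mat_lower_left_zero[OF bl(1,2) c0 bl(4)])
  moreover have "det p \<noteq> 0" using p GL_det by blast
  ultimately have "det a \<noteq> 0" "det d \<noteq> 0" by auto
  then have "a \<in> carrier (GL r)" "d \<in> carrier (GL s)" using bl by (auto intro: GL_memI)
  then show "p \<in> parabolic r s" unfolding parabolic_def using bl(2,5) c0 by blast
qed

lemma parabolicE:
  fixes p :: "'a::field mat"
  assumes "p \<in> parabolic r s"
  obtains a x d where "p = four_block_mat a x (0\<^sub>m s r) d" "a \<in> carrier (GL r)"
    "x \<in> carrier_mat r s" "d \<in> carrier (GL s)"
  using assms unfolding parabolic_def by blast

lemma parabolic_memI:
  fixes p :: "'a::field mat"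
  shows "p \<in> carrier (GL (r + s)) \<Longrightarrow> (\<And>i j. i < s \<Longrightarrow> j < r \<Longrightarrow> p $$ (i + r, j) = 0) \<Longrightarrow> p \<in> parabolic r s"
  by (simp add: parabolic_iff)

lemma parabolic_GL: "p \<in> parabolic r s \<Longrightarrow> p \<in> carrier (GL (r + s))"
  by (simp add: parabolic_iff)

lemma parabolic_zero: "p \<in> parabolic r s \<Longrightarrow> i < s \<Longrightarrow> j < r \<Longrightarrow> p $$ (i + r, j) = 0"
  by (simp add: parabolic_iff)

lemma four_block_parabolic:
  assumes "a \<in> carrier (GL r)" "x \<in> carrier_mat r s" "d \<in> carrier (GL s)"
  shows "four_block_mat a x (0\<^sub>m s r) d \<in> parabolic r s"
  unfolding parabolic_def using assms by blast

lemma parabolic_mult_blocks: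
  assumes "a \<in> carrier_mat r r" "x \<in> carrier_mat r s" "d \<in> carrier_mat s s"
    "a' \<in> carrier_mat r r" "x' \<in> carrier_mat r s" "d' \<in> carrier_mat s s"
  shows "four_block_mat a x (0\<^sub>m s r) d * four_block_mat a' x' (0\<^sub>m s r) d' =
    four_block_mat (a * a') (a * x' + x * d') (0\<^sub>m s r) (d * (d' :: 'a::field mat))"
proof -
  have "four_block_mat a x (0\<^sub>m s r) d * four_block_mat a' x' (0\<^sub>m s r) d' =
    four_block_mat (a * a' + x * 0\<^sub>m s r) (a * x' + x * d') (0\<^sub>m s r * a' + d * 0\<^sub>m s r) (0\<^sub>m s r * x' + d * d')"
    using assms by (intro mult_four_block_mat) auto
  moreover have "a * a' + x * 0\<^sub>m s r = a * a'" "0\<^sub>m s r * a' + d * 0\<^sub>m s r = 0\<^sub>m s r" "0\<^sub>m s r * x' + d * d' = d * d'"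
    using assms right_mult_zero_mat[OF assms(2), of r] right_mult_zero_mat[OF assms(3), of r]
      left_mult_zero_mat[OF assms(4), of s] left_mult_zero_mat[OF assms(5), of s] by auto
  ultimately show ?thesis by simp
qed

lemma parabolic_mult:
  fixes p q :: "'a::field mat"
  assumes "p \<in> parabolic r s" "q \<in> parabolic r s"
  shows "p * q \<in> parabolic r s"
proof -
  obtain a x d where p: "p = four_block_mat a x (0\<^sub>m s r) d" "a \<in> carrier (GL r)"
    "x \<in> carrier_mat r s" "d \<in> carrier (GL s)" by (rule parabolicE[OF assms(1)])
  obtain a' x' d' where q: "q = four_block_mat a' x' (0\<^sub>m s r) d'" "a' \<in> carrier (GL r)"
    "x' \<in> carrier_mat r s" "d' \<in> carrier (GL s)" by (rule parabolicE[OF assms(2)])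
  have c: "a \<in> carrier_mat r r" "d \<in> carrier_mat s s" "a' \<in> carrier_mat r r" "d' \<in> carrier_mat s s"
    using p q by auto
  have "a * x' + x * d' \<in> carrier_mat r s" using c p q by auto
  then show ?thesis unfolding p(1) q(1) parabolic_mult_blocks[OF c(1) p(3) c(2,3) q(3) c(4)]
    using p q by (intro four_block_parabolic) auto
qed

lemma parabolic_inv:
  fixes p :: "'a::field mat"
  assumes "p \<in> parabolic r s"
  shows "GLinv (r + s) p \<in> parabolic r s"
proof -
  obtain a x d where p: "p = four_block_mat a x (0\<^sub>m s r) d" "a \<in> carrier (GL r)"
    "x \<in> carrier_mat r s" "d \<in> carrier (GL s)" by (rule parabolicE[OF assms])
  let ?a = "GLinv r a" and ?d = "GLinv s d"
  let ?y = "- (?a * x * ?d)"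
  have c: "a \<in> carrier_mat r r" "d \<in> carrier_mat s s" "?a \<in> carrier_mat r r" "?d \<in> carrier_mat s s"
    using p by auto
  have y: "?y \<in> carrier_mat r s" using c p(3) by auto
  have ax: "?a * x \<in> carrier_mat r s" using c p(3) by auto
  have "a * (?a * x * ?d) = x * ?d"
  proof -
    have "a * (?a * x * ?d) = (a * ?a) * x * ?d"
      using c p(3) ax by (simp add: assoc_mult_mat[of _ r r _ r _ s] assoc_mult_mat[of _ r r _ s _ s])
    then show ?thesis using p by simp
  qed
  then have "a * ?y + x * ?d = 0\<^sub>m r s"
    using c p(3) ax by auto
  then have "p * four_block_mat ?a ?y (0\<^sub>m s r) ?d = four_block_mat (1\<^sub>m r) (0\<^sub>m r s) (0\<^sub>m s r) (1\<^sub>m s)"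
    unfolding p(1) parabolic_mult_blocks[OF c(1) p(3) c(2,3) y c(4)] using p by simp
  then have "p * four_block_mat ?a ?y (0\<^sub>m s r) ?d = 1\<^sub>m (r + s)" by simp
  then have "GLinv (r + s) p = four_block_mat ?a ?y (0\<^sub>m s r) ?d"
    using p(1) c by (intro GL_intro(3)) auto
  then show ?thesis using four_block_parabolic[of ?a r ?y s ?d] p y by simp
qed

lemma parabolic_one: "1\<^sub>m (r + s) \<in> parabolic r (s::nat)"
  by (intro parabolic_memI) auto

lemma parabolic_subgroup: "subgroup (parabolic r s) (GL (r + s) :: 'a::field mat monoid)"
  by (rule subgroup.intro) (auto intro: parabolic_GL parabolic_mult parabolic_one parabolic_inv)

lemma split_block_four_block:
  assumes "a \<in> carrier_mat r r" "x \<in> carrier_mat r s" "c \<in> carrier_mat s r" "d \<in> carrier_mat s s"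
  shows "split_block (four_block_mat a x c d) r r = (a, x, c, d)"
  using assms unfolding split_block_def Let_def by auto

lemma levi_char_four_block:
  assumes "a \<in> carrier_mat r r" "x \<in> carrier_mat r s" "c \<in> carrier_mat s r" "d \<in> carrier_mat s s"
  shows "levi_char r chi mu (four_block_mat a x c d) = chi a * mu d"
  by (simp add: levi_char_def split_block_four_block[OF assms])


section \<open>Small congruence subgroups\<close>

definition near_one :: "nat \<Rightarrow> real \<Rightarrow> 'a::nonarch_local_field mat set" where
  "near_one n e = {k \<in> carrier_mat n n. mbound (k - 1\<^sub>m n) e}"

lemma near_one_GL: "k \<in> near_one n e \<Longrightarrow> 0 \<le> e \<Longrightarrow> e < 1 \<Longrightarrow> k \<in> carrier (GL n)"
  unfolding near_one_def using GL_near_1(1) by blast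

lemma near_one_inv: "k \<in> near_one n e \<Longrightarrow> 0 \<le> e \<Longrightarrow> e < 1 \<Longrightarrow> GLinv n k \<in> near_one n e"
  unfolding near_one_def using GL_near_1[of k n e] by simp

lemma near_one_one: "0 \<le> e \<Longrightarrow> 1\<^sub>m n \<in> near_one n e"
  by (simp add: near_one_def mbound_self)

lemma near_one_bound: "k \<in> near_one n e \<Longrightarrow> e \<le> 1 \<Longrightarrow> mbound k 1"
  unfolding near_one_def using mbound_from_near_1 by blast

lemma near_one_mono: "k \<in> near_one n e \<Longrightarrow> e \<le> e' \<Longrightarrow> k \<in> near_one n e'"
  unfolding near_one_def using mbound_mono by blast

lemma near_one_mult:
  assumes k: "k \<in> near_one n e" and l: "l \<in> near_one n e" and e: "0 \<le> e" "e \<le> 1"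
  shows "k * l \<in> near_one n e"
proof -
  have c: "k \<in> carrier_mat n n" "l \<in> carrier_mat n n" using k l by (auto simp: near_one_def)
  have "mbound (k * (l - 1\<^sub>m n)) e"
    using l c e by (intro mbound_mult1[OF near_one_bound[OF k e(2)], where m=n and n=n and l=n]) (auto simp: near_one_def)
  then have "mbound (k * (l - 1\<^sub>m n) + (k - 1\<^sub>m n)) e"
    using k c by (intro mbound_add[of _ _ _ n n]) (auto simp: near_one_def)
  moreover have "k * (l - 1\<^sub>m n) + (k - 1\<^sub>m n) = k * l - 1\<^sub>m n"
    unfolding mult_minus_distrib_mat[OF c one_carrier_mat] right_mult_one_mat[OF c(1)]
    using c by (intro eq_matI) auto
  ultimately show ?thesis using c by (simp add: near_one_def)
qed

text \<open>The entries of \<open>b k c - b c\<close> are those of \<open>b (k - 1) c\<close>.\<close>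

lemma mult_near_one_bound:
  assumes b: "b \<in> carrier_mat n n" "mbound b B" "0 \<le> B" and c: "c \<in> carrier_mat n n" "mbound c C" "0 \<le> C"
    and k: "k \<in> near_one n e" "0 \<le> e"
  shows "mbound (b * k * c - b * c) (B * e * C)"
proof -
  have kc: "k \<in> carrier_mat n n" and k1: "k - 1\<^sub>m n \<in> carrier_mat n n" and kb: "mbound (k - 1\<^sub>m n) e"
    using k by (auto simp: near_one_def)
  have "b * (k - 1\<^sub>m n) \<in> carrier_mat n n" using b k1 by simp
  then have "mbound (b * (k - 1\<^sub>m n) * c) (B * e * C)"
    using b c k kb k1 by (intro mbound_mult[where m=n and n=n and l=n]) auto
  moreover have "b * (k - 1\<^sub>m n) * c = b * k * c - b * c"
    unfolding mult_minus_distrib_mat[OF b(1) kc one_carrier_mat] right_mult_one_mat[OF b(1)]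
    using b(1) c(1) kc by (intro minus_mult_distrib_mat[of _ n n]) auto
  ultimately show ?thesis by simp
qed

lemma seq_exists:
  "\<exists>e :: nat \<Rightarrow> real. (\<forall>i. 0 < e i \<and> e i < 1) \<and> decseq e \<and> (\<forall>c>0. \<exists>i. e i < c)"
proof (intro exI[of _ "\<lambda>i. (1/2) ^ Suc i"] conjI allI impI)
  show "decseq (\<lambda>i. (1/2::real) ^ Suc i)" by (intro decseq_SucI) simp
  fix c :: real assume "0 < c"
  then obtain i where "(1/2::real) ^ i < c" using real_arch_pow_inv[of c "1/2"] by auto
  moreover have "(1/2::real) ^ Suc i \<le> (1/2) ^ i" by simp
  ultimately have "(1/2::real) ^ Suc i < c" by linarith
  then show "\<exists>i. (1/2) ^ Suc i < c" ..
next
  show "(1/2::real) ^ Suc i < 1" for i by (rule power_Suc_less_one) auto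
qed simp

lemma compact_near_one_parabolic:
  assumes e: "0 \<le> e" "e < 1"
  shows "compactin (subtopology (GL_topology (r + s)) (parabolic r s)) (near_one (r + s) e \<inter> parabolic r s :: 'a::nonarch_local_field mat set)"
    (is "compactin _ ?C")
proof -
  let ?n = "r + s"
  let ?I = "{..<?n} \<times> {..<?n}"
  let ?B = "\<lambda>ij. if fst ij \<ge> r \<and> snd ij < r then {0} else {z::'a. absv (z - 1\<^sub>m ?n $$ ij) \<le> e}"
  have "compactin (product_topology (\<lambda>_. euclidean) ?I) (Pi\<^sub>E ?I ?B)"
    unfolding compactin_PiE
  proof (intro disjI2 ballI)
    fix ij assume "ij \<in> ?I"
    show "compactin euclidean (?B ij)"
      unfolding compactin_euclidean_iff by (simp add: compact_absv_ball_around)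
  qed
  moreover have "entries ?n ` ?C = Pi\<^sub>E ?I ?B"
  proof (rule equalityI)
    show "entries ?n ` ?C \<subseteq> Pi\<^sub>E ?I ?B"
    proof (intro image_subsetI PiE_I)
      fix k ij assume k: "k \<in> ?C" and ij: "ij \<in> ?I"
      obtain i j where [simp]: "ij = (i,j)" by (cases ij)
      have kc: "k \<in> carrier_mat ?n ?n" and kb: "mbound (k - 1\<^sub>m ?n) e" using k by (auto simp: near_one_def)
      have "absv ((k - 1\<^sub>m ?n) $$ (i,j)) \<le> e" using ij kc by (intro mboundD[OF kb, of ?n ?n]) auto
      moreover have "k $$ (i,j) = 0" if "r \<le> i" "j < r"
        using parabolic_zero[of k r s "i - r" j] k ij that by auto
      ultimately show "entries ?n k ij \<in> ?B ij" using ij kc by auto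
    qed auto
    show "Pi\<^sub>E ?I ?B \<subseteq> entries ?n ` ?C"
    proof
      fix a assume a: "a \<in> Pi\<^sub>E ?I ?B"
      let ?k = "mat ?n ?n a"
      have aB: "a ij \<in> ?B ij" if "ij \<in> ?I" for ij using a that by (rule PiE_mem)
      have zero: "a (i, j) = 0" if "r \<le> i" "i < ?n" "j < r" for i j
        using aB[of "(i,j)"] that by auto
      have "mbound (?k - 1\<^sub>m ?n) e"
        unfolding mbound_def
      proof (intro allI impI)
        fix i j assume "i < dim_row (?k - 1\<^sub>m ?n)" "j < dim_col (?k - 1\<^sub>m ?n)"
        then have ij: "i < ?n" "j < ?n" by auto
        then show "absv ((?k - 1\<^sub>m ?n) $$ (i, j)) \<le> e" using aB[of "(i,j)"] e by (auto split: if_splits)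
      qed
      then have k: "?k \<in> near_one ?n e" by (simp add: near_one_def)
      moreover have "?k \<in> parabolic r s"
        using near_one_GL[OF k e] zero by (intro parabolic_memI) auto
      moreover have "a = entries ?n ?k"
        using a by (auto simp: PiE_iff extensional_def fun_eq_iff restrict_def)
      ultimately show "a \<in> entries ?n ` ?C" by blast
    qed
  qed
  ultimately have "compactin (GL_topology ?n) ?C"
    unfolding GL_topology_def using parabolic_GL by (intro compactin_pullback_topology) auto
  then show ?thesis unfolding compactin_subtopology by blast
qed

abbreviation parabolic_group :: "nat \<Rightarrow> nat \<Rightarrow> 'a::field mat monoid" where
  "parabolic_group r s \<equiv> (GL (r + s))\<lparr>carrier := parabolic r s\<rparr>"

abbreviation parabolic_topology :: "nat \<Rightarrow> nat \<Rightarrow> 'a::nonarch_local_field mat topology" where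
  "parabolic_topology r s \<equiv> subtopology (GL_topology (r + s)) (parabolic r s)"

lemma parabolic_group_group: "group (parabolic_group r s :: 'a::field mat monoid)"
  using subgroup.subgroup_is_group[OF parabolic_subgroup GL_group] .

lemma parabolic_group_inv:
  "p \<in> parabolic r s \<Longrightarrow> inv\<^bsub>parabolic_group r s\<^esub> p = GLinv (r + s) (p :: 'a::field mat)"
  by (rule group.m_inv_consistent[OF GL_group parabolic_subgroup])

lemma parabolic_lcoset: "x <#\<^bsub>parabolic_group r s\<^esub> K = (\<lambda>k. x * k) ` K"
  unfolding l_coset_def by auto

lemma near_of_coset:
  assumes x: "x \<in> carrier (GL n)" and e: "0 < (e::real)"
  shows "\<exists>d>0. \<forall>y\<in>carrier_mat n n. mbound (y - x) d \<longrightarrow> GLinv n x * y \<in> near_one n e"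
proof -
  obtain c where c: "1 \<le> c" "mbound (GLinv n x) c" using mbound_exists by blast
  have "GLinv n x * y \<in> near_one n e" if y: "y \<in> carrier_mat n n" "mbound (y - x) (e / c)" for y
  proof -
    have xc: "x \<in> carrier_mat n n" "GLinv n x \<in> carrier_mat n n" using x by auto
    have "mbound (GLinv n x * (y - x)) (c * (e / c))"
      using c e xc y by (intro mbound_mult[where m=n and n=n and l=n]) auto
    moreover have "GLinv n x * (y - x) = GLinv n x * y - 1\<^sub>m n"
      unfolding mult_minus_distrib_mat[OF xc(2) y(1) xc(1)] using x by simp
    ultimately show ?thesis using c y xc by (simp add: near_one_def)
  qed
  then show ?thesis using e c by (intro exI[of _ "e / c"]) auto
qed

lemma parabolic_coset_of_near:
  assumes x: "x \<in> parabolic r s" and y: "y \<in> carrier_mat (r + s) (r + s)"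
    "\<And>i j. i < s \<Longrightarrow> j < r \<Longrightarrow> y $$ (i + r, j) = 0"
    and n: "GLinv (r + s) x * y \<in> near_one (r + s) e" and e: "0 \<le> e" "e < 1"
  shows "y \<in> parabolic r s" "y \<in> (\<lambda>k. x * k) ` (near_one (r + s) e \<inter> parabolic r s)"
proof -
  let ?n = "r + s" and ?k = "GLinv (r + s) x * y"
  have xG: "x \<in> carrier (GL ?n)" by (rule parabolic_GL[OF x])
  have "x * ?k = (x * GLinv ?n x) * y"
    using xG y(1) by (intro assoc_mult_mat[symmetric, of _ ?n ?n _ ?n _ ?n]) auto
  then have xk: "x * ?k = y" using xG y(1) by simp
  have "?k \<in> carrier (GL ?n)" by (rule near_one_GL[OF n e])
  then have "x * ?k \<in> carrier (GL ?n)" using xG by simp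
  then show yP: "y \<in> parabolic r s" using xk y(2) by (intro parabolic_memI) auto
  have "?k \<in> parabolic r s" by (rule parabolic_mult[OF parabolic_inv[OF x] yP])
  then show "y \<in> (\<lambda>k. x * k) ` (near_one ?n e \<inter> parabolic r s)"
    using n xk[symmetric] by blast
qed

lemma parabolic_locally_profinite:
  "\<exists>K e. 0 < e \<and> K 0 = near_one (r + s) e \<inter> parabolic r s \<and>
    locally_profinite_group (parabolic_group r s) (parabolic_topology r s :: 'a::nonarch_local_field mat topology) K"
proof -
  let ?n = "r + s" and ?P = "parabolic r s :: 'a mat set"
  let ?G = "parabolic_group r s :: 'a mat monoid"
  obtain e :: "nat \<Rightarrow> real" where e: "\<And>i. 0 < e i" "\<And>i. e i < 1" "decseq e" "\<And>c. 0 < c \<Longrightarrow> \<exists>i. e i < c"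
    using seq_exists by blast
  note e0 = less_imp_le[OF e(1)]
  define K :: "nat \<Rightarrow> 'a mat set" where "K i = near_one ?n (e i) \<inter> ?P" for i
  interpret P: group ?G by (rule parabolic_group_group)
  have PG: "?P \<subseteq> carrier (GL ?n)" using parabolic_GL by blast
  have coset: "y \<in> (\<lambda>k. x * k) ` K i" if "x \<in> ?P" "y \<in> ?P" "GLinv ?n x * y \<in> near_one ?n (e i)" for x y i
    unfolding K_def using parabolic_zero[OF that(2)] PG that(2)
    by (intro parabolic_coset_of_near(2)[OF that(1) _ _ that(3) e0 e(2)]) auto
  have sub: "subgroup (K i) ?G" for i
  proof (rule P.subgroupI)
    show "K i \<subseteq> carrier ?G" by (simp add: K_def)
    show "K i \<noteq> {}" unfolding K_def using near_one_one[OF e0[of i], of ?n] parabolic_one[of r s] by auto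
    show "inv\<^bsub>?G\<^esub> a \<in> K i" if "a \<in> K i" for a
      using that near_one_inv[OF _ e0 e(2)] parabolic_inv by (auto simp: K_def parabolic_group_inv)
    show "a \<otimes>\<^bsub>?G\<^esub> b \<in> K i" if "a \<in> K i" "b \<in> K i" for a b
      using that near_one_mult[OF _ _ e0 less_imp_le[OF e(2)]] parabolic_mult by (auto simp: K_def)
  qed
  have "locally_profinite_group ?G (parabolic_topology r s) K"
  proof (intro locally_profinite_group.intro[OF parabolic_group_group] locally_profinite_group_axioms.intro)
    fix U :: "'a mat set"
    have eq: "(\<exists>d>0. \<forall>y\<in>?P. mbound (y - x) d \<longrightarrow> y \<in> U) \<longleftrightarrow> (\<exists>i. (\<lambda>k. x * k) ` K i \<subseteq> U)"
      if U: "U \<subseteq> carrier ?G" and x: "x \<in> U" for x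
    proof -
      have xP: "x \<in> ?P" using U x by auto
      then have xc: "x \<in> carrier_mat ?n ?n" using PG by auto
      show ?thesis
      proof
        assume "\<exists>d>0. \<forall>y\<in>?P. mbound (y - x) d \<longrightarrow> y \<in> U"
        then obtain d where d: "0 < d" "\<And>y. y \<in> ?P \<Longrightarrow> mbound (y - x) d \<Longrightarrow> y \<in> U" by blast
        obtain c where c: "1 \<le> c" "mbound x c" using mbound_exists by blast
        obtain i where i: "e i < d / c" using e(4)[of "d / c"] d c by auto
        have "x * k \<in> U" if k: "k \<in> K i" for k
        proof (rule d(2))
          show "x * k \<in> ?P" using k xP by (auto simp: K_def intro: parabolic_mult)
          have kc: "k \<in> carrier_mat ?n ?n" using k by (auto simp: K_def near_one_def)
          have "mbound (x * k * 1\<^sub>m ?n - x * 1\<^sub>m ?n) (c * e i * 1)"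
            using c xc k e0 by (intro mult_near_one_bound) (auto simp: K_def mbound_one)
          then have "mbound (x * k - x) (c * e i)"
            using xc kc right_mult_one_mat[OF xc] right_mult_one_mat[of "x * k" ?n ?n] by simp
          then show "mbound (x * k - x) d" using i c by (elim mbound_mono) (simp add: field_simps)
        qed
        then show "\<exists>i. (\<lambda>k. x * k) ` K i \<subseteq> U" by blast
      next
        assume "\<exists>i. (\<lambda>k. x * k) ` K i \<subseteq> U"
        then obtain i where i: "(\<lambda>k. x * k) ` K i \<subseteq> U" by blast
        obtain d where d: "d > 0" "\<And>y. y \<in> carrier_mat ?n ?n \<Longrightarrow> mbound (y - x) d \<Longrightarrow> GLinv ?n x * y \<in> near_one ?n (e i)"
          using near_of_coset[OF subsetD[OF PG xP] e(1)[of i]] by blast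
        have "y \<in> U" if y: "y \<in> ?P" "mbound (y - x) d" for y
        proof -
          have "y \<in> carrier_mat ?n ?n" using PG y(1) by auto
          then have "y \<in> (\<lambda>k. x * k) ` K i" by (intro coset[OF xP y(1)] d(2)[OF _ y(2)])
          then show ?thesis using i by blast
        qed
        then show "\<exists>d>0. \<forall>y\<in>?P. mbound (y - x) d \<longrightarrow> y \<in> U" using d(1) by blast
      qed
    qed
    show "openin (parabolic_topology r s) U \<longleftrightarrow> U \<subseteq> carrier ?G \<and> (\<forall>x\<in>U. \<exists>i. x <#\<^bsub>?G\<^esub> K i \<subseteq> U)"
      unfolding openin_GL_sub[OF PG] parabolic_lcoset
    proof (rule conj_cong)
      show "U \<subseteq> ?P \<longleftrightarrow> U \<subseteq> carrier ?G" by simp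
      assume U: "U \<subseteq> carrier ?G"
      show "(\<forall>x\<in>U. \<exists>d>0. \<forall>y\<in>?P. mbound (y - x) d \<longrightarrow> y \<in> U) \<longleftrightarrow> (\<forall>x\<in>U. \<exists>i. (\<lambda>k. x * k) ` K i \<subseteq> U)"
        by (rule ball_cong[OF refl]) (rule eq[OF U])
    qed
  next
    show "subgroup (K i) ?G" for i by (rule sub)
    show "decseq K"
      unfolding decseq_def K_def using near_one_mono[OF _ decseqD[OF e(3)]] by blast
  next
    fix g i assume "g \<in> carrier ?G"
    then have gP: "g \<in> ?P" by simp
    let ?g = "GLinv ?n g"
    have gc: "g \<in> carrier_mat ?n ?n" "?g \<in> carrier_mat ?n ?n" "?g * g = 1\<^sub>m ?n" using PG gP by auto
    obtain b c where bc: "1 \<le> b" "mbound ?g b" "1 \<le> c" "mbound g c" using mbound_exists by metis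
    obtain j where j: "e j < e i / (b * c)" using e(4)[of "e i / (b * c)"] e(1)[of i] bc by auto
    have "?g * k * g \<in> K i" if k: "k \<in> K j" for k
    proof -
      have "mbound (?g * k * g - 1\<^sub>m ?n) (b * e j * c)"
        using mult_near_one_bound[OF gc(2) bc(2) _ gc(1) bc(4), of k "e j"] bc k e0 gc(3) by (simp add: K_def)
      then have "mbound (?g * k * g - 1\<^sub>m ?n) (e i)"
        using j bc by (elim mbound_mono) (simp add: field_simps)
      moreover have "?g * k * g \<in> ?P" using k gP by (auto simp: K_def intro: parabolic_mult parabolic_inv)
      ultimately show ?thesis using PG by (auto simp: K_def near_one_def)
    qed
    then show "\<exists>j. \<forall>k\<in>K j. inv\<^bsub>?G\<^esub> g \<otimes>\<^bsub>?G\<^esub> k \<otimes>\<^bsub>?G\<^esub> g \<in> K i"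
      by (auto simp: parabolic_group_inv[OF gP])
  next
    show "compactin (parabolic_topology r s) (K 0)"
      unfolding K_def by (rule compact_near_one_parabolic[OF e0 e(2)])
  next
    fix i
    obtain Q :: "'a set" where Q: "countable Q" "0 \<in> Q" "\<And>x d. 0 < d \<Longrightarrow> \<exists>q\<in>Q. absv (x - q) \<le> d"
      using countable_dense by blast
    let ?D = "(\<lambda>xs. mat ?n ?n (\<lambda>(i,j). xs ! i ! j)) ` lists (lists Q)"
    have "countable ?D" using Q(1) by simp
    moreover have "(\<lambda>x. x <#\<^bsub>?G\<^esub> K i) ` carrier ?G \<subseteq> (\<lambda>x. x <#\<^bsub>?G\<^esub> K i) ` ?D"
    proof (intro image_subsetI)
      fix x assume "x \<in> carrier ?G"
      then have xP: "x \<in> ?P" by simp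
      then have xc: "x \<in> carrier_mat ?n ?n" using PG by auto
      obtain d where d: "d > 0" "\<And>y. y \<in> carrier_mat ?n ?n \<Longrightarrow> mbound (y - x) d \<Longrightarrow> GLinv ?n x * y \<in> near_one ?n (e i)"
        using near_of_coset[OF subsetD[OF PG xP] e(1)[of i]] by blast
      have "\<exists>q\<in>Q. absv (z - q) \<le> d \<and> (z = 0 \<longrightarrow> q = 0)" for z
        using Q(2) Q(3)[OF d(1), of z] d(1) by (cases "z = 0") auto
      then obtain q where q: "\<And>z. q z \<in> Q" "\<And>z. absv (z - q z) \<le> d" "q 0 = 0" by metis
      let ?xs = "map (\<lambda>i. map (\<lambda>j. q (x $$ (i,j))) [0..<?n]) [0..<?n]"
      let ?y = "mat ?n ?n (\<lambda>(i,j). q (x $$ (i,j)))"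
      have xs: "?xs \<in> lists (lists Q)" using q(1) by (auto simp: lists_eq_set)
      have "?y = mat ?n ?n (\<lambda>(i,j). ?xs ! i ! j)" by (rule eq_matI) simp_all
      then have yD: "?y \<in> ?D" using xs by (rule image_eqI)
      have "mbound (x - ?y) d" using q(2) xc by (simp add: mbound_def)
      then have "mbound (?y - x) d" using mbound_diff_commute[OF xc, of ?y] by simp
      then have near: "GLinv ?n x * ?y \<in> near_one ?n (e i)" by (intro d(2)) auto
      have "?y $$ (i' + r, j) = 0" if "i' < s" "j < r" for i' j
        using parabolic_zero[OF xP that] that q(3) by auto
      then have "?y \<in> x <#\<^bsub>?G\<^esub> K i"
        unfolding parabolic_lcoset K_def
        by (intro parabolic_coset_of_near(2)[OF xP _ _ near e0 e(2)]) auto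
      then have "x <#\<^bsub>?G\<^esub> K i = ?y <#\<^bsub>?G\<^esub> K i"
        using xP by (intro P.l_repr_independence[OF _ _ sub]) auto
      then show "x <#\<^bsub>?G\<^esub> K i \<in> (\<lambda>x. x <#\<^bsub>?G\<^esub> K i) ` ?D" using yD by blast
    qed
    ultimately show "countable ((\<lambda>x. x <#\<^bsub>?G\<^esub> K i) ` carrier ?G)"
      by (meson countable_image countable_subset)
  qed
  then show ?thesis using e(1)[of 0] by (intro exI[of _ K] exI[of _ "e 0"]) (auto simp: K_def)
qed

abbreviation parabolic_modulus :: "nat \<Rightarrow> nat \<Rightarrow> 'a::nonarch_local_field mat \<Rightarrow> real" where
  "parabolic_modulus r s \<equiv> modulus (parabolic_group r s) (parabolic_topology r s)"

lemma parabolic_modulus_props: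
  fixes p q :: "'a::nonarch_local_field mat"
  shows parabolic_modulus_pos: "p \<in> parabolic r s \<Longrightarrow> 0 < parabolic_modulus r s p"
    and parabolic_modulus_mult: "p \<in> parabolic r s \<Longrightarrow> q \<in> parabolic r s \<Longrightarrow>
      parabolic_modulus r s (p * q) = parabolic_modulus r s p * parabolic_modulus r s q"
    and parabolic_modulus_smooth: "\<exists>e>0. \<forall>k\<in>near_one (r + s) e \<inter> parabolic r s. parabolic_modulus r s (k::'a mat) = 1"
    and parabolic_modulus_central: "p \<in> parabolic r s \<Longrightarrow>
      (\<And>x. x \<in> parabolic r s \<Longrightarrow> x * GLinv (r + s) p = GLinv (r + s) p * x) \<Longrightarrow> parabolic_modulus r s p = 1"
proof -
  obtain K :: "nat \<Rightarrow> 'a mat set" and e where K: "0 < e" "K 0 = near_one (r + s) e \<inter> parabolic r s"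
    "locally_profinite_group (parabolic_group r s) (parabolic_topology r s) K"
    using parabolic_locally_profinite by blast
  interpret locally_profinite_group "parabolic_group r s" "parabolic_topology r s" K by (rule K(3))
  show "p \<in> parabolic r s \<Longrightarrow> 0 < parabolic_modulus r s p" using modulus_pos by simp
  show "p \<in> parabolic r s \<Longrightarrow> q \<in> parabolic r s \<Longrightarrow>
      parabolic_modulus r s (p * q) = parabolic_modulus r s p * parabolic_modulus r s q"
    using modulus_mult[of p q] by simp
  show "\<exists>e>0. \<forall>k\<in>near_one (r + s) e \<inter> parabolic r s. parabolic_modulus r s (k::'a mat) = 1"
    using modulus_K K by blast
  show "p \<in> parabolic r s \<Longrightarrow>
      (\<And>x. x \<in> parabolic r s \<Longrightarrow> x * GLinv (r + s) p = GLinv (r + s) p * x) \<Longrightarrow> parabolic_modulus r s p = 1"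
    using modulus_central[of p] by (simp add: parabolic_group_inv)
qed

section \<open>Characters\<close>

lemma smooth_characterD:
  assumes "smooth_character G T chi"
  shows "chi \<one>\<^bsub>G\<^esub> = 1"
    and "g \<in> carrier G \<Longrightarrow> h \<in> carrier G \<Longrightarrow> chi (g \<otimes>\<^bsub>G\<^esub> h) = chi g * chi h"
    and "openin T {g \<in> carrier G. chi g = 1}"
proof -
  have "smooth_rep G T (complex_line, \<lambda>g z. chi g * z)"
    using assms by (simp add: smooth_character_def char_rep_def)
  then have 1: "\<forall>v\<in>carrier complex_line. chi \<one>\<^bsub>G\<^esub> * v = v"
    and 2: "\<forall>g\<in>carrier G. \<forall>h\<in>carrier G. \<forall>v\<in>carrier complex_line. chi (g \<otimes>\<^bsub>G\<^esub> h) * v = chi g * (chi h * v)"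
    and 3: "\<forall>v\<in>carrier complex_line. openin T {g \<in> carrier G. chi g * v = v}"
    unfolding smooth_rep_def by auto
  have one: "1 \<in> carrier complex_line" by (simp add: complex_line_def)
  show "chi \<one>\<^bsub>G\<^esub> = 1" using bspec[OF 1 one] by simp
  show "chi (g \<otimes>\<^bsub>G\<^esub> h) = chi g * chi h" if "g \<in> carrier G" "h \<in> carrier G"
    using 2[THEN bspec, OF that(1), THEN bspec, OF that(2), THEN bspec, OF one] by simp
  show "openin T {g \<in> carrier G. chi g = 1}" using bspec[OF 3 one] by simp
qed

lemma near_one_block:
  assumes "four_block_mat a x (0\<^sub>m s r) d \<in> near_one (r + s) e"
    "a \<in> carrier_mat r r" "x \<in> carrier_mat r s" "d \<in> carrier_mat s s"
  shows "a \<in> near_one r e" "d \<in> near_one s e"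
proof -
  let ?p = "four_block_mat a x (0\<^sub>m s r) d"
  have b: "absv ((?p - 1\<^sub>m (r + s)) $$ (i, j)) \<le> e" if "i < r + s" "j < r + s" for i j
    using assms that by (intro mboundD[of _ e "r + s" "r + s"]) (auto simp: near_one_def)
  have "absv ((a - 1\<^sub>m r) $$ (i, j)) \<le> e" if "i < r" "j < r" for i j
    using b[of i j] that assms(2-) by (auto split: if_splits)
  then show "a \<in> near_one r e" using assms(2) by (auto simp: near_one_def mbound_def)
  have "absv ((d - 1\<^sub>m s) $$ (i, j)) \<le> e" if "i < s" "j < s" for i j
    using b[of "i + r" "j + r"] that assms(2-) by (auto split: if_splits)
  then show "d \<in> near_one s e" using assms(4) by (auto simp: near_one_def mbound_def)
qed

lemma open_GL_near_one:
  assumes "openin (GL_topology n) U" "1\<^sub>m n \<in> U"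
  shows "\<exists>e>0. e < 1 \<and> near_one n e \<subseteq> (U :: 'a::nonarch_local_field mat set)"
proof -
  obtain e where e: "e > 0" "\<And>y. y \<in> carrier (GL n) \<Longrightarrow> mbound (y - 1\<^sub>m n) e \<Longrightarrow> y \<in> U"
    using assms unfolding openin_GL_topology by blast
  show ?thesis
  proof (intro exI conjI subsetI)
    show "0 < min e (1/2)" "min e (1/2) < 1" using e(1) by auto
    fix y :: "'a mat" assume y: "y \<in> near_one n (min e (1/2))"
    then have "y \<in> carrier (GL n)" using e(1) by (intro near_one_GL[OF y]) auto
    moreover have "mbound (y - 1\<^sub>m n) e" using y unfolding near_one_def by (auto intro: mbound_mono)
    ultimately show "y \<in> U" by (rule e(2))
  qed
qed

lemma smooth_GL_characterD:
  fixes chi :: "'a::nonarch_local_field mat \<Rightarrow> complex"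
  assumes "smooth_character (GL n) (GL_topology n) chi"
  shows "chi (1\<^sub>m n) = 1"
    and "g \<in> carrier (GL n) \<Longrightarrow> h \<in> carrier (GL n) \<Longrightarrow> chi (g * h) = chi g * chi h"
    and "\<exists>e>0. e < 1 \<and> (\<forall>k\<in>near_one n e. chi k = 1)"
proof -
  show one: "chi (1\<^sub>m n) = 1" using smooth_characterD(1)[OF assms] by simp
  show "g \<in> carrier (GL n) \<Longrightarrow> h \<in> carrier (GL n) \<Longrightarrow> chi (g * h) = chi g * chi h"
    using smooth_characterD(2)[OF assms, of g h] by simp
  obtain e where "e > 0" "e < 1" "near_one n e \<subseteq> {g \<in> carrier (GL n). chi g = 1}"
    using open_GL_near_one[OF smooth_characterD(3)[OF assms]] one by auto
  then show "\<exists>e>0. e < 1 \<and> (\<forall>k\<in>near_one n e. chi k = 1)" by blast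
qed

definition ind_char :: "nat \<Rightarrow> nat \<Rightarrow> ('a mat \<Rightarrow> complex) \<Rightarrow> ('a mat \<Rightarrow> complex) \<Rightarrow> 'a::nonarch_local_field mat \<Rightarrow> complex" where
  "ind_char r s chi mu p = of_real (sqrt (parabolic_modulus r s p)) * levi_char r chi mu p"

locale parabolic_character =
  fixes r s :: nat and \<sigma> :: "'a::nonarch_local_field mat \<Rightarrow> complex"
  assumes \<sigma>_mult: "p \<in> parabolic r s \<Longrightarrow> q \<in> parabolic r s \<Longrightarrow> \<sigma> (p * q) = \<sigma> p * \<sigma> q"
    and \<sigma>_one: "\<sigma> (1\<^sub>m (r + s)) = 1"
    and \<sigma>_smooth: "\<exists>e>0. e < 1 \<and> (\<forall>k\<in>near_one (r + s) e \<inter> parabolic r s. \<sigma> k = 1)"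

lemma levi_char_mult:
  assumes chi: "\<And>g h. g \<in> carrier (GL r) \<Longrightarrow> h \<in> carrier (GL r) \<Longrightarrow> chi (g * h) = chi g * chi h"
    and mu: "\<And>g h. g \<in> carrier (GL s) \<Longrightarrow> h \<in> carrier (GL s) \<Longrightarrow> mu (g * h) = mu g * mu h"
    and p: "p \<in> parabolic r s" and q: "q \<in> parabolic r s"
  shows "levi_char r chi mu (p * q) = levi_char r chi mu p * levi_char r chi mu (q::'a::field mat)"
proof -
  obtain a x d where p: "p = four_block_mat a x (0\<^sub>m s r) d" "a \<in> carrier (GL r)"
    "x \<in> carrier_mat r s" "d \<in> carrier (GL s)" by (rule parabolicE[OF p])
  obtain a' x' d' where q: "q = four_block_mat a' x' (0\<^sub>m s r) d'" "a' \<in> carrier (GL r)"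
    "x' \<in> carrier_mat r s" "d' \<in> carrier (GL s)" by (rule parabolicE[OF q])
  have c: "a \<in> carrier_mat r r" "d \<in> carrier_mat s s" "a' \<in> carrier_mat r r" "d' \<in> carrier_mat s s"
    using p q by auto
  have xx: "a * x' + x * d' \<in> carrier_mat r s" "a * a' \<in> carrier_mat r r" "d * d' \<in> carrier_mat s s"
    using c p q by auto
  show ?thesis
    unfolding p(1) q(1) parabolic_mult_blocks[OF c(1) p(3) c(2,3) q(3) c(4)]
      levi_char_four_block[OF xx(2,1) zero_carrier_mat xx(3)]
      levi_char_four_block[OF c(1) p(3) zero_carrier_mat c(2)]
      levi_char_four_block[OF c(3) q(3) zero_carrier_mat c(4)]
    using chi[OF p(2) q(2)] mu[OF p(4) q(4)] by simp
qed

lemma levi_char_one: "levi_char r chi mu (1\<^sub>m (r + s)) = chi (1\<^sub>m r) * mu (1\<^sub>m s)"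
  using levi_char_four_block[of "1\<^sub>m r" r "0\<^sub>m r s" s "0\<^sub>m s r" "1\<^sub>m s" chi mu] by simp

lemma parabolic_modulus_one: "parabolic_modulus r s (1\<^sub>m (r + s) :: 'a::nonarch_local_field mat) = 1"
proof (rule parabolic_modulus_central[OF parabolic_one])
  fix x :: "'a mat" assume "x \<in> parabolic r s"
  then have x: "x \<in> carrier_mat (r + s) (r + s)" by (intro GL_carrier_mat parabolic_GL)
  have "GLinv (r + s) (1\<^sub>m (r + s)) = (1\<^sub>m (r + s) :: 'a mat)" by (intro GL_intro(3)) auto
  then show "x * GLinv (r + s) (1\<^sub>m (r + s)) = GLinv (r + s) (1\<^sub>m (r + s)) * x" using x by simp
qed

lemma ind_char_parabolic_character:
  fixes chi mu :: "'a::nonarch_local_field mat \<Rightarrow> complex"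
  assumes chi: "smooth_character (GL r) (GL_topology r) chi"
    and mu: "smooth_character (GL s) (GL_topology s) mu"
  shows "parabolic_character r s (ind_char r s chi mu)"
proof
  note c = smooth_GL_characterD[OF chi] and m = smooth_GL_characterD[OF mu]
  fix p q :: "'a mat" assume pq: "p \<in> parabolic r s" "q \<in> parabolic r s"
  have lm: "levi_char r chi mu (p * q) = levi_char r chi mu p * levi_char r chi mu q"
    by (rule levi_char_mult[OF _ _ pq]) (erule c(2) m(2), assumption)+
  show "ind_char r s chi mu (p * q) = ind_char r s chi mu p * ind_char r s chi mu q"
    unfolding ind_char_def parabolic_modulus_mult[OF pq] lm real_sqrt_mult by simp
next
  note c = smooth_GL_characterD[OF chi] and m = smooth_GL_characterD[OF mu]
  show "ind_char r s chi mu (1\<^sub>m (r + s)) = 1"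
    unfolding ind_char_def parabolic_modulus_one levi_char_one c(1) m(1) by simp
next
  obtain e1 where e1: "e1 > 0" "e1 < 1" "\<forall>k\<in>near_one r e1. chi k = 1"
    using smooth_GL_characterD(3)[OF chi] by blast
  obtain e2 where e2: "e2 > 0" "e2 < 1" "\<forall>k\<in>near_one s e2. mu k = 1"
    using smooth_GL_characterD(3)[OF mu] by blast
  obtain e3 where e3: "e3 > 0" "\<forall>k\<in>near_one (r + s) e3 \<inter> parabolic r s. parabolic_modulus r s (k::'a mat) = 1"
    using parabolic_modulus_smooth by blast
  define e where "e = min e1 (min e2 e3)"
  show "\<exists>e>0. e < 1 \<and> (\<forall>k\<in>near_one (r + s) e \<inter> parabolic r s. ind_char r s chi mu k = 1)"
  proof (intro exI[of _ e] conjI ballI)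
    show "0 < e" "e < 1" using e1 e2 e3 by (auto simp: e_def)
    fix k :: "'a mat" assume k: "k \<in> near_one (r + s) e \<inter> parabolic r s"
    then have kP: "k \<in> parabolic r s" by blast
    obtain a x d where p: "k = four_block_mat a x (0\<^sub>m s r) d" "a \<in> carrier (GL r)"
      "x \<in> carrier_mat r s" "d \<in> carrier (GL s)" by (rule parabolicE[OF kP])
    have ad: "a \<in> carrier_mat r r" "d \<in> carrier_mat s s" using p by auto
    have "a \<in> near_one r e" "d \<in> near_one s e"
      using k near_one_block[of a x s r d e] p ad by auto
    then have "a \<in> near_one r e1" "d \<in> near_one s e2"
      using near_one_mono[of a r e e1] near_one_mono[of d s e e2] by (simp_all add: e_def)
    moreover have "k \<in> near_one (r + s) e3" using k near_one_mono[of k "r + s" e e3] by (simp add: e_def)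
    ultimately show "ind_char r s chi mu k = 1"
      unfolding ind_char_def using e1(3) e2(3) e3(2) kP levi_char_four_block[OF ad(1) p(3) zero_carrier_mat ad(2), of chi mu]
      by (simp add: p(1))
  qed
qed

context parabolic_character
begin

lemma \<sigma>_inv:
  assumes "p \<in> parabolic r s" shows "\<sigma> p * \<sigma> (GLinv (r + s) p) = 1"
  using \<sigma>_mult[OF assms parabolic_inv[OF assms]] GL_inv(3)[OF parabolic_GL[OF assms]] \<sigma>_one by simp

lemma \<sigma>_nonzero: "p \<in> parabolic r s \<Longrightarrow> \<sigma> p \<noteq> 0"
  using \<sigma>_inv by fastforce

end

section \<open>Transvections\<close>

definition outer :: "'a::comm_ring_1 vec \<Rightarrow> 'a vec \<Rightarrow> 'a mat" where
  "outer c w = mat (dim_vec c) (dim_vec w) (\<lambda>(i,j). c $ i * w $ j)"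

lemma outer_carrier: "c \<in> carrier_vec m \<Longrightarrow> w \<in> carrier_vec n \<Longrightarrow> outer c w \<in> carrier_mat m n"
  by (auto simp: outer_def)

lemma outer_index: "c \<in> carrier_vec m \<Longrightarrow> w \<in> carrier_vec n \<Longrightarrow> i < m \<Longrightarrow> j < n \<Longrightarrow> outer c w $$ (i,j) = c $ i * w $ j"
  by (auto simp: outer_def)

lemma mult_outer:
  assumes "A \<in> carrier_mat l m" "c \<in> carrier_vec m" "w \<in> carrier_vec n"
  shows "A * outer c w = outer (A *\<^sub>v c) w"
proof (rule eq_matI)
  fix i j assume "i < dim_row (outer (A *\<^sub>v c) w)" "j < dim_col (outer (A *\<^sub>v c) w)"
  then have ij: "i < l" "j < n" using assms by (auto simp: outer_def)
  show "(A * outer c w) $$ (i, j) = outer (A *\<^sub>v c) w $$ (i, j)"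
    using assms ij by (simp add: outer_def scalar_prod_def sum_distrib_right mult.assoc)
qed (use assms in \<open>auto simp: outer_def\<close>)

lemma outer_mult:
  assumes "A \<in> carrier_mat n l" "c \<in> carrier_vec m" "w \<in> carrier_vec n"
  shows "outer c w * A = outer c (A\<^sup>T *\<^sub>v w)"
proof (rule eq_matI)
  fix i j assume "i < dim_row (outer c (A\<^sup>T *\<^sub>v w))" "j < dim_col (outer c (A\<^sup>T *\<^sub>v w))"
  then have ij: "i < m" "j < l" using assms by (auto simp: outer_def)
  show "(outer c w * A) $$ (i, j) = outer c (A\<^sup>T *\<^sub>v w) $$ (i, j)"
    using assms ij by (simp add: outer_def scalar_prod_def sum_distrib_left mult_ac)
qed (use assms in \<open>auto simp: outer_def\<close>)

lemma outer_apply: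
  assumes "c \<in> carrier_vec m" "w \<in> carrier_vec n" "v \<in> carrier_vec n"
  shows "outer c w *\<^sub>v v = (w \<bullet> v) \<cdot>\<^sub>v c"
  using assms by (intro eq_vecI) (auto simp: outer_def scalar_prod_def sum_distrib_right mult_ac sum_distrib_left)

lemma outer_transpose: "(outer c w)\<^sup>T = outer w c"
  by (intro eq_matI) (auto simp: outer_def mult.commute)

definition transvection :: "nat \<Rightarrow> 'a::comm_ring_1 vec \<Rightarrow> 'a vec \<Rightarrow> 'a mat" where
  "transvection n c w = 1\<^sub>m n + outer c w"

lemma transvection_carrier: "c \<in> carrier_vec n \<Longrightarrow> w \<in> carrier_vec n \<Longrightarrow> transvection n c w \<in> carrier_mat n n"
  by (simp add: transvection_def outer_carrier)

lemma transvection_apply: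
  assumes "c \<in> carrier_vec n" "w \<in> carrier_vec n" "v \<in> carrier_vec n"
  shows "transvection n c w *\<^sub>v v = v + (w \<bullet> v) \<cdot>\<^sub>v c"
  unfolding transvection_def using assms
  by (simp add: add_mult_distrib_mat_vec[of _ n n] outer_carrier outer_apply)

lemma transvection_transpose: "c \<in> carrier_vec n \<Longrightarrow> w \<in> carrier_vec n \<Longrightarrow> (transvection n c w)\<^sup>T = transvection n w c"
  by (intro eq_matI) (auto simp: transvection_def outer_def mult.commute)

lemma transvection_left:
  assumes "A \<in> carrier_mat n n" "c \<in> carrier_vec n" "w \<in> carrier_vec n"
  shows "A * transvection n c w = A + outer (A *\<^sub>v c) w"
  unfolding transvection_def using assms
  by (subst mult_add_distrib_mat[of _ n n _ n]) (auto simp: outer_carrier mult_outer)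

lemma transvection_right:
  assumes "A \<in> carrier_mat n n" "c \<in> carrier_vec n" "w \<in> carrier_vec n"
  shows "transvection n c w * A = A + outer c (A\<^sup>T *\<^sub>v w)"
  unfolding transvection_def using assms
  by (subst add_mult_distrib_mat[of _ n n _ _ n]) (auto simp: outer_carrier outer_mult)

lemma outer_smult_left: "outer (a \<cdot>\<^sub>v c) w = a \<cdot>\<^sub>m outer c w"
  by (intro eq_matI) (auto simp: outer_def)

lemma outer_smult_right: "outer c (a \<cdot>\<^sub>v w) = a \<cdot>\<^sub>m outer c w"
  by (intro eq_matI) (auto simp: outer_def)

lemma transvection_mult:
  assumes c: "c \<in> carrier_vec n" and w: "w \<in> carrier_vec n"
  shows "transvection n (a \<cdot>\<^sub>v c) w * transvection n (b \<cdot>\<^sub>v c) w = transvection n ((a + b + a * b * (w \<bullet> c)) \<cdot>\<^sub>v c) w"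
proof -
  have "transvection n (a \<cdot>\<^sub>v c) w *\<^sub>v (b \<cdot>\<^sub>v c) = b \<cdot>\<^sub>v c + (w \<bullet> (b \<cdot>\<^sub>v c)) \<cdot>\<^sub>v (a \<cdot>\<^sub>v c)"
    using c w by (intro transvection_apply) auto
  then show ?thesis
    using c w transvection_carrier[of "a \<cdot>\<^sub>v c" n w]
    by (subst transvection_left)
      (auto simp: transvection_def outer_def algebra_simps intro!: eq_matI)
qed

text \<open>A dilation \<open>t\<close> along \<open>c\<close> rescales the transvection, so that each transvection along \<open>c\<close>
  is a commutator with \<open>t\<close>.\<close>

lemma hom_transvection_dilation:
  fixes \<sigma> :: "'a::field mat \<Rightarrow> complex"
  assumes mult: "\<And>p q. p \<in> H \<Longrightarrow> q \<in> H \<Longrightarrow> \<sigma> (p * q) = \<sigma> p * \<sigma> q"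
    and nz: "\<And>p. p \<in> H \<Longrightarrow> \<sigma> p \<noteq> 0"
    and c: "c \<in> carrier_vec n" and w: "w \<in> carrier_vec n" and wc: "w \<bullet> c = 0"
    and T: "\<And>a. transvection n (a \<cdot>\<^sub>v c) w \<in> H"
    and t: "t \<in> H" "t \<in> carrier_mat n n" and l: "l \<noteq> 0" "l \<noteq> 1"
    and comm: "(t *\<^sub>v c = l \<cdot>\<^sub>v c \<and> t\<^sup>T *\<^sub>v w = w) \<or> (t *\<^sub>v c = c \<and> t\<^sup>T *\<^sub>v w = l \<cdot>\<^sub>v w)"
  shows "\<sigma> (transvection n c w) = 1"
proof -
  let ?T = "\<lambda>a. transvection n (a \<cdot>\<^sub>v c) w"
  have add: "?T a * ?T b = ?T (a + b)" for a b
    using transvection_mult[OF c w, of a b] wc by simp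
  have ac: "a \<cdot>\<^sub>v c \<in> carrier_vec n" for a using c by simp
  have tl: "t * ?T a = t + a \<cdot>\<^sub>m outer (t *\<^sub>v c) w" for a
    using t(2) c w by (subst transvection_left) (auto simp: mult_mat_vec outer_smult_left)
  have tr: "?T a * t = t + a \<cdot>\<^sub>m outer c (t\<^sup>T *\<^sub>v w)" for a
    using t(2) c w by (subst transvection_right) (auto simp: outer_smult_left)
  have *: "\<sigma> (?T (l * a)) = \<sigma> (?T a)" for a
    using comm
  proof
    assume "t *\<^sub>v c = l \<cdot>\<^sub>v c \<and> t\<^sup>T *\<^sub>v w = w"
    then have "t * ?T a = ?T (l * a) * t"
      unfolding tl tr by (simp add: outer_smult_left) (auto simp: outer_def intro!: eq_matI)
    then have "\<sigma> t * \<sigma> (?T a) = \<sigma> (?T (l * a)) * \<sigma> t" using mult[OF t(1) T] mult[OF T t(1)] by metis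
    then show ?thesis using nz[OF t(1)] by simp
  next
    assume "t *\<^sub>v c = c \<and> t\<^sup>T *\<^sub>v w = l \<cdot>\<^sub>v w"
    then have "t * ?T (l * a) = ?T a * t"
      unfolding tl tr by (simp add: outer_smult_right) (auto simp: outer_def intro!: eq_matI)
    then have "\<sigma> t * \<sigma> (?T (l * a)) = \<sigma> (?T a) * \<sigma> t" using mult[OF t(1) T] mult[OF T t(1)] by metis
    then show ?thesis using nz[OF t(1)] by simp
  qed
  define a where "a = 1 / (l - 1)"
  have "l * a = a + 1" using l(2) by (simp add: a_def field_simps)
  then have "\<sigma> (?T a) * \<sigma> (?T 1) = \<sigma> (?T a)"
    using *[of a] add[of a 1] mult[OF T T] by metis
  then have "\<sigma> (?T 1) = 1" using nz[OF T] by simp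
  then show ?thesis by simp
qed

lemma dilation_GL:
  assumes c: "c \<in> carrier_vec n" and w: "w \<in> carrier_vec n" and wc: "w \<bullet> c = (1::'a::field)" and l: "l \<noteq> 0"
  shows "transvection n ((l - 1) \<cdot>\<^sub>v c) w \<in> carrier (GL n)"
proof (rule GL_intro(1))
  let ?b = "1 / l - 1"
  show "transvection n (?b \<cdot>\<^sub>v c) w \<in> carrier_mat n n" "transvection n ((l - 1) \<cdot>\<^sub>v c) w \<in> carrier_mat n n"
    using c w by (auto intro!: transvection_carrier)
  have "(l - 1) + ?b + (l - 1) * ?b * (w \<bullet> c) = 0" unfolding wc using l by (simp add: field_simps)
  then show "transvection n ((l - 1) \<cdot>\<^sub>v c) w * transvection n (?b \<cdot>\<^sub>v c) w = 1\<^sub>m n"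
    unfolding transvection_mult[OF c w] using c w
    by (auto simp: transvection_def outer_def intro!: eq_matI)
qed

lemma transvection_GL:
  assumes c: "c \<in> carrier_vec n" and w: "w \<in> carrier_vec n" and wc: "w \<bullet> c = (0::'a::field)"
  shows "transvection n c w \<in> carrier (GL n)"
proof (rule GL_intro(1))
  show "transvection n (-1 \<cdot>\<^sub>v c) w \<in> carrier_mat n n" "transvection n c w \<in> carrier_mat n n"
    using c w by (auto intro!: transvection_carrier)
  have "transvection n (1 \<cdot>\<^sub>v c) w * transvection n (-1 \<cdot>\<^sub>v c) w = 1\<^sub>m n"
    unfolding transvection_mult[OF c w] using c w wc
    by (auto simp: transvection_def outer_def intro!: eq_matI)
  then show "transvection n c w * transvection n (-1 \<cdot>\<^sub>v c) w = 1\<^sub>m n" by simp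
qed

lemma dual_vec_exists:
  assumes c: "c \<in> carrier_vec n" "c \<noteq> 0\<^sub>v n"
  obtains w :: "'a::field vec" where "w \<in> carrier_vec n" "w \<bullet> c = 1"
proof -
  have "\<exists>j<n. c $ j \<noteq> 0"
  proof (rule ccontr)
    assume "\<not> ?thesis"
    then have "c = 0\<^sub>v n" using c(1) by (intro eq_vecI) auto
    with c(2) show False by blast
  qed
  then obtain j where j: "j < n" "c $ j \<noteq> 0" by blast
  let ?w = "(1 / c $ j) \<cdot>\<^sub>v unit_vec n j"
  have "?w \<bullet> c = (1 / c $ j) * (unit_vec n j \<bullet> c)" using c j by simp
  also have "unit_vec n j \<bullet> c = c $ j" using c j by (simp add: scalar_prod_left_unit)
  finally have "?w \<bullet> c = 1" using j by simp
  then show thesis using that[of ?w] by simp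
qed

context parabolic_character
begin

abbreviation "N \<equiv> r + s"

lemma transvection_parabolic:
  assumes c: "c \<in> carrier_vec N" and w: "w \<in> carrier_vec N"
    and inP: "(\<forall>i<s. c $ (i + r) = 0) \<or> (\<forall>j<r. w $ j = 0)"
    and G: "transvection N c w \<in> carrier (GL N)"
  shows "transvection N c w \<in> parabolic r s"
  using G
proof (rule parabolic_memI)
  fix i j assume "i < s" "j < r"
  then show "transvection N c w $$ (i + r, j) = 0"
    using c w inP by (auto simp: transvection_def outer_index[OF c w] outer_def)
qed

lemma \<sigma>_transvection:
  assumes c: "c \<in> carrier_vec N" and w: "w \<in> carrier_vec N" and wc: "w \<bullet> c = 0"
    and inP: "(\<forall>i<s. c $ (i + r) = 0) \<or> (\<forall>j<r. w $ j = 0)"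
  shows "transvection N c w \<in> parabolic r s" "\<sigma> (transvection N c w) = 1"
proof -
  have T: "transvection N (a \<cdot>\<^sub>v c) w \<in> parabolic r s" for a
    using c w wc inP by (intro transvection_parabolic transvection_GL) auto
  from T[of 1] show "transvection N c w \<in> parabolic r s" by simp
  obtain l :: 'a where l: "l \<noteq> 0" "l \<noteq> 1" using unit_ne_1_exists by blast
  show "\<sigma> (transvection N c w) = 1"
  proof (cases "c = 0\<^sub>v N \<or> w = 0\<^sub>v N")
    case True
    then have "transvection N c w = 1\<^sub>m N" using c w by (auto simp: transvection_def outer_def intro!: eq_matI)
    then show ?thesis by (simp add: \<sigma>_one)
  next
    case False
    show ?thesis using inP
    proof
      assume c0: "\<forall>i<s. c $ (i + r) = 0"
      obtain v where v: "v \<in> carrier_vec N" "v \<bullet> c = 1" using dual_vec_exists[OF c] False by blast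
      let ?t = "transvection N ((l - 1) \<cdot>\<^sub>v c) v"
      have tG: "?t \<in> carrier (GL N)" by (rule dilation_GL[OF c v l(1)])
      have "?t *\<^sub>v c = c + (v \<bullet> c) \<cdot>\<^sub>v ((l - 1) \<cdot>\<^sub>v c)"
        using c v by (intro transvection_apply) auto
      then have "?t *\<^sub>v c = l \<cdot>\<^sub>v c"
        using c unfolding v(2) by (auto simp: algebra_simps intro!: eq_vecI)
      moreover have "?t\<^sup>T *\<^sub>v w = w + (((l - 1) \<cdot>\<^sub>v c) \<bullet> w) \<cdot>\<^sub>v v"
        using c v w by (subst transvection_transpose[of _ N], simp, simp, intro transvection_apply) auto
      then have "?t\<^sup>T *\<^sub>v w = w"
        using c v w wc comm_scalar_prod[OF c w] by (auto intro!: eq_vecI)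
      ultimately show ?thesis
        using c0 c v tG
        by (intro hom_transvection_dilation[where H = "parabolic r s" and t = ?t and l = l, OF \<sigma>_mult \<sigma>_nonzero c w wc T _ _ l])
          (auto intro!: transvection_parabolic)
    next
      assume w0: "\<forall>j<r. w $ j = 0"
      obtain v where v: "v \<in> carrier_vec N" "v \<bullet> w = 1" using dual_vec_exists[OF w] False by blast
      then have wv: "w \<bullet> v = 1" using comm_scalar_prod[OF w v(1)] by simp
      let ?t = "transvection N ((l - 1) \<cdot>\<^sub>v v) w"
      have tG: "?t \<in> carrier (GL N)" by (rule dilation_GL[OF v(1) w wv l(1)])
      have "?t *\<^sub>v c = c + (w \<bullet> c) \<cdot>\<^sub>v ((l - 1) \<cdot>\<^sub>v v)"
        using c v w by (intro transvection_apply) auto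
      then have "?t *\<^sub>v c = c"
        using c v unfolding wc by (auto intro!: eq_vecI)
      moreover have "?t\<^sup>T *\<^sub>v w = w + (((l - 1) \<cdot>\<^sub>v v) \<bullet> w) \<cdot>\<^sub>v w"
        using v w by (subst transvection_transpose[of _ N], simp, simp, intro transvection_apply) auto
      then have "?t\<^sup>T *\<^sub>v w = l \<cdot>\<^sub>v w"
        using w v by (auto simp: algebra_simps intro!: eq_vecI)
      ultimately show ?thesis
        using w0 w v tG
        by (intro hom_transvection_dilation[where H = "parabolic r s" and t = ?t and l = l, OF \<sigma>_mult \<sigma>_nonzero c w wc T _ _ l])
          (auto intro!: transvection_parabolic)
    qed
  qed
qed

end

section \<open>The induced representation\<close>

lemma near_one_open:
  assumes "0 < e" "e < 1"
  shows "openin (GL_topology n) (near_one n e :: 'a::nonarch_local_field mat set)"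
  unfolding openin_GL_topology
proof (intro conjI ballI)
  show "near_one n e \<subseteq> carrier (GL n)" using near_one_GL[OF _ less_imp_le[OF assms(1)] assms(2)] by blast
  fix x :: "'a mat" assume x: "x \<in> near_one n e"
  have "y \<in> near_one n e" if y: "y \<in> carrier (GL n)" "mbound (y - x) e" for y
  proof -
    have c: "y \<in> carrier_mat n n" "x \<in> carrier_mat n n" using x y by (auto simp: near_one_def)
    have "mbound ((y - x) + (x - 1\<^sub>m n)) e"
      using x y c by (intro mbound_add[of _ _ _ n n]) (auto simp: near_one_def)
    moreover have "(y - x) + (x - 1\<^sub>m n) = y - 1\<^sub>m n" using c by (intro eq_matI) auto
    ultimately show ?thesis using c by (simp add: near_one_def)
  qed
  then show "\<exists>d>0. \<forall>y\<in>carrier (GL n). mbound (y - x) d \<longrightarrow> y \<in> near_one n e"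
    by (intro exI[of _ e] conjI ballI impI assms(1))
qed

lemma near_one_subgroup:
  assumes "0 < e" "e < 1"
  shows "subgroup (near_one n e :: 'a::nonarch_local_field mat set) (GL n)"
  using assms near_one_GL[of _ n e] near_one_mult[of _ n e] near_one_one[of e n] near_one_inv[of _ n e]
  by (intro subgroup.intro) auto

lemma near_one_conj:
  assumes h: "h \<in> carrier (GL n)" and e: "0 < (e::real)"
  shows "\<exists>d>0. d < 1 \<and> (\<forall>k\<in>near_one n d. GLinv n h * k * h \<in> near_one n e)"
proof -
  obtain b where b: "1 \<le> b" "mbound (GLinv n h) b" using mbound_exists by blast
  obtain c where c: "1 \<le> c" "mbound h c" using mbound_exists by blast
  have hc: "h \<in> carrier_mat n n" "GLinv n h \<in> carrier_mat n n" "GLinv n h * h = 1\<^sub>m n" using h by auto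
  define d where "d = min (1/2) (e / (b * c))"
  have d: "0 < d" "d < 1" "d \<le> e / (b * c)" using e b c by (auto simp: d_def)
  have "GLinv n h * k * h \<in> near_one n e" if k: "k \<in> near_one n d" for k
  proof -
    have "mbound (GLinv n h * k * h - 1\<^sub>m n) (b * d * c)"
      using mult_near_one_bound[OF hc(2) b(2) _ hc(1) c(2) _ k] b c d hc(3) by simp
    then have "mbound (GLinv n h * k * h - 1\<^sub>m n) e"
      using d b c by (elim mbound_mono) (simp add: field_simps)
    then show ?thesis using hc k by (auto simp: near_one_def)
  qed
  then show ?thesis using d by blast
qed

context parabolic_character
begin

abbreviation "G \<equiv> carrier (GL N) :: 'a mat set"

definition Ind :: "('a mat \<Rightarrow> complex) set" where
  "Ind = {f \<in> G \<rightarrow>\<^sub>E UNIV. (\<forall>p\<in>parabolic r s. \<forall>g\<in>G. f (p * g) = \<sigma> p * f g) \<and>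
     (\<exists>e>0. e < 1 \<and> (\<forall>g\<in>G. \<forall>k\<in>near_one N e. f (g * k) = f g))}"

lemma IndI:
  assumes "f \<in> extensional G" "\<And>p g. p \<in> parabolic r s \<Longrightarrow> g \<in> G \<Longrightarrow> f (p * g) = \<sigma> p * f g"
    "0 < e" "e < 1" "\<And>g k. g \<in> G \<Longrightarrow> k \<in> near_one N e \<Longrightarrow> f (g * k) = f g"
  shows "f \<in> Ind"
  using assms unfolding Ind_def PiE_def by auto

lemma Ind_ext: "f \<in> Ind \<Longrightarrow> f \<in> extensional G"
  unfolding Ind_def PiE_def by blast

lemma Ind_equivariant: "f \<in> Ind \<Longrightarrow> p \<in> parabolic r s \<Longrightarrow> g \<in> G \<Longrightarrow> f (p * g) = \<sigma> p * f g"
  unfolding Ind_def by blast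

lemma Ind_smooth:
  assumes "f \<in> Ind"
  obtains e where "0 < e" "e < 1" "\<And>g k. g \<in> G \<Longrightarrow> k \<in> near_one N e \<Longrightarrow> f (g * k) = f g"
  using assms unfolding Ind_def by blast

lemma ind_space_eq_Ind:
  assumes "\<And>p. p \<in> parabolic r s \<Longrightarrow> \<sigma> p = of_real (sqrt (parabolic_modulus r s p)) * \<tau> p"
  shows "ind_space (GL N) (GL_topology N) (parabolic r s) \<tau> = Ind"
proof (intro equalityI subsetI)
  fix f assume f: "f \<in> ind_space (GL N) (GL_topology N) (parabolic r s) \<tau>"
  have eq: "f (p * g) = \<sigma> p * f g" if "p \<in> parabolic r s" "g \<in> G" for p g
    using f that assms[OF that(1)] unfolding ind_space_def by auto
  obtain K where K: "subgroup K (GL N)" "openin (GL_topology N) K" "\<And>g k. g \<in> G \<Longrightarrow> k \<in> K \<Longrightarrow> f (g * k) = f g"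
    using f unfolding ind_space_def by auto
  obtain e where e: "e > 0" "e < 1" "near_one N e \<subseteq> K"
    using open_GL_near_one[OF K(2)] subgroup.one_closed[OF K(1)] by auto
  show "f \<in> Ind"
    using f eq e K(3) by (intro IndI[of f e]) (auto simp: ind_space_def PiE_def)
next
  fix f assume f: "f \<in> Ind"
  obtain e where e: "0 < e" "e < 1" "\<And>g k. g \<in> G \<Longrightarrow> k \<in> near_one N e \<Longrightarrow> f (g * k) = f g"
    using Ind_smooth[OF f] by blast
  show "f \<in> ind_space (GL N) (GL_topology N) (parabolic r s) \<tau>"
    unfolding ind_space_def
  proof (intro CollectI conjI ballI)
    show "f \<in> G \<rightarrow>\<^sub>E UNIV" using Ind_ext[OF f] by (simp add: PiE_def)
    show "\<exists>K. subgroup K (GL N) \<and> openin (GL_topology N) K \<and>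
        (\<forall>g\<in>G. \<forall>k\<in>K. f (g \<otimes>\<^bsub>GL N\<^esub> k) = f g)"
      by (intro exI[of _ "near_one N e"] conjI ballI near_one_subgroup near_one_open e(1,2)) (simp add: e(3))
  qed (use Ind_equivariant[OF f] assms in simp)
qed

lemma Ind_eqI: "f \<in> Ind \<Longrightarrow> h \<in> Ind \<Longrightarrow> (\<And>g. g \<in> G \<Longrightarrow> f g = h g) \<Longrightarrow> f = h"
  by (rule extensionalityI[OF Ind_ext Ind_ext])

lemma Ind_zero: "(\<lambda>x\<in>G. 0) \<in> Ind"
  by (rule IndI[of _ "1/2"]) (auto simp: near_one_GL parabolic_GL)

lemma Ind_add:
  assumes f: "f \<in> Ind" and h: "h \<in> Ind"
  shows "(\<lambda>x\<in>G. f x + h x) \<in> Ind"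
proof -
  obtain e where e: "0 < e" "e < 1" "\<And>g k. g \<in> G \<Longrightarrow> k \<in> near_one N e \<Longrightarrow> f (g * k) = f g"
    using Ind_smooth[OF f] by blast
  obtain d where d: "0 < d" "d < 1" "\<And>g k. g \<in> G \<Longrightarrow> k \<in> near_one N d \<Longrightarrow> h (g * k) = h g"
    using Ind_smooth[OF h] by blast
  show ?thesis
  proof (rule IndI[of _ "min d e"])
    fix g k :: "'a mat" assume g: "g \<in> G" and k: "k \<in> near_one N (min d e)"
    have "k \<in> near_one N d" "k \<in> near_one N e" using near_one_mono[OF k] by auto
    moreover have "k \<in> G" using near_one_GL[OF k] d e by auto
    ultimately show "(\<lambda>x\<in>G. f x + h x) (g * k) = (\<lambda>x\<in>G. f x + h x) g"
      using d(3)[OF g] e(3)[OF g] g by simp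
  next
    fix p g :: "'a mat" assume p: "p \<in> parabolic r s" and g: "g \<in> G"
    then show "(\<lambda>x\<in>G. f x + h x) (p * g) = \<sigma> p * (\<lambda>x\<in>G. f x + h x) g"
      using Ind_equivariant[OF f p g] Ind_equivariant[OF h p g] parabolic_GL[OF p] by (simp add: algebra_simps)
  qed (use d e in auto)
qed

lemma Ind_smult:
  assumes f: "f \<in> Ind" shows "(\<lambda>x\<in>G. c * f x) \<in> Ind"
proof -
  obtain e where e: "0 < e" "e < 1" "\<And>g k. g \<in> G \<Longrightarrow> k \<in> near_one N e \<Longrightarrow> f (g * k) = f g"
    using Ind_smooth[OF f] by blast
  show ?thesis
  proof (rule IndI[of _ e])
    fix p g :: "'a mat" assume p: "p \<in> parabolic r s" and g: "g \<in> G"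
    then show "(\<lambda>x\<in>G. c * f x) (p * g) = \<sigma> p * (\<lambda>x\<in>G. c * f x) g"
      using Ind_equivariant[OF f p g] parabolic_GL[OF p] by simp
  next
    fix g k :: "'a mat" assume g: "g \<in> G" and k: "k \<in> near_one N e"
    have "k \<in> G" using near_one_GL[OF k] e by simp
    then show "(\<lambda>x\<in>G. c * f x) (g * k) = (\<lambda>x\<in>G. c * f x) g" using e(3)[OF g k] g by simp
  qed (use e in auto)
qed

definition act :: "'a mat \<Rightarrow> ('a mat \<Rightarrow> complex) \<Rightarrow> 'a mat \<Rightarrow> complex" where
  "act h f = (\<lambda>x\<in>G. f (x * h))"

lemma act_apply: "x \<in> G \<Longrightarrow> act h f x = f (x * h)"
  by (simp add: act_def)

lemma Ind_act:
  assumes f: "f \<in> Ind" and h: "h \<in> G" shows "act h f \<in> Ind"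
proof -
  obtain e where e: "0 < e" "e < 1" "\<And>g k. g \<in> G \<Longrightarrow> k \<in> near_one N e \<Longrightarrow> f (g * k) = f g"
    using Ind_smooth[OF f] by blast
  obtain d where d: "0 < d" "d < 1" "\<And>k. k \<in> near_one N d \<Longrightarrow> GLinv N h * k * h \<in> near_one N e"
    using near_one_conj[OF h e(1)] by blast
  show ?thesis
  proof (rule IndI[of _ d])
    fix p g :: "'a mat" assume p: "p \<in> parabolic r s" and g: "g \<in> G"
    have pG: "p \<in> G" by (rule parabolic_GL[OF p])
    have "p * g * h = p * (g * h)" using pG g h by (intro assoc_mult_mat[of _ N N _ N _ N]) auto
    then show "act h f (p * g) = \<sigma> p * act h f g"
      using Ind_equivariant[OF f p, of "g * h"] g h pG by (simp add: act_apply)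
  next
    fix g k :: "'a mat" assume g: "g \<in> G" and k: "k \<in> near_one N d"
    have kG: "k \<in> G" using near_one_GL[OF k] d by simp
    have c: "g \<in> carrier_mat N N" "h \<in> carrier_mat N N" "k \<in> carrier_mat N N" "GLinv N h \<in> carrier_mat N N"
      using g h kG by auto
    have "(g * h) * (GLinv N h * k * h) = g * ((h * GLinv N h) * (k * h))"
      using c by (simp add: assoc_mult_mat[of _ N N _ N _ N])
    also have "\<dots> = g * k * h" using h c by (simp add: assoc_mult_mat[of _ N N _ N _ N])
    finally have "f (g * k * h) = f ((g * h) * (GLinv N h * k * h))" by simp
    also have "\<dots> = f (g * h)" using g h by (intro e(3) d(3) k) simp
    finally show "act h f (g * k) = act h f g" using g kG by (simp add: act_apply)
  qed (use d in \<open>auto simp: act_def\<close>)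
qed

lemma act_mult:
  assumes "h \<in> G" "k \<in> G" shows "act (h * k) f = act h (act k f)"
proof (rule ext)
  fix x show "act (h * k) f x = act h (act k f) x"
  proof (cases "x \<in> G")
    case True
    then have "x * (h * k) = x * h * k" using assms by (intro assoc_mult_mat[symmetric, of _ N N _ N _ N]) auto
    then show ?thesis using True assms by (simp add: act_apply)
  qed (simp add: act_def)
qed

lemma act_one: "f \<in> Ind \<Longrightarrow> act (1\<^sub>m N) f = f"
proof (rule extensionalityI[of _ G])
  fix x assume "x \<in> G"
  then show "act (1\<^sub>m N) f x = f x" by (simp add: act_apply right_mult_one_mat[of x N N])
qed (auto simp: act_def Ind_ext)

definition V :: "(complex, 'a mat \<Rightarrow> complex) module" where
  "V = (ring.func_space complex_ring G)\<lparr>carrier := Ind\<rparr>"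

lemma V_simps:
  "carrier V = Ind" "zero V = (\<lambda>x\<in>G. 0)" "add V = (\<lambda>f h. \<lambda>x\<in>G. f x + h x)" "smult V = (\<lambda>c f. \<lambda>x\<in>G. c * f x)"
  by (simp_all add: V_def class_ring.func_space_def)

lemma V_module: "module complex_ring V"
proof -
  interpret M: module complex_ring "ring.func_space complex_ring G" by (rule class_cring.func_space_is_module)
  have "submodule complex_ring Ind (ring.func_space complex_ring G)"
  proof
    show "Ind \<subseteq> carrier (ring.func_space complex_ring G)"
      using Ind_ext by (auto simp: class_ring.func_space_def PiE_def)
  qed (auto simp: class_ring.func_space_def intro: Ind_add Ind_smult Ind_zero M.module_axioms)
  then show ?thesis unfolding V_def by (rule M.submodule_is_module)
qed

sublocale V: module complex_ring V by (rule V_module)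

lemma V_minus:
  assumes "f \<in> Ind" "h \<in> Ind" shows "f \<ominus>\<^bsub>V\<^esub> h = (\<lambda>x\<in>G. f x - h x)"
proof -
  have "\<ominus>\<^bsub>V\<^esub> h = (\<lambda>x\<in>G. - h x)"
  proof (rule V.M.minus_equality)
    show "(\<lambda>x\<in>G. - h x) \<oplus>\<^bsub>V\<^esub> h = \<zero>\<^bsub>V\<^esub>" by (auto simp: V_simps)
    show "(\<lambda>x\<in>G. - h x) \<in> carrier V" using Ind_smult[OF assms(2), of "-1"] by (simp add: V_simps)
  qed (use assms in \<open>simp add: V_simps\<close>)
  then show ?thesis by (auto simp: a_minus_def V_simps)
qed

end

section \<open>Lattices of matrices and their transversals\<close>

definition box :: "nat \<Rightarrow> real \<Rightarrow> 'a::nonarch_local_field mat set" where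
  "box n R = {x \<in> carrier_mat n n. mbound x R}"

lemma box_carrier: "x \<in> box n R \<Longrightarrow> x \<in> carrier_mat n n"
  by (simp add: box_def)

lemma box_mono: "x \<in> box n R \<Longrightarrow> R \<le> R' \<Longrightarrow> x \<in> box n R'"
  by (auto simp: box_def intro: mbound_mono)

lemma box_zero: "0 \<le> R \<Longrightarrow> 0\<^sub>m n n \<in> box n R"
  by (simp add: box_def)

lemma box_add: "x \<in> box n R \<Longrightarrow> y \<in> box n R \<Longrightarrow> x + y \<in> box n R"
  by (auto simp: box_def intro: mbound_add)

lemma box_diff: "x \<in> box n R \<Longrightarrow> y \<in> box n R \<Longrightarrow> x - y \<in> box n R"
  by (auto simp: box_def intro: mbound_diff)

lemma box_uminus: "x \<in> box n R \<Longrightarrow> - x \<in> box n R"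
  by (auto simp: box_def)

definition transversal :: "nat \<Rightarrow> real \<Rightarrow> real \<Rightarrow> 'a::nonarch_local_field mat set \<Rightarrow> bool" where
  "transversal n R \<rho> D \<longleftrightarrow> finite D \<and> D \<subseteq> box n R \<and> (\<forall>x\<in>box n R. \<exists>!d. d \<in> D \<and> x - d \<in> box n \<rho>)"

lemma transversal_exists:
  assumes "0 < \<rho>"
  shows "\<exists>D :: 'a::nonarch_local_field mat set. transversal n R \<rho> D"
proof -
  obtain S :: "'a set" where S: "finite S" "\<And>x. absv x \<le> R \<Longrightarrow> \<exists>s\<in>S. absv (x - s) \<le> \<rho>"
    using finite_net[OF assms] by blast
  define cd where "cd x = (SOME s. s \<in> S \<and> absv (x - s) \<le> \<rho>)" for x
  have cd: "cd x \<in> S \<and> absv (x - cd x) \<le> \<rho>" if "absv x \<le> R" for x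
  proof -
    have "\<exists>s. s \<in> S \<and> absv (x - s) \<le> \<rho>" using S(2)[OF that] by blast
    then show ?thesis unfolding cd_def by (rule someI_ex)
  qed
  define code where "code x = mat n n (\<lambda>ij. cd (x $$ ij))" for x
  define rep where "rep x = (SOME y. y \<in> box n R \<and> y - x \<in> box n \<rho>)" for x :: "'a mat"
  have code_eq: "x - y \<in> box n \<rho>" if x: "x \<in> box n R" and y: "y \<in> box n R" and eq: "code x = code y" for x y
  proof -
    have "absv ((x - y) $$ (i, j)) \<le> \<rho>" if ij: "i < n" "j < n" for i j
    proof -
      have "absv (x $$ (i,j)) \<le> R" "absv (y $$ (i,j)) \<le> R"
        using x y ij mboundD[of _ R n n i j] by (auto simp: box_def)
      moreover have "cd (x $$ (i,j)) = cd (y $$ (i,j))" using arg_cong[OF eq, of "\<lambda>A. A $$ (i,j)"] ij by (simp add: code_def)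
      ultimately have "absv (x $$ (i,j) - cd (x $$ (i,j))) \<le> \<rho>" "absv (y $$ (i,j) - cd (x $$ (i,j))) \<le> \<rho>"
        using cd[of "x $$ (i,j)"] cd[of "y $$ (i,j)"] by simp_all
      then have "absv ((x $$ (i,j) - cd (x $$ (i,j))) - (y $$ (i,j) - cd (x $$ (i,j)))) \<le> \<rho>"
        by (rule absv_diff_le)
      then show ?thesis using x y ij by (auto simp: box_def)
    qed
    then show ?thesis using x y by (auto simp: box_def mbound_def)
  qed
  have rep: "rep x \<in> box n R \<and> rep x - x \<in> box n \<rho>" if x: "x \<in> box n R" for x
    unfolding rep_def
  proof (rule someI)
    show "x \<in> box n R \<and> x - x \<in> box n \<rho>" using x code_eq[OF x x refl] by simp
  qed
  have rep_eq: "rep x = rep y" if x: "x \<in> box n R" and y: "y \<in> box n R" and xy: "x - y \<in> box n \<rho>" for x y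
  proof -
    have "z - x \<in> box n \<rho> \<longleftrightarrow> z - y \<in> box n \<rho>" if z: "z \<in> box n R" for z
    proof
      have c: "x \<in> carrier_mat n n" "y \<in> carrier_mat n n" "z \<in> carrier_mat n n"
        using x y z by (auto simp: box_def)
      assume "z - x \<in> box n \<rho>"
      then have "(z - x) + (x - y) \<in> box n \<rho>" using xy by (rule box_add)
      moreover have "(z - x) + (x - y) = z - y" using c by (intro eq_matI) auto
      ultimately show "z - y \<in> box n \<rho>" by simp
    next
      have c: "x \<in> carrier_mat n n" "y \<in> carrier_mat n n" "z \<in> carrier_mat n n"
        using x y z by (auto simp: box_def)
      assume "z - y \<in> box n \<rho>"
      then have "(z - y) - (x - y) \<in> box n \<rho>" using xy by (rule box_diff)
      moreover have "(z - y) - (x - y) = z - x" using c by (intro eq_matI) auto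
      ultimately show "z - x \<in> box n \<rho>" by simp
    qed
    then have "(\<lambda>z. z \<in> box n R \<and> z - x \<in> box n \<rho>) = (\<lambda>z. z \<in> box n R \<and> z - y \<in> box n \<rho>)" by blast
    then show ?thesis unfolding rep_def by simp
  qed
  have "finite (rep ` box n R)"
  proof -
    have "rep ` box n R \<subseteq> (\<lambda>a. rep (SOME x. x \<in> box n R \<and> code x = a)) ` (code ` box n R)"
    proof
      fix r assume "r \<in> rep ` box n R"
      then obtain x where x: "x \<in> box n R" "r = rep x" by blast
      let ?y = "SOME y. y \<in> box n R \<and> code y = code x"
      have y: "?y \<in> box n R \<and> code ?y = code x" by (rule someI[of _ x]) (simp add: x)
      then have "rep ?y = rep x" using x(1) by (intro rep_eq code_eq) auto
      then have "r = (\<lambda>a. rep (SOME x. x \<in> box n R \<and> code x = a)) (code x)" using x(2) by simp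
      then show "r \<in> (\<lambda>a. rep (SOME x. x \<in> box n R \<and> code x = a)) ` (code ` box n R)"
        by (rule image_eqI) (rule imageI[OF x(1)])
    qed
    moreover have "finite (code ` box n R)"
    proof (rule finite_subset)
      show "code ` box n R \<subseteq> (\<lambda>a. mat n n a) ` (({..<n} \<times> {..<n}) \<rightarrow>\<^sub>E S)"
      proof (rule image_subsetI)
        fix x :: "'a mat" assume x: "x \<in> box n R"
        have "cd (x $$ (i,j)) \<in> S" if "i < n" "j < n" for i j
          using x that mboundD[of x R n n i j] cd by (auto simp: box_def)
        then have "(\<lambda>ij\<in>{..<n} \<times> {..<n}. cd (x $$ ij)) \<in> ({..<n} \<times> {..<n}) \<rightarrow>\<^sub>E S" by auto
        moreover have "code x = mat n n (\<lambda>ij\<in>{..<n} \<times> {..<n}. cd (x $$ ij))"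
          unfolding code_def by (intro eq_matI) auto
        ultimately show "code x \<in> (\<lambda>a. mat n n a) ` (({..<n} \<times> {..<n}) \<rightarrow>\<^sub>E S)" by blast
      qed
      show "finite ((\<lambda>a. mat n n a) ` (({..<n} \<times> {..<n}) \<rightarrow>\<^sub>E S))"
        using S(1) by (intro finite_imageI finite_PiE) auto
    qed
    ultimately show ?thesis using finite_surj by blast
  qed
  moreover have "\<exists>!d. d \<in> rep ` box n R \<and> x - d \<in> box n \<rho>" if x: "x \<in> box n R" for x
  proof (rule ex1I[of _ "rep x"])
    have c: "x \<in> carrier_mat n n" "rep x \<in> carrier_mat n n" using x rep[OF x] by (auto simp: box_def)
    have "- (rep x - x) = x - rep x" using c by (intro eq_matI) auto
    moreover have "- (rep x - x) \<in> box n \<rho>" using rep[OF x] by (intro box_uminus) simp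
    ultimately show "rep x \<in> rep ` box n R \<and> x - rep x \<in> box n \<rho>" using x by simp
  next
    fix d assume d: "d \<in> rep ` box n R \<and> x - d \<in> box n \<rho>"
    then obtain y where y: "y \<in> box n R" "d = rep y" by blast
    have dB: "d \<in> box n R" "d - y \<in> box n \<rho>" using rep[OF y(1)] y(2) by simp_all
    have "rep x = rep d" by (rule rep_eq[OF x dB(1) conjunct2[OF d]])
    also have "\<dots> = rep y" by (rule rep_eq[OF dB(1) y(1) dB(2)])
    finally show "d = rep x" using y by simp
  qed
  ultimately show ?thesis unfolding transversal_def using rep by (intro exI[of _ "rep ` box n R"]) auto
qed

lemma transversalD:
  assumes "transversal n R \<rho> D"
  shows "finite D" "d \<in> D \<Longrightarrow> d \<in> box n R" "x \<in> box n R \<Longrightarrow> \<exists>!d. d \<in> D \<and> x - d \<in> box n \<rho>"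
  using assms unfolding transversal_def by blast+

lemma transversal_nonempty: "transversal n R \<rho> D \<Longrightarrow> 0 \<le> R \<Longrightarrow> D \<noteq> {}"
  using transversalD(3)[OF _ box_zero] by blast

lemma transversal_diff:
  assumes D: "transversal n R \<rho> D" and "0 \<le> \<rho>" "d \<in> D" "d' \<in> D" "d - d' \<in> box n \<rho>"
  shows "d = d'"
proof -
  have d: "d \<in> box n R" using transversalD(2)[OF D] assms by blast
  have "d - d = 0\<^sub>m n n" using box_carrier[OF d] by auto
  then have "d - d \<in> box n \<rho>" using assms(2) by (simp add: box_zero)
  then show ?thesis using transversalD(3)[OF D d] assms by blast
qed

text \<open>Sums over a transversal are invariant under translation, like the integral they stand for.\<close>

lemma transversal_translate:
  fixes F :: "'a::nonarch_local_field mat \<Rightarrow> complex"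
  assumes D: "transversal n R \<rho> D" and \<rho>: "0 \<le> \<rho>"
    and per: "\<And>x y. x \<in> box n R \<Longrightarrow> y \<in> box n \<rho> \<Longrightarrow> x + y \<in> box n R \<Longrightarrow> F (x + y) = F x"
    and x: "x \<in> box n R"
  shows "(\<Sum>d\<in>D. F (x + d)) = (\<Sum>d\<in>D. F d)"
proof -
  have "\<exists>e. e \<in> D \<and> (x + d) - e \<in> box n \<rho>" if "d \<in> D" for d
    using transversalD(3)[OF D box_add[OF x transversalD(2)[OF D that]]] by blast
  then obtain p where p: "\<And>d. d \<in> D \<Longrightarrow> p d \<in> D \<and> (x + d) - p d \<in> box n \<rho>" by metis
  have inj: "inj_on p D"
  proof (rule inj_onI)
    fix d d' assume d: "d \<in> D" "d' \<in> D" "p d = p d'"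
    have c: "x \<in> carrier_mat n n" "d \<in> carrier_mat n n" "d' \<in> carrier_mat n n" "p d \<in> carrier_mat n n"
      using x transversalD(2)[OF D d(1)] transversalD(2)[OF D d(2)] transversalD(2)[OF D conjunct1[OF p[OF d(1)]]]
      by (auto simp: box_def)
    have "((x + d) - p d) - ((x + d') - p d) \<in> box n \<rho>"
      using p[OF d(1)] p[OF d(2)] unfolding d(3) by (intro box_diff[of "x + d - p d'" n \<rho> "x + d' - p d'"]) blast+
    moreover have "((x + d) - p d) - ((x + d') - p d) = d - d'" using c by (intro eq_matI) auto
    ultimately have "d - d' \<in> box n \<rho>" by simp
    then show "d = d'" by (rule transversal_diff[OF D \<rho> d(1,2)])
  qed
  have bij: "bij_betw p D D"
    using endo_inj_surj[OF transversalD(1)[OF D] _ inj] p inj by (auto simp: bij_betw_def)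
  have "F (x + d) = F (p d)" if d: "d \<in> D" for d
  proof -
    have pd: "p d \<in> box n R" using p[OF d] transversalD(2)[OF D] by blast
    have c: "x \<in> carrier_mat n n" "d \<in> carrier_mat n n" "p d \<in> carrier_mat n n"
      using x transversalD(2)[OF D d] pd by (auto simp: box_def)
    have eq: "p d + ((x + d) - p d) = x + d" using c by (intro eq_matI) auto
    have "F (p d + ((x + d) - p d)) = F (p d)"
      using p[OF d] box_add[OF x transversalD(2)[OF D d]] by (intro per pd) (auto simp: eq)
    then show ?thesis by (simp add: eq)
  qed
  then have "(\<Sum>d\<in>D. F (x + d)) = (\<Sum>d\<in>D. F (p d))" by (intro sum.cong) auto
  also have "\<dots> = (\<Sum>d\<in>D. F d)" by (rule sum.reindex_bij_betw[OF bij])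
  finally show ?thesis .
qed

lemma matrix_trace_outer:
  assumes "c \<in> carrier_vec n" "w \<in> carrier_vec n"
  shows "(\<Sum>i<n. outer c w $$ (i,i)) = c \<bullet> (w :: 'a::comm_ring_1 vec)"
  using assms by (auto simp: outer_def scalar_prod_def lessThan_atLeast0 intro!: sum.cong)

text \<open>The multiple of a unit vector dual to an entry of \<open>v\<close> of maximal absolute value.\<close>

lemma bounded_outer:
  fixes v :: "'a::nonarch_local_field vec"
  assumes v: "v \<in> carrier_vec n" "v \<noteq> 0\<^sub>v n"
  obtains w where "w \<in> carrier_vec n" "v \<bullet> w = t" "w \<bullet> v = t" "outer v w \<in> box n (absv t)" "outer w v \<in> box n (absv t)"
proof -
  have "\<exists>j<n. v $ j \<noteq> 0"
  proof (rule ccontr)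
    assume "\<not> ?thesis"
    then have "v = 0\<^sub>v n" using v(1) by (intro eq_vecI) auto
    with v(2) show False by blast
  qed
  then obtain j where j: "j < n" "v $ j \<noteq> 0" by blast
  define S where "S = (\<lambda>i. absv (v $ i)) ` {..<n}"
  have S: "finite S" "S \<noteq> {}" using j by (auto simp: S_def)
  obtain k where k: "k < n" "absv (v $ k) = Max S" using Max_in[OF S] by (auto simp: S_def)
  have le: "absv (v $ i) \<le> absv (v $ k)" if "i < n" for i
    unfolding k(2) using S that by (auto simp: S_def intro!: Max_ge)
  have vk: "v $ k \<noteq> 0" using le[OF j(1)] j(2) by (metis absv_eq_0_iff absv_nonneg antisym)
  let ?w = "(t / v $ k) \<cdot>\<^sub>v unit_vec n k"
  have w: "?w \<in> carrier_vec n" by simp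
  have wv: "?w \<bullet> v = t" using v(1) k vk by (simp add: scalar_prod_left_unit)
  have vw: "v \<bullet> ?w = t" using wv comm_scalar_prod[OF v(1) w] by simp
  have b: "absv (v $ i * (t / v $ k)) \<le> absv t" if "i < n" for i
  proof -
    have "absv (v $ i) * absv t \<le> absv (v $ k) * absv t" using le[OF that] by (intro mult_right_mono) auto
    then show ?thesis using vk by (simp add: absv_mult absv_divide field_simps)
  qed
  have "outer v ?w \<in> box n (absv t)" "outer ?w v \<in> box n (absv t)"
    using v(1) k b by (auto simp: box_def mbound_def outer_def absv_mult mult.commute)
  then show thesis using that[OF w vw wv] by blast
qed

lemma zero_row_kernel:
  fixes M :: "'a::field mat"
  assumes M: "M \<in> carrier_mat n n" and i: "i < n" "\<And>j. j < n \<Longrightarrow> M $$ (i,j) = 0"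
  shows "det M = 0"
proof -
  have "M\<^sup>T *\<^sub>v unit_vec n i = 0\<^sub>v n"
    using M i by (intro eq_vecI) (auto simp: scalar_prod_right_unit)
  moreover have "unit_vec n i \<noteq> (0\<^sub>v n :: 'a vec)"
    using i(1) by (metis index_unit_vec(1) index_zero_vec(1) zero_neq_one)
  ultimately have "\<exists>v. v \<in> carrier_vec n \<and> v \<noteq> 0\<^sub>v n \<and> M\<^sup>T *\<^sub>v v = 0\<^sub>v n"
    by (intro exI[of _ "unit_vec n i"]) simp
  then have "det M\<^sup>T = 0"
    using M by (intro iffD2[OF det_0_iff_vec_prod_zero[of "M\<^sup>T" n]]) simp
  then show ?thesis using det_transpose[OF M] by simp
qed

locale twisted_character = parabolic_character r s \<sigma> for r s and \<sigma> :: "'a::nonarch_local_field mat \<Rightarrow> complex" +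
  fixes n :: nat and \<psi> :: "'a \<Rightarrow> complex" and t :: 'a
  assumes rs: "r + s = n + n"
    and \<psi>_add: "\<psi> (x + y) = \<psi> x * \<psi> y"
    and \<psi>_smooth: "\<exists>e>0. \<forall>x. absv x \<le> e \<longrightarrow> \<psi> x = 1"
    and \<psi>_t: "\<psi> t \<noteq> 1"
begin

definition u :: "'a mat \<Rightarrow> 'a mat" where
  "u x = four_block_mat (1\<^sub>m n) x (0\<^sub>m n n) (1\<^sub>m n)"

definition \<Psi> :: "'a mat \<Rightarrow> complex" where
  "\<Psi> x = \<psi> (\<Sum>i<n. x $$ (i,i))"

abbreviation "M \<equiv> carrier_mat n n :: 'a mat set"

lemma u_carrier: "x \<in> M \<Longrightarrow> u x \<in> carrier_mat N N"
  unfolding u_def rs by (intro four_block_carrier_mat) auto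

lemma u_add: "x \<in> M \<Longrightarrow> y \<in> M \<Longrightarrow> u x * u y = u (x + y)"
  unfolding u_def using parabolic_mult_blocks[of "1\<^sub>m n" n x n "1\<^sub>m n" "1\<^sub>m n" y "1\<^sub>m n"]
  by (simp add: comm_add_mat[of x n n y])

lemma u_zero: "u (0\<^sub>m n n) = 1\<^sub>m N"
  by (simp add: u_def rs)

lemma u_G: "x \<in> M \<Longrightarrow> u x \<in> G"
proof -
  assume x: "x \<in> M"
  have "x + - x = 0\<^sub>m n n" using x by (intro eq_matI) auto
  then have "u x * u (- x) = 1\<^sub>m N" using x by (simp add: u_add u_zero)
  then show ?thesis using x by (intro GL_intro(1)[OF u_carrier u_carrier]) auto
qed

lemma u_near:
  assumes x: "x \<in> box n e" and e: "0 \<le> e" shows "u x \<in> near_one N e"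
proof -
  have xM: "x \<in> M" and xb: "mbound x e" using x by (auto simp: box_def)
  have "absv ((u x - 1\<^sub>m N) $$ (i, j)) \<le> e" if "i < n + n" "j < n + n" for i j
    using xM mboundD[OF xb xM, of i "j - n"] that e unfolding rs u_def by auto
  then show ?thesis using u_carrier[OF xM] unfolding near_one_def mbound_def by (simp add: rs)
qed

lemma \<psi>_zero: "\<psi> 0 = 1"
  using \<psi>_smooth by auto

lemma \<Psi>_add: "x \<in> M \<Longrightarrow> y \<in> M \<Longrightarrow> \<Psi> (x + y) = \<Psi> x * \<Psi> y"
  unfolding \<Psi>_def by (simp add: sum.distrib flip: \<psi>_add)

lemma \<Psi>_zero: "\<Psi> (0\<^sub>m n n) = 1"
  by (simp add: \<Psi>_def \<psi>_zero)

lemma \<Psi>_inverse: "x \<in> M \<Longrightarrow> \<Psi> (- x) * \<Psi> x = 1"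
proof -
  assume x: "x \<in> M"
  have "- x + x = 0\<^sub>m n n" using x by (intro eq_matI) auto
  then show ?thesis using x \<Psi>_add[of "- x" x] by (simp add: \<Psi>_zero)
qed

lemma \<Psi>_smooth: "\<exists>e>0. \<forall>x\<in>box n e. \<Psi> x = 1"
proof -
  obtain e where e: "e > 0" "\<And>x. absv x \<le> e \<Longrightarrow> \<psi> x = 1" using \<psi>_smooth by blast
  have "\<Psi> x = 1" if x: "x \<in> box n e" for x
    unfolding \<Psi>_def
  proof (intro e(2) absv_sum_le)
    fix i assume "i \<in> {..<n}"
    then show "absv (x $$ (i,i)) \<le> e" using x mboundD[of x e n n i i] by (auto simp: box_def)
  qed (use e in simp)
  then show ?thesis using e(1) by blast
qed

lemma G_mult: "g \<in> G \<Longrightarrow> h \<in> G \<Longrightarrow> g * h \<in> G"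
  by simp

lemma G_assoc: "g \<in> G \<Longrightarrow> h \<in> G \<Longrightarrow> k \<in> G \<Longrightarrow> g * h * k = g * (h * k)"
  by (intro assoc_mult_mat[of _ N N _ N _ N]) auto

subsection \<open>The twisted coinvariants\<close>

definition gens :: "('a mat \<Rightarrow> complex) set" where
  "gens = {act (u x) f \<ominus>\<^bsub>V\<^esub> \<Psi> x \<odot>\<^bsub>V\<^esub> f | x f. x \<in> M \<and> f \<in> Ind}"

definition W :: "('a mat \<Rightarrow> complex) set" where
  "W = V.span gens"

lemma gens_eq: "gens = {\<lambda>g\<in>G. f (g * u x) - \<Psi> x * f g | x f. x \<in> M \<and> f \<in> Ind}"
proof -
  have eq: "act (u x) f \<ominus>\<^bsub>V\<^esub> \<Psi> x \<odot>\<^bsub>V\<^esub> f = (\<lambda>g\<in>G. f (g * u x) - \<Psi> x * f g)"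
    if "x \<in> M" "f \<in> Ind" for x f
    unfolding V_simps(4) V_minus[OF Ind_act[OF that(2) u_G[OF that(1)]] Ind_smult[OF that(2)]]
    by (auto simp: act_apply)
  show ?thesis
  proof (intro equalityI subsetI)
    fix h assume "h \<in> gens"
    then obtain x f where "x \<in> M" "f \<in> Ind" "h = act (u x) f \<ominus>\<^bsub>V\<^esub> \<Psi> x \<odot>\<^bsub>V\<^esub> f"
      unfolding gens_def by blast
    then show "h \<in> {\<lambda>g\<in>G. f (g * u x) - \<Psi> x * f g | x f. x \<in> M \<and> f \<in> Ind}"
      using eq[of x f] by (intro CollectI exI[of _ x] exI[of _ f]) simp
  next
    fix h assume "h \<in> {\<lambda>g\<in>G. f (g * u x) - \<Psi> x * f g | x f. x \<in> M \<and> f \<in> Ind}"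
    then obtain x f where "x \<in> M" "f \<in> Ind" "h = (\<lambda>g\<in>G. f (g * u x) - \<Psi> x * f g)"
      by blast
    then show "h \<in> gens"
      unfolding gens_def using eq[of x f] by (intro CollectI exI[of _ x] exI[of _ f]) simp
  qed
qed

lemma gens_Ind: "gens \<subseteq> carrier V"
proof
  fix h assume "h \<in> gens"
  then obtain x f where h: "x \<in> M" "f \<in> Ind" "h = act (u x) f \<ominus>\<^bsub>V\<^esub> \<Psi> x \<odot>\<^bsub>V\<^esub> f"
    unfolding gens_def by blast
  have "act (u x) f \<in> carrier V" "f \<in> carrier V" using h Ind_act[OF h(2) u_G[OF h(1)]] by (simp_all add: V_simps)
  then show "h \<in> carrier V" unfolding h(3) by (intro V.M.minus_closed V.smult_closed) auto
qed

lemma W_submodule: "submodule complex_ring W V"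
  unfolding W_def by (rule V.span_is_submodule[OF gens_Ind])

lemma W_Ind: "f \<in> W \<Longrightarrow> f \<in> Ind"
  using submodule.subset[OF W_submodule] by (auto simp: V_simps)

lemma W_zero: "(\<lambda>g\<in>G. 0) \<in> W"
  using submodule.zero_closed[OF W_submodule] by (simp add: V_simps)

lemma W_add: "f \<in> W \<Longrightarrow> h \<in> W \<Longrightarrow> (\<lambda>g\<in>G. f g + h g) \<in> W"
  using submodule.m_closed[OF W_submodule, of f h] by (simp add: V_simps)

lemma W_smult: "f \<in> W \<Longrightarrow> (\<lambda>g\<in>G. c * f g) \<in> W"
  using submodule.smult_closed[OF W_submodule, of c f] by (simp add: V_simps)

lemma W_gen: "x \<in> M \<Longrightarrow> f \<in> Ind \<Longrightarrow> (\<lambda>g\<in>G. f (g * u x) - \<Psi> x * f g) \<in> W"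
  using V.in_own_span[OF gens_Ind] unfolding W_def gens_eq by blast

lemma W_least:
  assumes "\<And>x f. x \<in> M \<Longrightarrow> f \<in> Ind \<Longrightarrow> (\<lambda>g\<in>G. f (g * u x) - \<Psi> x * f g) \<in> S"
    and "submodule complex_ring S V"
  shows "W \<subseteq> S"
  unfolding W_def by (rule V.span_is_subset[OF _ assms(2)]) (use assms(1) in \<open>auto simp: gens_eq\<close>)

lemma W_sum:
  assumes "finite D" "\<And>d. d \<in> D \<Longrightarrow> F d \<in> W"
  shows "(\<lambda>g\<in>G. \<Sum>d\<in>D. c d * F d g) \<in> W"
  using assms
proof (induction D rule: finite_induct)
  case empty
  show ?case unfolding sum.empty by (rule W_zero)
next
  case (insert d D)
  have 1: "(\<lambda>g\<in>G. c d * F d g) \<in> W" by (rule W_smult) (use insert.prems in blast)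
  have 2: "(\<lambda>g\<in>G. \<Sum>d\<in>D. c d * F d g) \<in> W" by (rule insert.IH) (use insert.prems in blast)
  from 1 2 have "(\<lambda>g\<in>G. (\<lambda>g\<in>G. c d * F d g) g + (\<lambda>g\<in>G. \<Sum>d\<in>D. c d * F d g) g) \<in> W" by (rule W_add)
  moreover have "(\<lambda>g\<in>G. (\<lambda>g\<in>G. c d * F d g) g + (\<lambda>g\<in>G. \<Sum>d\<in>D. c d * F d g) g) = (\<lambda>g\<in>G. \<Sum>d\<in>insert d D. c d * F d g)"
    using insert.hyps by (intro restrict_ext) simp
  ultimately show ?case by (simp only:)
qed

lemma Ind_sum:
  assumes "finite D" "\<And>d. d \<in> D \<Longrightarrow> F d \<in> Ind"
  shows "(\<lambda>g\<in>G. \<Sum>d\<in>D. c d * F d g) \<in> Ind"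
  using assms
proof (induction D rule: finite_induct)
  case empty
  show ?case unfolding sum.empty by (rule Ind_zero)
next
  case (insert d D)
  have 1: "(\<lambda>g\<in>G. c d * F d g) \<in> Ind" by (rule Ind_smult) (use insert.prems in blast)
  have 2: "(\<lambda>g\<in>G. \<Sum>d\<in>D. c d * F d g) \<in> Ind" by (rule insert.IH) (use insert.prems in blast)
  from 1 2 have "(\<lambda>g\<in>G. (\<lambda>g\<in>G. c d * F d g) g + (\<lambda>g\<in>G. \<Sum>d\<in>D. c d * F d g) g) \<in> Ind" by (rule Ind_add)
  moreover have "(\<lambda>g\<in>G. (\<lambda>g\<in>G. c d * F d g) g + (\<lambda>g\<in>G. \<Sum>d\<in>D. c d * F d g) g) = (\<lambda>g\<in>G. \<Sum>d\<in>insert d D. c d * F d g)"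
    using insert.hyps by (intro restrict_ext) simp
  ultimately show ?case by (simp only:)
qed

definition avg :: "'a mat set \<Rightarrow> ('a mat \<Rightarrow> complex) \<Rightarrow> 'a mat \<Rightarrow> complex" where
  "avg D f = (\<lambda>g\<in>G. \<Sum>d\<in>D. \<Psi> (- d) * f (g * u d))"

lemma avg_Ind:
  assumes D: "finite D" "D \<subseteq> M" and f: "f \<in> Ind"
  shows "avg D f \<in> Ind"
proof -
  have "(\<lambda>g\<in>G. \<Sum>d\<in>D. \<Psi> (- d) * act (u d) f g) \<in> Ind"
    using D u_G by (intro Ind_sum Ind_act[OF f]) auto
  moreover have "(\<lambda>g\<in>G. \<Sum>d\<in>D. \<Psi> (- d) * act (u d) f g) = avg D f"
    by (auto simp: avg_def act_apply)
  ultimately show ?thesis by simp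
qed

lemma avg_equiv:
  assumes D: "finite D" "D \<subseteq> M" "D \<noteq> {}" and f: "f \<in> Ind"
  shows "(\<lambda>g\<in>G. f g - avg D f g / of_nat (card D)) \<in> W"
proof -
  let ?c = "\<lambda>d. - \<Psi> (- d) / of_nat (card D)"
  have "(\<lambda>g\<in>G. \<Sum>d\<in>D. ?c d * (\<lambda>g\<in>G. f (g * u d) - \<Psi> d * f g) g) \<in> W"
    using D by (intro W_sum W_gen f) auto
  moreover have "(\<Sum>d\<in>D. ?c d * (\<lambda>g\<in>G. f (g * u d) - \<Psi> d * f g) g) = f g - avg D f g / of_nat (card D)"
    if g: "g \<in> G" for g
  proof -
    have "?c d * (f (g * u d) - \<Psi> d * f g) = f g / of_nat (card D) - \<Psi> (- d) * f (g * u d) / of_nat (card D)"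
      if "d \<in> D" for d
    proof -
      have "\<Psi> (- d) * (\<Psi> d * f g) = f g" using \<Psi>_inverse[of d] D(2) that by (simp flip: mult.assoc) auto
      then show ?thesis by (simp add: right_diff_distrib diff_divide_distrib)
    qed
    then have "(\<Sum>d\<in>D. ?c d * (\<lambda>g\<in>G. f (g * u d) - \<Psi> d * f g) g) =
        (\<Sum>d\<in>D. f g / of_nat (card D) - \<Psi> (- d) * f (g * u d) / of_nat (card D))"
      using g by (intro sum.cong) auto
    also have "\<dots> = f g - avg D f g / of_nat (card D)"
      using g D(1,3) by (simp add: sum_subtractf avg_def sum_divide_distrib)
    finally show ?thesis .
  qed
  then have "(\<lambda>g\<in>G. \<Sum>d\<in>D. ?c d * (\<lambda>g\<in>G. f (g * u d) - \<Psi> d * f g) g) = (\<lambda>g\<in>G. f g - avg D f g / of_nat (card D))"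
    by (rule restrict_ext)
  ultimately show ?thesis by simp
qed

subsection \<open>Degenerate points\<close>

definition degenerate :: "'a mat \<Rightarrow> bool" where
  "degenerate g \<longleftrightarrow> (\<exists>x\<in>box n (absv t). \<Psi> x = \<psi> t \<and>
     (\<forall>f\<in>Ind. \<forall>y\<in>M. f (g * u (x + y)) = f (g * u y)))"

lemma avg_degenerate:
  assumes g: "g \<in> G" "degenerate g" and D: "transversal n (absv t) \<rho> D" and \<rho>: "0 \<le> \<rho>"
    and f: "f \<in> Ind" "\<And>g k. g \<in> G \<Longrightarrow> k \<in> near_one N \<rho> \<Longrightarrow> f (g * k) = f g"
    and \<Psi>1: "\<And>x. x \<in> box n \<rho> \<Longrightarrow> \<Psi> x = 1"
  shows "avg D f g = 0"
proof -
  obtain x where x: "x \<in> box n (absv t)" "\<Psi> x = \<psi> t" "\<And>y. y \<in> M \<Longrightarrow> f (g * u (x + y)) = f (g * u y)"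
    using g(2) f(1) unfolding degenerate_def by blast
  have xM: "x \<in> M" by (rule box_carrier[OF x(1)])
  define F where "F d = \<Psi> (- d) * f (g * u d)" for d
  have per: "F (d + y) = F d" if d: "d \<in> box n (absv t)" and y: "y \<in> box n \<rho>" for d y
  proof -
    have dM: "d \<in> M" "y \<in> M" using box_carrier d y by auto
    have "- (d + y) = - d + - y" using dM by (intro eq_matI) auto
    then have "\<Psi> (- (d + y)) = \<Psi> (- d)" using dM \<Psi>1[OF box_uminus[OF y]] by (simp add: \<Psi>_add)
    moreover have "f (g * u (d + y)) = f (g * u d)"
    proof -
      have "g * u (d + y) = g * u d * u y" using g(1) u_G[OF dM(1)] u_G[OF dM(2)] by (simp add: G_assoc u_add dM)
      then show ?thesis using f(2)[of "g * u d" "u y"] u_near[OF y \<rho>] g(1) u_G[OF dM(1)] by simp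
    qed
    ultimately show ?thesis by (simp add: F_def)
  qed
  have "F (x + d) = \<Psi> (- x) * F d" if d: "d \<in> D" for d
  proof -
    have dM: "d \<in> M" using box_carrier transversalD(2)[OF D d] by blast
    have "- (x + d) = - x + - d" using dM xM by (intro eq_matI) auto
    then show ?thesis using x(3)[OF dM] xM dM by (simp add: F_def \<Psi>_add)
  qed
  then have "(\<Sum>d\<in>D. F (x + d)) = \<Psi> (- x) * (\<Sum>d\<in>D. F d)" by (simp add: sum_distrib_left)
  moreover have "(\<Sum>d\<in>D. F (x + d)) = (\<Sum>d\<in>D. F d)"
    by (rule transversal_translate[OF D \<rho> per x(1)])
  moreover have "\<Psi> (- x) \<noteq> 1" using \<Psi>_inverse[OF xM] x(2) \<psi>_t by auto
  ultimately have "(\<Sum>d\<in>D. F d) = 0" by simp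
  then show ?thesis using g(1) by (simp add: avg_def F_def)
qed

text \<open>Conjugating \<open>u (c b\<^sup>T)\<close> by \<open>g\<close> gives the transvection with column \<open>g (c, 0)\<close> and row
  \<open>(0, b) g\<inverse>\<close>; if this lies in the parabolic, then \<open>\<sigma>\<close> is trivial on it.\<close>

lemma degenerateI:
  assumes g: "g \<in> G" and c: "c \<in> carrier_vec n" and b: "b \<in> carrier_vec n"
    and box: "outer c b \<in> box n (absv t)" and cb: "c \<bullet> b = t"
    and inP: "(\<forall>i<s. (g *\<^sub>v (c @\<^sub>v 0\<^sub>v n)) $ (i + r) = 0) \<or> (\<forall>j<r. ((GLinv N g)\<^sup>T *\<^sub>v (0\<^sub>v n @\<^sub>v b)) $ j = 0)"
  shows "degenerate g"
proof -
  let ?c = "c @\<^sub>v 0\<^sub>v n" and ?b = "0\<^sub>v n @\<^sub>v b" and ?h = "GLinv N g"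
  have cv: "?c \<in> carrier_vec N" "?b \<in> carrier_vec N" unfolding rs using c b by auto
  have gc: "g \<in> carrier_mat N N" "?h \<in> carrier_mat N N" "?h * g = 1\<^sub>m N" using g by auto
  let ?C = "g *\<^sub>v ?c" and ?B = "?h\<^sup>T *\<^sub>v ?b"
  have CB: "?C \<in> carrier_vec N" "?B \<in> carrier_vec N" using gc cv by auto
  have hgc: "?h *\<^sub>v ?C = ?c" using gc cv by (simp flip: assoc_mult_mat_vec[of _ N N _ N])
  have "?B \<bullet> ?C = ?b \<bullet> (?h *\<^sub>v ?C)" by (rule transpose_vec_mult_scalar[OF gc(2) CB(1) cv(2)])
  also have "\<dots> = 0" unfolding hgc using c b by (subst scalar_prod_append[of _ n _ n]) auto
  finally have BC: "?B \<bullet> ?C = 0" .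
  let ?p = "transvection N ?C ?B"
  have p: "?p \<in> parabolic r s" "\<sigma> ?p = 1"
    using \<sigma>_transvection[OF CB BC] inP by auto
  have oM: "outer c b \<in> M" using outer_carrier[OF c b] .
  have ut: "u (outer c b) = transvection N ?c ?b"
    unfolding u_def transvection_def rs using c b by (intro eq_matI) (auto simp: outer_def)
  have "g\<^sup>T *\<^sub>v ?B = (g\<^sup>T * ?h\<^sup>T) *\<^sub>v ?b"
    using gc cv by (intro assoc_mult_mat_vec[symmetric, of _ N N _ N]) auto
  also have "g\<^sup>T * ?h\<^sup>T = (?h * g)\<^sup>T" using gc by (intro transpose_mult[symmetric]) auto
  finally have gB: "g\<^sup>T *\<^sub>v ?B = ?b" using gc cv by simp
  have gu: "g * u (outer c b) = ?p * g"
    unfolding ut transvection_left[OF gc(1) cv] transvection_right[OF gc(1) CB] gB ..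
  have "f (g * u (outer c b + y)) = f (g * u y)" if f: "f \<in> Ind" and y: "y \<in> M" for f y
  proof -
    have uG: "u y \<in> G" "u (outer c b) \<in> G" using u_G y oM by auto
    have "g * u (outer c b + y) = g * u (outer c b) * u y"
      using g uG by (simp add: G_assoc u_add[OF oM y])
    also have "\<dots> = ?p * (g * u y)" unfolding gu using g uG parabolic_GL[OF p(1)] by (simp add: G_assoc)
    finally show ?thesis using Ind_equivariant[OF f p(1), of "g * u y"] g uG p(2) by simp
  qed
  moreover have "\<Psi> (outer c b) = \<psi> t" unfolding \<Psi>_def matrix_trace_outer[OF c b] cb ..
  ultimately show ?thesis unfolding degenerate_def using box by blast
qed

lemma mult_append_zero:
  assumes g: "g \<in> carrier_mat N N" and c: "c \<in> carrier_vec n" and i: "i < N"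
  shows "(g *\<^sub>v (c @\<^sub>v 0\<^sub>v n)) $ i = (\<Sum>j = 0..<n. g $$ (i,j) * c $ j)"
proof -
  have "(g *\<^sub>v (c @\<^sub>v 0\<^sub>v n)) $ i = (\<Sum>j = 0..<n + n. g $$ (i,j) * (c @\<^sub>v 0\<^sub>v n) $ j)"
    using g c i by (auto simp: scalar_prod_def rs)
  also have "\<dots> = (\<Sum>j = 0..<n. g $$ (i,j) * c $ j)"
    using c by (intro sum.mono_neutral_cong_right) auto
  finally show ?thesis .
qed

lemma mult_zero_append:
  assumes g: "g \<in> carrier_mat N N" and y: "y \<in> carrier_vec s" and i: "i < N"
  shows "(g *\<^sub>v (0\<^sub>v r @\<^sub>v y)) $ i = (\<Sum>j = 0..<s. g $$ (i,j + r) * y $ j)"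
proof -
  have "(g *\<^sub>v (0\<^sub>v r @\<^sub>v y)) $ i = (\<Sum>j = 0..<r + s. g $$ (i,j) * (0\<^sub>v r @\<^sub>v y) $ j)"
    using g y i by (auto simp: scalar_prod_def)
  also have "\<dots> = (\<Sum>j = r..<r + s. g $$ (i,j) * y $ (j - r))"
    using y by (intro sum.mono_neutral_cong_right) auto
  also have "\<dots> = (\<Sum>j = 0..<s. g $$ (i,j + r) * y $ j)"
    using sum.shift_bounds_nat_ivl[of "\<lambda>j. g $$ (i,j) * y $ (j - r)" 0 r s] by (simp add: add.commute)
  finally show ?thesis .
qed

abbreviation "lower_left g \<equiv> mat n n (\<lambda>(i,j). g $$ (i + r,j))"

lemma degenerate_points:
  assumes g: "g \<in> G" and bad: "r \<noteq> n \<or> det (lower_left g) = 0"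
  shows "degenerate g"
proof -
  have gc: "g \<in> carrier_mat N N" using g by simp
  show ?thesis
  proof (cases "s \<le> n")
    case True
    let ?A = "mat n n (\<lambda>(i,j). if i < s then g $$ (i + r,j) else 0)"
    have "det ?A = 0"
    proof (cases "s < n")
      case True
      then show ?thesis by (intro zero_row_kernel[of _ n s]) auto
    next
      case False
      then have sn: "s = n" using \<open>s \<le> n\<close> by simp
      then have "?A = lower_left g" by (intro eq_matI) auto
      then show ?thesis using bad rs sn by simp
    qed
    then have "\<exists>c. c \<in> carrier_vec n \<and> c \<noteq> 0\<^sub>v n \<and> ?A *\<^sub>v c = 0\<^sub>v n"
      by (intro iffD1[OF det_0_iff_vec_prod_zero[of ?A n]]) simp_all
    then obtain c where c: "c \<in> carrier_vec n" "c \<noteq> 0\<^sub>v n" "?A *\<^sub>v c = 0\<^sub>v n" by blast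
    obtain b where b: "b \<in> carrier_vec n" "c \<bullet> b = t" "outer c b \<in> box n (absv t)"
      using bounded_outer[OF c(1,2), of t] by blast
    have "(g *\<^sub>v (c @\<^sub>v 0\<^sub>v n)) $ (i + r) = 0" if i: "i < s" for i
    proof -
      have "(g *\<^sub>v (c @\<^sub>v 0\<^sub>v n)) $ (i + r) = (\<Sum>j = 0..<n. g $$ (i + r,j) * c $ j)"
        using i by (intro mult_append_zero[OF gc c(1)]) simp
      also have "\<dots> = (?A *\<^sub>v c) $ i" using i True c(1) by (simp add: scalar_prod_def)
      finally show ?thesis unfolding c(3) using i True by simp
    qed
    then show ?thesis by (intro degenerateI[OF g c(1) b(1,3,2)]) blast
  next
    case False
    let ?A = "mat s s (\<lambda>(i,j). if i < n then g $$ (j + r,i) else 0)"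
    have "det ?A = 0" using False by (intro zero_row_kernel[of _ s n]) auto
    then have "\<exists>c. c \<in> carrier_vec s \<and> c \<noteq> 0\<^sub>v s \<and> ?A *\<^sub>v c = 0\<^sub>v s"
      by (intro iffD1[OF det_0_iff_vec_prod_zero[of ?A s]]) simp_all
    then obtain y where y: "y \<in> carrier_vec s" "y \<noteq> 0\<^sub>v s" "?A *\<^sub>v y = 0\<^sub>v s" by blast
    let ?y = "0\<^sub>v r @\<^sub>v y"
    have yv: "?y \<in> carrier_vec N" using y by auto
    have hT: "(GLinv N g)\<^sup>T *\<^sub>v (g\<^sup>T *\<^sub>v ?y) = ?y"
    proof -
      have hc: "GLinv N g \<in> carrier_mat N N" using g by simp
      have "(GLinv N g)\<^sup>T *\<^sub>v (g\<^sup>T *\<^sub>v ?y) = ((GLinv N g)\<^sup>T * g\<^sup>T) *\<^sub>v ?y"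
        using gc hc yv by (intro assoc_mult_mat_vec[symmetric, of _ N N _ N]) auto
      also have "(GLinv N g)\<^sup>T * g\<^sup>T = (g * GLinv N g)\<^sup>T" using gc hc by (intro transpose_mult[symmetric]) auto
      finally show ?thesis using g yv by simp
    qed
    define b where "b = vec n (\<lambda>j. (g\<^sup>T *\<^sub>v ?y) $ (j + n))"
    have bv: "b \<in> carrier_vec n" by (simp add: b_def)
    have "(g\<^sup>T *\<^sub>v ?y) $ j = 0" if j: "j < n" for j
    proof -
      have "(g\<^sup>T *\<^sub>v ?y) $ j = (\<Sum>i = 0..<s. g\<^sup>T $$ (j,i + r) * y $ i)"
        using gc j rs by (intro mult_zero_append[OF _ y(1)]) auto
      also have "\<dots> = (?A *\<^sub>v y) $ j" using j False y(1) gc rs by (auto simp: scalar_prod_def intro!: sum.cong)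
      finally show ?thesis unfolding y(3) using j False by simp
    qed
    then have gy: "g\<^sup>T *\<^sub>v ?y = 0\<^sub>v n @\<^sub>v b"
      using gc rs by (intro eq_vecI) (auto simp: b_def)
    have "b \<noteq> 0\<^sub>v n"
    proof
      assume "b = 0\<^sub>v n"
      then have "g\<^sup>T *\<^sub>v ?y = 0\<^sub>v N" unfolding gy rs by (intro eq_vecI) auto
      then have y0: "?y = (GLinv N g)\<^sup>T *\<^sub>v 0\<^sub>v N" using hT by simp
      have "(GLinv N g)\<^sup>T *\<^sub>v 0\<^sub>v N = 0\<^sub>v N"
        using GL_inv(4)[OF g] by (intro eq_vecI) (auto simp: scalar_prod_def)
      with y0 have "?y = 0\<^sub>v N" by simp
      then have "?y $ (i + r) = 0" if "i < s" for i using that by simp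
      then have "y $ i = 0" if "i < s" for i using that y(1) by fastforce
      then have "y = 0\<^sub>v s" using y(1) by (intro eq_vecI) auto
      with y(2) show False by blast
    qed
    then obtain c where c: "c \<in> carrier_vec n" "c \<bullet> b = t" "outer c b \<in> box n (absv t)"
      using bounded_outer[OF bv, of t] by metis
    have "((GLinv N g)\<^sup>T *\<^sub>v (0\<^sub>v n @\<^sub>v b)) $ j = 0" if "j < r" for j
      unfolding gy[symmetric] hT using that y(1) by simp
    then show ?thesis by (intro degenerateI[OF g c(1) bv c(3,2)]) blast
  qed
qed

text \<open>With a large lattice and a small sublattice, averaging makes any function in the induced space
  vanish at all degenerate points, without changing its class.\<close>

lemma average_exists:
  assumes f: "f \<in> Ind"
  obtains f' where "f' \<in> Ind" "(\<lambda>g\<in>G. f g - f' g) \<in> W" "\<And>g. g \<in> G \<Longrightarrow> degenerate g \<Longrightarrow> f' g = 0"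
proof -
  obtain e where e: "0 < e" "e < 1" "\<And>g k. g \<in> G \<Longrightarrow> k \<in> near_one N e \<Longrightarrow> f (g * k) = f g"
    using Ind_smooth[OF f] by blast
  obtain d where d: "0 < d" "\<And>x. x \<in> box n d \<Longrightarrow> \<Psi> x = 1" using \<Psi>_smooth by blast
  define \<rho> where "\<rho> = min d e"
  have \<rho>: "0 < \<rho>" "\<rho> \<le> d" "\<rho> \<le> e" using d e by (auto simp: \<rho>_def)
  obtain D :: "'a mat set" where D: "transversal n (absv t) \<rho> D" using transversal_exists[OF \<rho>(1)] by blast
  have D': "finite D" "D \<subseteq> M" "D \<noteq> {}"
    using transversalD(1,2)[OF D] transversal_nonempty[OF D] box_carrier by auto
  let ?f = "\<lambda>g\<in>G. (1 / of_nat (card D)) * avg D f g"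
  show thesis
  proof
    show "?f \<in> Ind" by (rule Ind_smult[OF avg_Ind[OF D'(1,2) f]])
    have "(\<lambda>g\<in>G. f g - ?f g) = (\<lambda>g\<in>G. f g - avg D f g / of_nat (card D))" by auto
    then show "(\<lambda>g\<in>G. f g - ?f g) \<in> W" using avg_equiv[OF D' f] by simp
    fix g assume g: "g \<in> G" "degenerate g"
    have "avg D f g = 0"
      using d(2) box_mono[OF _ \<rho>(2)] e(3) near_one_mono[OF _ \<rho>(3)]
      by (intro avg_degenerate[OF g D less_imp_le[OF \<rho>(1)] f]) blast+
    then show "?f g = 0" using g by simp
  qed
qed

lemma Ind_eq_W:
  assumes "r \<noteq> n" shows "Ind = W"
proof (intro equalityI subsetI)
  fix f assume f: "f \<in> Ind"
  obtain f' where f': "f' \<in> Ind" "(\<lambda>g\<in>G. f g - f' g) \<in> W" "\<And>g. g \<in> G \<Longrightarrow> degenerate g \<Longrightarrow> f' g = 0"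
    using average_exists[OF f] by blast
  have "f' g = 0" if "g \<in> G" for g using f'(3)[OF that] degenerate_points[OF that] assms by blast
  then have "(\<lambda>g\<in>G. f g - f' g) = f" using Ind_ext[OF f] by (auto simp: extensional_def)
  then show "f \<in> W" using f'(2) by simp
qed (rule W_Ind)

end

section \<open>Positive characters of the general linear group\<close>

context
  fixes n :: nat and \<theta> :: "'a::nonarch_local_field mat \<Rightarrow> real"
  assumes \<theta>_mult: "\<And>g h. g \<in> carrier (GL n) \<Longrightarrow> h \<in> carrier (GL n) \<Longrightarrow> \<theta> (g * h) = \<theta> g * \<theta> h"
    and \<theta>_pos: "\<And>g. g \<in> carrier (GL n) \<Longrightarrow> 0 < \<theta> g"
    and \<theta>_scalar: "\<And>z. z \<noteq> 0 \<Longrightarrow> \<theta> (z \<cdot>\<^sub>m 1\<^sub>m n) = 1"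
begin

lemma \<theta>_transvection:
  assumes c: "c \<in> carrier_vec n" and w: "w \<in> carrier_vec n" and wc: "w \<bullet> c = 0"
  shows "\<theta> (transvection n c w) = 1"
proof (cases "c = 0\<^sub>v n")
  case True
  then have "transvection n c w = 1 \<cdot>\<^sub>m 1\<^sub>m n" using w by (auto simp: transvection_def outer_def intro!: eq_matI)
  then show ?thesis using \<theta>_scalar[of 1] by simp
next
  case False
  obtain l :: 'a where l: "l \<noteq> 0" "l \<noteq> 1" using unit_ne_1_exists by blast
  obtain v where v: "v \<in> carrier_vec n" "v \<bullet> c = 1" using dual_vec_exists[OF c False] by blast
  let ?t = "transvection n ((l - 1) \<cdot>\<^sub>v c) v"
  have tG: "?t \<in> carrier (GL n)" by (rule dilation_GL[OF c v l(1)])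
  have "?t *\<^sub>v c = c + (v \<bullet> c) \<cdot>\<^sub>v ((l - 1) \<cdot>\<^sub>v c)"
    using c v by (intro transvection_apply) auto
  then have tc: "?t *\<^sub>v c = l \<cdot>\<^sub>v c"
    using c unfolding v(2) by (auto simp: algebra_simps intro!: eq_vecI)
  have "?t\<^sup>T *\<^sub>v w = w + (((l - 1) \<cdot>\<^sub>v c) \<bullet> w) \<cdot>\<^sub>v v"
    using c v w by (subst transvection_transpose[of _ n], simp, simp, intro transvection_apply) auto
  then have tw: "?t\<^sup>T *\<^sub>v w = w"
    using c v w wc comm_scalar_prod[OF c w] by (auto intro!: eq_vecI)
  have "complex_of_real (\<theta> (transvection n c w)) = 1"
  proof (rule hom_transvection_dilation[where H = "carrier (GL n)" and t = ?t and l = l and \<sigma> = "\<lambda>g. complex_of_real (\<theta> g)"])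
    fix p q :: "'a mat" assume "p \<in> carrier (GL n)" "q \<in> carrier (GL n)"
    then show "complex_of_real (\<theta> (p * q)) = complex_of_real (\<theta> p) * complex_of_real (\<theta> q)"
      by (simp add: \<theta>_mult)
  next
    fix p :: "'a mat" assume "p \<in> carrier (GL n)"
    then show "complex_of_real (\<theta> p) \<noteq> 0" using \<theta>_pos[of p] by simp
  next
    fix a show "transvection n (a \<cdot>\<^sub>v c) w \<in> carrier (GL n)"
      using c w wc by (intro transvection_GL) auto
  qed (use c w wc tG l tc tw in auto)
  then show ?thesis by simp
qed

text \<open>Two dilations with the same factor are conjugate by transvections.\<close>

lemma \<theta>_dilation_eq:
  assumes c: "c \<in> carrier_vec n" "c' \<in> carrier_vec n" and w: "w \<in> carrier_vec n" "w' \<in> carrier_vec n" and z: "z \<noteq> 0"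
  shows "w \<bullet> c = 1 \<Longrightarrow> w \<bullet> c' = 1 \<Longrightarrow> \<theta> (transvection n ((z - 1) \<cdot>\<^sub>v c) w) = \<theta> (transvection n ((z - 1) \<cdot>\<^sub>v c') w)"
    and "w \<bullet> c = 1 \<Longrightarrow> w' \<bullet> c = 1 \<Longrightarrow> \<theta> (transvection n ((z - 1) \<cdot>\<^sub>v c) w) = \<theta> (transvection n ((z - 1) \<cdot>\<^sub>v c) w')"
proof -
  assume 1: "w \<bullet> c = 1" "w \<bullet> c' = 1"
  let ?S = "transvection n (c' - c) w"
  let ?A = "transvection n ((z - 1) \<cdot>\<^sub>v c) w" and ?B = "transvection n ((z - 1) \<cdot>\<^sub>v c') w"
  have cc: "c' - c \<in> carrier_vec n" using c by simp
  have w0: "w \<bullet> (c' - c) = 0" using 1 c w by (simp add: scalar_prod_minus_distrib)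
  have S: "?S \<in> carrier (GL n)" "?S \<in> carrier_mat n n" using transvection_GL[OF cc w(1) w0] by auto
  have "?S *\<^sub>v ((z - 1) \<cdot>\<^sub>v c) = (z - 1) \<cdot>\<^sub>v c + (w \<bullet> ((z - 1) \<cdot>\<^sub>v c)) \<cdot>\<^sub>v (c' - c)"
    using c w cc by (intro transvection_apply) auto
  also have "\<dots> = (z - 1) \<cdot>\<^sub>v c'" using c w 1 by (intro eq_vecI) (auto simp: algebra_simps)
  finally have Sc: "?S *\<^sub>v ((z - 1) \<cdot>\<^sub>v c) = (z - 1) \<cdot>\<^sub>v c'" .
  have "?S\<^sup>T *\<^sub>v w = w + ((c' - c) \<bullet> w) \<cdot>\<^sub>v w"
    using w cc by (subst transvection_transpose[of _ n], simp, simp, intro transvection_apply) auto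
  also have "\<dots> = w" using w comm_scalar_prod[OF cc w(1)] w0 by (intro eq_vecI) auto
  finally have Sw: "?S\<^sup>T *\<^sub>v w = w" .
  have "?S * ?A = ?B * ?S"
    using c w S(2) by (subst transvection_left, simp_all add: Sc, subst transvection_right) (simp_all add: Sw)
  moreover have "?A \<in> carrier (GL n)" "?B \<in> carrier (GL n)" using dilation_GL c w 1 z by auto
  ultimately have "\<theta> ?S * \<theta> ?A = \<theta> ?B * \<theta> ?S" using \<theta>_mult S(1) by metis
  then show "\<theta> ?A = \<theta> ?B" using \<theta>_pos[OF S(1)] by simp
next
  assume 1: "w \<bullet> c = 1" "w' \<bullet> c = 1"
  let ?S = "transvection n c (w' - w)"
  let ?A = "transvection n ((z - 1) \<cdot>\<^sub>v c) w" and ?B = "transvection n ((z - 1) \<cdot>\<^sub>v c) w'"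
  have ww: "w' - w \<in> carrier_vec n" using w by simp
  have w0: "(w' - w) \<bullet> c = 0" using 1 c w by (simp add: minus_scalar_prod_distrib)
  have S: "?S \<in> carrier (GL n)" "?S \<in> carrier_mat n n" using transvection_GL[OF c(1) ww w0] by auto
  have "?S *\<^sub>v ((z - 1) \<cdot>\<^sub>v c) = (z - 1) \<cdot>\<^sub>v c + ((w' - w) \<bullet> ((z - 1) \<cdot>\<^sub>v c)) \<cdot>\<^sub>v c"
    using c w ww by (intro transvection_apply) auto
  also have "\<dots> = (z - 1) \<cdot>\<^sub>v c" using c ww w0 by (intro eq_vecI) auto
  finally have Sc: "?S *\<^sub>v ((z - 1) \<cdot>\<^sub>v c) = (z - 1) \<cdot>\<^sub>v c" .
  have "?S\<^sup>T *\<^sub>v w = w + (c \<bullet> w) \<cdot>\<^sub>v (w' - w)"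
    using c w ww by (subst transvection_transpose[of _ n], simp, simp, intro transvection_apply) auto
  also have "\<dots> = w'" using w comm_scalar_prod[OF c(1) w(1)] 1 by (intro eq_vecI) auto
  finally have Sw: "?S\<^sup>T *\<^sub>v w = w'" .
  have "?S * ?B = ?A * ?S"
    using c w S(2) by (subst transvection_left, simp_all add: Sc, subst transvection_right) (simp_all add: Sw)
  moreover have "?A \<in> carrier (GL n)" "?B \<in> carrier (GL n)" using dilation_GL c w 1 z by auto
  ultimately have "\<theta> ?S * \<theta> ?B = \<theta> ?A * \<theta> ?S" using \<theta>_mult S(1) by metis
  then show "\<theta> ?A = \<theta> ?B" using \<theta>_pos[OF S(1)] by simp
qed

abbreviation "dil k z \<equiv> transvection n ((z - 1) \<cdot>\<^sub>v unit_vec n k) (unit_vec n k)"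

lemma dil_GL: "k < n \<Longrightarrow> z \<noteq> 0 \<Longrightarrow> dil k z \<in> carrier (GL n)"
  by (rule dilation_GL) auto

lemma \<theta>_dil_indep:
  assumes k: "k < n" "l < n" and z: "z \<noteq> 0"
  shows "\<theta> (dil k z) = \<theta> (dil l z)"
proof (cases "k = l")
  case False
  let ?k = "unit_vec n k :: 'a vec" and ?l = "unit_vec n l :: 'a vec"
  have v: "?k \<in> carrier_vec n" "?l \<in> carrier_vec n" "?k + ?l \<in> carrier_vec n" by auto
  have s: "?k \<bullet> ?k = 1" "?l \<bullet> ?l = 1" "?k \<bullet> ?l = 0" "?l \<bullet> ?k = 0" using k False by auto
  have s': "(?k + ?l) \<bullet> ?k = 1" "(?k + ?l) \<bullet> ?l = 1"
    using s v by (simp_all add: add_scalar_prod_distrib[of _ n])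
  have "\<theta> (dil k z) = \<theta> (transvection n ((z - 1) \<cdot>\<^sub>v ?k) (?k + ?l))"
    by (rule \<theta>_dilation_eq(2)[OF v(1,1,1,3) z s(1) s'(1)])
  also have "\<dots> = \<theta> (transvection n ((z - 1) \<cdot>\<^sub>v ?l) (?k + ?l))"
    by (rule \<theta>_dilation_eq(1)[OF v(1,2,3,3) z s'])
  also have "\<dots> = \<theta> (dil l z)"
    by (rule \<theta>_dilation_eq(2)[OF v(2,2,3,2) z s'(2) s(2)])
  finally show ?thesis .
qed simp

text \<open>The product of the \<open>n\<close> conjugate dilations with factor \<open>z\<close> is the scalar matrix \<open>z\<close>, and the
  only positive \<open>n\<close>-th root of 1 is 1.\<close>

lemma \<theta>_dil:
  assumes k: "k < n" and z: "z \<noteq> 0"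
  shows "\<theta> (dil k z) = 1"
proof -
  let ?E = "\<lambda>m. mat n n (\<lambda>(i,j). if i = j then (if i < m then z else 1) else 0)"
  have "?E m \<in> carrier (GL n) \<and> \<theta> (?E m) = \<theta> (dil k z) ^ m" if "m \<le> n" for m
    using that
  proof (induction m)
    case 0
    have E0: "?E 0 = 1\<^sub>m n" by (intro eq_matI) auto
    have "1 \<cdot>\<^sub>m 1\<^sub>m n = (1\<^sub>m n :: 'a mat)" by (intro eq_matI) auto
    then have "\<theta> (1\<^sub>m n) = 1" using \<theta>_scalar[of 1] by simp
    then show ?case unfolding E0 by simp
  next
    case (Suc m)
    then have m: "m < n" and IH: "?E m \<in> carrier (GL n)" "\<theta> (?E m) = \<theta> (dil k z) ^ m" by auto
    have "?E m * dil m z = ?E m + outer (?E m *\<^sub>v ((z - 1) \<cdot>\<^sub>v unit_vec n m)) (unit_vec n m)"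
      by (rule transvection_left) auto
    also have "?E m *\<^sub>v ((z - 1) \<cdot>\<^sub>v unit_vec n m) = (z - 1) \<cdot>\<^sub>v unit_vec n m"
    proof (rule eq_vecI)
      fix i assume "i < dim_vec ((z - 1) \<cdot>\<^sub>v unit_vec n m :: 'a vec)"
      then have i: "i < n" by simp
      have "(?E m *\<^sub>v ((z - 1) \<cdot>\<^sub>v unit_vec n m)) $ i = (z - 1) * (row (?E m) i \<bullet> unit_vec n m)"
        using i by simp
      also have "row (?E m) i \<bullet> unit_vec n m = ?E m $$ (i, m)"
        unfolding scalar_prod_right_unit[OF m] using i m by simp
      finally show "(?E m *\<^sub>v ((z - 1) \<cdot>\<^sub>v unit_vec n m)) $ i = ((z - 1) \<cdot>\<^sub>v unit_vec n m) $ i"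
        using i m by simp
    qed simp
    also have "?E m + outer ((z - 1) \<cdot>\<^sub>v unit_vec n m) (unit_vec n m) = ?E (Suc m)"
      using m by (intro eq_matI) (auto simp: outer_def)
    finally have E: "?E (Suc m) = ?E m * dil m z" ..
    have "\<theta> (?E m * dil m z) = \<theta> (dil k z) ^ Suc m"
      using \<theta>_mult[OF IH(1) dil_GL[OF m z]] IH(2) \<theta>_dil_indep[OF m k z] by simp
    then show ?case unfolding E using GL_mult_closed[OF IH(1) dil_GL[OF m z]] by simp
  qed
  then have "\<theta> (?E n) = \<theta> (dil k z) ^ n" by simp
  moreover have "?E n = z \<cdot>\<^sub>m 1\<^sub>m n" by (intro eq_matI) auto
  ultimately have "\<theta> (dil k z) ^ n = 1" using \<theta>_scalar[OF z] by simp
  then have "\<theta> (dil k z) ^ n = 1 ^ n" by simp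
  then show ?thesis
    using \<theta>_pos[OF dil_GL[OF k z]] k by (intro power_eq_imp_eq_base[of _ n 1]) auto
qed

lemma transvection_fixes:
  assumes "c \<in> carrier_vec n" "w \<in> carrier_vec n" "v \<in> carrier_vec n" "w \<bullet> v = 0"
  shows "transvection n c w *\<^sub>v v = v"
  using assms by (subst transvection_apply) (auto intro!: eq_vecI)

text \<open>Column by column, multiplication by transvections and dilations from the left turns an
  invertible matrix into the identity.\<close>

lemma \<theta>_trivial:
  assumes a: "a \<in> carrier (GL n)"
  shows "\<theta> a = 1"
proof -
  have "\<theta> a = 1" if "m \<le> n" "a \<in> carrier (GL n)" "\<forall>j<m. col a j = unit_vec n j" for m a
    using that
  proof (induction m arbitrary: a rule: inc_induct)
    case base
    then have ac: "a \<in> carrier_mat n n" by simp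
    have "a = 1 \<cdot>\<^sub>m 1\<^sub>m n"
    proof (rule eq_matI)
      fix i j assume "i < dim_row (1 \<cdot>\<^sub>m 1\<^sub>m n :: 'a mat)" "j < dim_col (1 \<cdot>\<^sub>m 1\<^sub>m n :: 'a mat)"
      then have ij: "i < n" "j < n" by auto
      have "a $$ (i,j) = col a j $ i" using ac ij by simp
      then show "a $$ (i,j) = (1 \<cdot>\<^sub>m 1\<^sub>m n) $$ (i,j)" using base ij by simp
    qed (use ac in auto)
    then show ?case using \<theta>_scalar[of 1] by simp
  next
    case (step m)
    have m: "m < n" using step by simp
    let ?e = "\<lambda>i. unit_vec n i :: 'a vec"
    have ee: "?e i \<bullet> ?e j = (if i = j then 1 else 0)" if "i < n" "j < n" for i j using that by auto
    have red: "\<theta> b = 1" if b: "b \<in> carrier (GL n)" "\<forall>j<m. col b j = ?e j" "col b m $ m \<noteq> 0" for b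
    proof -
      have bc: "b \<in> carrier_mat n n" using b by simp
      let ?z = "1 / (col b m $ m)"
      let ?d = "dil m ?z"
      have z: "?z \<noteq> 0" using b(3) by (metis divide_eq_0_iff one_neq_zero)
      have d: "?d \<in> carrier (GL n)" "\<theta> ?d = 1" by (rule dil_GL[OF m z], rule \<theta>_dil[OF m z])
      let ?b = "?d * b"
      have b2: "?b \<in> carrier (GL n)" using d b by simp
      have colb: "col ?b j = ?d *\<^sub>v col b j" if "j < n" for j
        using col_mult2[of ?d n n b n j] d(1) bc that by simp
      have cb: "col b m \<in> carrier_vec n" using bc m by simp
      have c1: "col ?b j = ?e j" if "j < m" for j
      proof -
        have "?d *\<^sub>v ?e j = ?e j" using that m ee[of m j] by (intro transvection_fixes) auto
        then show ?thesis using colb[of j] b(2) that m by simp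
      qed
      obtain v where v_def: "v = col ?b m" by blast
      have v: "v \<in> carrier_vec n" unfolding v_def using GL_carrier_mat[OF b2] m by auto
      have "v = col b m + (?e m \<bullet> col b m) \<cdot>\<^sub>v ((?z - 1) \<cdot>\<^sub>v ?e m)"
        unfolding v_def colb[OF m] using cb by (intro transvection_apply) auto
      then have vm: "v $ m = 1" using m cb b(3) by (simp add: scalar_prod_left_unit[OF cb m] field_simps)
      let ?T = "transvection n (?e m - v) (?e m)"
      have Tc: "?e m - v \<in> carrier_vec n" using v by simp
      have T0: "?e m \<bullet> (?e m - v) = 0"
        using m v vm by (simp add: scalar_prod_left_unit[OF Tc m])
      have T: "?T \<in> carrier (GL n)" "\<theta> ?T = 1"
        using transvection_GL[OF Tc _ T0] \<theta>_transvection[OF Tc _ T0] by auto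
      have colT: "col (?T * ?b) j = ?T *\<^sub>v col ?b j" if "j < n" for j
        using col_mult2[of ?T n n ?b n j] T(1) b2 that by simp
      have "\<theta> (?T * ?b) = 1"
      proof (rule step.IH)
        show "?T * ?b \<in> carrier (GL n)" using T b2 by simp
        show "\<forall>j<Suc m. col (?T * ?b) j = ?e j"
        proof (intro allI impI)
          fix j assume "j < Suc m"
          then consider "j < m" | "j = m" by linarith
          then show "col (?T * ?b) j = ?e j"
          proof cases
            case 1
            have "?T *\<^sub>v ?e j = ?e j" using 1 m ee[of m j] Tc by (intro transvection_fixes) auto
            then show ?thesis using colT[of j] c1[OF 1] 1 m by simp
          next
            case 2
            have "?T *\<^sub>v v = v + (?e m \<bullet> v) \<cdot>\<^sub>v (?e m - v)"
              using Tc v by (intro transvection_apply) auto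
            also have "\<dots> = ?e m" unfolding scalar_prod_left_unit[OF v m] vm using v by (intro eq_vecI) auto
            finally show ?thesis unfolding 2 colT[OF m] by (simp only: v_def)
          qed
        qed
      qed
      then show ?thesis using \<theta>_mult[OF T(1) b2] \<theta>_mult[OF d(1) b(1)] T(2) d(2) by simp
    qed
    show ?case
    proof (cases "col a m $ m = 0")
      case False
      then show ?thesis using red step.prems by blast
    next
      case True
      have ac: "a \<in> carrier_mat n n" using step.prems by simp
      have "\<exists>i<n. m < i \<and> col a m $ i \<noteq> 0"
      proof (rule ccontr)
        assume "\<not> ?thesis"
        then have z: "a $$ (i, m) = 0" if "i < n" "m \<le> i" for i
          using True that ac m by (cases "i = m") auto
        let ?x = "vec n (\<lambda>j. if j = m then 1 else if j < m then - a $$ (j,m) else 0)"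
        have "a *\<^sub>v ?x = 0\<^sub>v n"
        proof (rule eq_vecI)
          fix i assume "i < dim_vec (0\<^sub>v n :: 'a vec)"
          then have i: "i < n" by simp
          have aij: "a $$ (i,j) = (if i = j then 1 else 0)" if "j < m" for j
          proof -
            have "a $$ (i,j) = col a j $ i" using ac i that m by simp
            then show ?thesis using step.prems that i m by simp
          qed
          have "(a *\<^sub>v ?x) $ i = (\<Sum>j = 0..<n. a $$ (i,j) * ?x $ j)"
            using ac i by (simp add: scalar_prod_def)
          also have "\<dots> = (\<Sum>j = 0..<n. (if j = m then a $$ (i,m) else 0) + (if j = i then (if i < m then - a $$ (i,m) else 0) else 0))"
            using aij by (intro sum.cong) auto
          also have "\<dots> = 0" using i m z[of i] by (auto simp: sum.distrib)
          finally show "(a *\<^sub>v ?x) $ i = 0\<^sub>v n $ i" using i by simp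
        qed (use ac in simp)
        moreover have "?x \<noteq> 0\<^sub>v n"
        proof
          assume "?x = 0\<^sub>v n"
          then have "?x $ m = 0\<^sub>v n $ m" by simp
          then show False using m by simp
        qed
        ultimately have "\<exists>v. v \<in> carrier_vec n \<and> v \<noteq> 0\<^sub>v n \<and> a *\<^sub>v v = 0\<^sub>v n"
          by (intro exI[of _ ?x]) simp
        then have "det a = 0" by (rule iffD2[OF det_0_iff_vec_prod_zero[OF ac]])
        then show False using GL_det step.prems by blast
      qed
      then obtain i where i: "i < n" "m < i" "col a m $ i \<noteq> 0" by blast
      let ?S = "transvection n (?e m) (?e i)"
      have S0: "?e i \<bullet> ?e m = 0" using ee[of i m] i m by simp
      have S: "?S \<in> carrier (GL n)" "\<theta> ?S = 1"
        using transvection_GL[OF _ _ S0] \<theta>_transvection[OF _ _ S0] by auto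
      have cola: "col (?S * a) j = ?S *\<^sub>v col a j" if "j < n" for j
        using col_mult2[of ?S n n a n j] S(1) ac that by simp
      have ca: "col a m \<in> carrier_vec n" using ac m by simp
      have "\<theta> (?S * a) = 1"
      proof (rule red)
        show "?S * a \<in> carrier (GL n)" using S step.prems by simp
        show "\<forall>j<m. col (?S * a) j = ?e j"
        proof (intro allI impI)
          fix j assume j: "j < m"
          have "?S *\<^sub>v ?e j = ?e j" using ee[of i j] i j m by (intro transvection_fixes) auto
          then show "col (?S * a) j = ?e j" using cola[of j] step.prems j m by simp
        qed
        have "?S *\<^sub>v col a m = col a m + (?e i \<bullet> col a m) \<cdot>\<^sub>v ?e m"
          using ca by (intro transvection_apply) auto
        then show "col (?S * a) m $ m \<noteq> 0"
          using cola[OF m] True i m ca ac by (simp add: scalar_prod_left_unit[OF ca i(1)])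
      qed
      then show ?thesis using \<theta>_mult[OF S(1), of a] S(2) step.prems by simp
    qed
  qed
  from this[of 0 a] show ?thesis using a by simp
qed

end

section \<open>The open cell\<close>

lemma blocksE:
  assumes "g \<in> carrier_mat (n + n) (n + n)"
  obtains a b c d where "g = four_block_mat a b c d" "a \<in> carrier_mat n n" "b \<in> carrier_mat n n"
    "c \<in> carrier_mat n n" "d \<in> carrier_mat n n"
proof -
  obtain a b c d where sb: "split_block g n n = (a, b, c, d)" by (metis prod_cases4)
  show thesis using split_block[OF sb, of n n] assms that[of a b c d] by auto
qed

lemma four_block_mult:
  assumes "a \<in> carrier_mat n n" "b \<in> carrier_mat n n" "c \<in> carrier_mat n n" "d \<in> carrier_mat n n"
    "a' \<in> carrier_mat n n" "b' \<in> carrier_mat n n" "c' \<in> carrier_mat n n" "d' \<in> carrier_mat n n"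
  shows "four_block_mat a b c d * four_block_mat a' b' c' d' =
    four_block_mat (a * a' + b * c') (a * b' + b * d') (c * a' + d * c') (c * b' + d * (d' :: 'a::field mat))"
  by (rule mult_four_block_mat[OF assms(1-4) assms(5-8)])

lemma mat_telescope:
  fixes A :: "'a::ab_group_add mat"
  assumes "A \<in> carrier_mat m k" "B \<in> carrier_mat m k" "C \<in> carrier_mat m k"
  shows "(A - B) + (B - C) = A - C"
  using assms by (intro eq_matI) auto

locale balanced_character = twisted_character +
  assumes rn: "r = n"
begin

lemma sn: "s = n"
  using rs rn by simp

definition LL :: "'a mat \<Rightarrow> 'a mat" where
  "LL g = mat n n (\<lambda>(i,j). g $$ (i + n,j))"

definition LR :: "'a mat \<Rightarrow> 'a mat" where
  "LR g = mat n n (\<lambda>(i,j). g $$ (i + n,j + n))"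

lemma LL_carrier [simp]: "LL g \<in> M" and LR_carrier [simp]: "LR g \<in> M"
  by (simp_all add: LL_def LR_def)

lemma LL_four: "a \<in> M \<Longrightarrow> b \<in> M \<Longrightarrow> c \<in> M \<Longrightarrow> d \<in> M \<Longrightarrow> LL (four_block_mat a b c d) = c"
  unfolding LL_def by (intro eq_matI) auto

lemma LR_four: "a \<in> M \<Longrightarrow> b \<in> M \<Longrightarrow> c \<in> M \<Longrightarrow> d \<in> M \<Longrightarrow> LR (four_block_mat a b c d) = d"
  unfolding LR_def by (intro eq_matI) auto

lemma G_blocks:
  assumes "g \<in> G"
  obtains a b c d where "g = four_block_mat a b c d" "a \<in> M" "b \<in> M" "c \<in> M" "d \<in> M"
proof -
  have "g \<in> carrier_mat (n + n) (n + n)" using GL_carrier_mat[OF assms] unfolding rs .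
  then show thesis using that by (rule blocksE)
qed

lemma G_right_one: "g \<in> G \<Longrightarrow> g * 1\<^sub>m N = g"
  by (rule right_mult_one_mat[OF GL_carrier_mat])

lemma P_blocks:
  assumes "p \<in> parabolic r s"
  obtains a x d where "p = four_block_mat a x (0\<^sub>m n n) d" "a \<in> carrier (GL n)" "x \<in> M" "d \<in> carrier (GL n)"
  using assms unfolding rn sn by (rule parabolicE)

definition w :: "'a mat \<Rightarrow> 'a mat" where
  "w x = four_block_mat (0\<^sub>m n n) (1\<^sub>m n) (1\<^sub>m n) x"

definition w' :: "'a mat \<Rightarrow> 'a mat" where
  "w' x = four_block_mat (- x) (1\<^sub>m n) (1\<^sub>m n) (0\<^sub>m n n)"

lemma w_carrier: "x \<in> M \<Longrightarrow> w x \<in> carrier_mat N N" "x \<in> M \<Longrightarrow> w' x \<in> carrier_mat N N"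
  unfolding w_def w'_def rs by (auto intro!: four_block_carrier_mat)

lemma w_w': "x \<in> M \<Longrightarrow> y \<in> M \<Longrightarrow> w x * w' y = four_block_mat (1\<^sub>m n) (0\<^sub>m n n) (x - y) (1\<^sub>m n)"
  unfolding w_def w'_def
  by (subst four_block_mult[of _ n], simp_all, rule cong_four_block_mat) (auto intro!: eq_matI)

lemma w_w'_one: "x \<in> M \<Longrightarrow> w x * w' x = 1\<^sub>m N"
proof -
  assume x: "x \<in> M"
  have "x - x = 0\<^sub>m n n" using x by (intro eq_matI) auto
  then show ?thesis using w_w'[OF x x] by (simp add: rs)
qed

lemma w_G: "x \<in> M \<Longrightarrow> w x \<in> G" "x \<in> M \<Longrightarrow> w' x \<in> G" "x \<in> M \<Longrightarrow> w' x * w x = 1\<^sub>m N"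
  using GL_intro[OF w_carrier w_w'_one, of x] mat_mult_left_right_inverse[OF w_carrier w_w'_one, of x] by auto

lemma w_u: "x \<in> M \<Longrightarrow> y \<in> M \<Longrightarrow> w x * u y = w (x + y)"
  unfolding w_def u_def
  by (subst four_block_mult[of _ n], simp_all, rule cong_four_block_mat) (auto intro!: eq_matI)

lemma LL_w: "x \<in> M \<Longrightarrow> LL (w x) = 1\<^sub>m n" and LR_w: "x \<in> M \<Longrightarrow> LR (w x) = x"
  unfolding w_def by (simp_all add: LL_four LR_four)

definition cell :: "'a mat \<Rightarrow> bool" where
  "cell g \<longleftrightarrow> det (LL g) \<noteq> 0"

definition coord :: "'a mat \<Rightarrow> 'a mat" where
  "coord g = GLinv n (LL g) * LR g"

definition pcomp :: "'a mat \<Rightarrow> 'a mat" where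
  "pcomp g = g * w' (coord g)"

lemma cell_GL: "cell g \<Longrightarrow> LL g \<in> carrier (GL n)"
  unfolding cell_def by (intro GL_memI) auto

lemma coord_M: "cell g \<Longrightarrow> coord g \<in> M"
  unfolding coord_def using cell_GL[of g] by (intro mult_carrier_mat[of _ n n]) auto

lemma not_cell_degenerate: "g \<in> G \<Longrightarrow> \<not> cell g \<Longrightarrow> degenerate g"
  using degenerate_points[of g] unfolding cell_def LL_def rn by simp

lemma pcomp_P:
  assumes g: "g \<in> G" "cell g"
  shows "pcomp g \<in> parabolic r s" "pcomp g * w (coord g) = g"
proof -
  note x = coord_M[OF g(2)]
  obtain a b c d where bl: "g = four_block_mat a b c d" "a \<in> M" "b \<in> M" "c \<in> M" "d \<in> M"
    by (rule G_blocks[OF g(1)])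
  have c: "c \<in> carrier (GL n)" using cell_GL[OF g(2)] bl by (simp add: LL_four)
  have cx: "c * coord g = d"
  proof -
    have "c * (GLinv n c * d) = (c * GLinv n c) * d"
      using c bl by (intro assoc_mult_mat[symmetric, of _ n n _ n _ n]) auto
    then show ?thesis using c bl by (simp add: coord_def LL_four LR_four)
  qed
  have pG: "pcomp g \<in> G" unfolding pcomp_def using g(1) w_G(2)[OF x] by simp
  have "pcomp g = four_block_mat (a * - coord g + b * 1\<^sub>m n) (a * 1\<^sub>m n + b * 0\<^sub>m n n)
      (c * - coord g + d * 1\<^sub>m n) (c * 1\<^sub>m n + d * 0\<^sub>m n n)"
    unfolding pcomp_def w'_def bl(1) using bl x by (intro four_block_mult) (auto simp: bl(1)[symmetric])
  moreover have "c * - coord g + d * 1\<^sub>m n = 0\<^sub>m n n"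
    using bl x cx by (intro eq_matI) auto
  ultimately have pf: "pcomp g = four_block_mat (a * - coord g + b * 1\<^sub>m n) (a * 1\<^sub>m n + b * 0\<^sub>m n n)
      (0\<^sub>m n n) (c * 1\<^sub>m n + d * 0\<^sub>m n n)" by simp
  show "pcomp g \<in> parabolic r s"
  proof (rule parabolic_memI[OF pG])
    fix i j assume "i < s" "j < r"
    then show "pcomp g $$ (i + r, j) = 0" unfolding pf rn sn using bl x by auto
  qed
  show "pcomp g * w (coord g) = g"
    unfolding pcomp_def using g(1) w_G[OF x] by (simp add: G_assoc G_right_one)
qed

lemma cell_mult_P:
  assumes p: "p \<in> parabolic r s" and g: "g \<in> G"
  shows "cell (p * g) \<longleftrightarrow> cell g" "cell g \<Longrightarrow> coord (p * g) = coord g" "cell g \<Longrightarrow> pcomp (p * g) = p * pcomp g"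
proof -
  obtain a x d where pb: "p = four_block_mat a x (0\<^sub>m n n) d" "a \<in> carrier (GL n)" "x \<in> M" "d \<in> carrier (GL n)"
    by (rule P_blocks[OF p])
  obtain a' b' c' d' where bl: "g = four_block_mat a' b' c' d'" "a' \<in> M" "b' \<in> M" "c' \<in> M" "d' \<in> M"
    by (rule G_blocks[OF g])
  have ad: "a \<in> M" "d \<in> M" using pb by auto
  have "p * g = four_block_mat (a * a' + x * c') (a * b' + x * d') (0\<^sub>m n n * a' + d * c') (0\<^sub>m n n * b' + d * d')"
    unfolding pb(1) bl(1) using ad pb bl by (intro four_block_mult) (auto simp: bl(1)[symmetric])
  moreover have "0\<^sub>m n n * a' + d * c' = d * c'" "0\<^sub>m n n * b' + d * d' = d * d'"
    using ad bl left_mult_zero_mat[OF bl(2), of n] left_mult_zero_mat[OF bl(3), of n] by auto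
  ultimately have pg: "p * g = four_block_mat (a * a' + x * c') (a * b' + x * d') (d * c') (d * d')" by simp
  have cc: "a * a' + x * c' \<in> M" "a * b' + x * d' \<in> M" "d * c' \<in> M" "d * d' \<in> M"
    by (intro add_carrier_mat mult_carrier_mat[OF ad(1)] mult_carrier_mat[OF pb(3)] mult_carrier_mat[OF ad(2)] bl)+
  have LLpg: "LL (p * g) = d * c'" "LR (p * g) = d * d'" unfolding pg by (rule LL_four[OF cc], rule LR_four[OF cc])
  have LLg: "LL g = c'" "LR g = d'" using bl by (simp_all add: LL_four LR_four)
  show cl: "cell (p * g) \<longleftrightarrow> cell g"
    unfolding cell_def LLpg LLg using det_mult[OF ad(2) bl(4)] GL_det[OF pb(4)] by simp
  assume c: "cell g"
  then have c': "c' \<in> carrier (GL n)" using cell_GL[OF c] LLg by simp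
  have "GLinv n (d * c') = GLinv n c' * GLinv n d"
    using group.inv_mult_group[OF GL_group pb(4) c'] by simp
  then have "coord (p * g) = GLinv n c' * GLinv n d * (d * d')" unfolding coord_def LLpg by simp
  also have "\<dots> = GLinv n c' * ((GLinv n d * d) * d')"
    unfolding assoc_mult_mat[OF GL_inv(4)[OF c'] GL_inv(4)[OF pb(4)] cc(4)]
      assoc_mult_mat[OF GL_inv(4)[OF pb(4)] ad(2) bl(5)] ..
  also have "\<dots> = coord g" unfolding coord_def LLg using pb bl by simp
  finally show co: "coord (p * g) = coord g" .
  show "pcomp (p * g) = p * pcomp g"
    unfolding pcomp_def co using parabolic_GL[OF p] g w_G(2)[OF coord_M[OF c]] by (simp add: G_assoc)
qed

lemma cell_w:
  assumes x: "x \<in> M"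
  shows "cell (w x)" "coord (w x) = x" "pcomp (w x) = 1\<^sub>m N"
proof -
  show "cell (w x)" unfolding cell_def LL_w[OF x] by simp
  have "GLinv n (1\<^sub>m n) = (1\<^sub>m n :: 'a mat)" by (intro GL_intro(3)) auto
  then show co: "coord (w x) = x" unfolding coord_def LL_w[OF x] LR_w[OF x] using x by simp
  show "pcomp (w x) = 1\<^sub>m N" unfolding pcomp_def co using w_w'_one[OF x] .
qed

lemma cell_P_w:
  assumes p: "p \<in> parabolic r s" and x: "x \<in> M"
  shows "cell (p * w x)" "coord (p * w x) = x" "pcomp (p * w x) = p"
  using cell_mult_P[OF p w_G(1)[OF x]] cell_w[OF x] right_mult_one_mat[OF GL_carrier_mat[OF parabolic_GL[OF p]]] by auto

lemma cell_u:
  assumes g: "g \<in> G" "cell g" and y: "y \<in> M"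
  shows "cell (g * u y)" "coord (g * u y) = coord g + y" "pcomp (g * u y) = pcomp g"
proof -
  have "g * u y = pcomp g * (w (coord g) * u y)"
    using pcomp_P[OF g] parabolic_GL[OF pcomp_P(1)[OF g]] w_G(1)[OF coord_M[OF g(2)]] u_G[OF y] by (simp flip: G_assoc)
  then have eq: "g * u y = pcomp g * w (coord g + y)" using w_u[OF coord_M[OF g(2)] y] by simp
  have "coord g + y \<in> M" using coord_M[OF g(2)] y by simp
  from cell_P_w[OF pcomp_P(1)[OF g] this] show "cell (g * u y)" "coord (g * u y) = coord g + y" "pcomp (g * u y) = pcomp g"
    unfolding eq .
qed

lemma not_cell_u:
  assumes g: "g \<in> G" "\<not> cell g" and y: "y \<in> M" shows "\<not> cell (g * u y)"
proof
  assume c: "cell (g * u y)"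
  have y': "- y \<in> M" using y by simp
  have "y + - y = 0\<^sub>m n n" using y by (intro eq_matI) auto
  then have "g * u y * u (- y) = g"
    using g(1) u_G[OF y] u_G[OF y'] u_add[OF y y'] by (simp add: G_assoc G_right_one u_zero)
  moreover have "cell (g * u y * u (- y))" using cell_u(1)[OF _ c y'] g(1) u_G[OF y] by simp
  ultimately show False using g(2) by simp
qed

subsection \<open>Bump functions\<close>

definition bump :: "real \<Rightarrow> 'a mat \<Rightarrow> complex" where
  "bump \<rho> = (\<lambda>g\<in>G. if cell g \<and> coord g \<in> box n \<rho> then \<sigma> (pcomp g) else 0)"

lemma bump_apply: "g \<in> G \<Longrightarrow> bump \<rho> g = (if cell g \<and> coord g \<in> box n \<rho> then \<sigma> (pcomp g) else 0)"
  by (simp add: bump_def)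

lemma bump_w: "x \<in> M \<Longrightarrow> bump \<rho> (w x) = (if x \<in> box n \<rho> then 1 else 0)"
  using cell_w[of x] w_G(1)[of x] by (simp add: bump_apply \<sigma>_one)

lemma mbound_w: "x \<in> box n 1 \<Longrightarrow> mbound (w x) 1" "x \<in> box n 1 \<Longrightarrow> mbound (w' x) 1"
proof -
  assume x: "x \<in> box n 1"
  have xM: "x \<in> M" by (rule box_carrier[OF x])
  have b: "absv (x $$ (i,j)) \<le> 1" if "i < n" "j < n" for i j
    using x that mboundD[of x 1 n n i j] by (auto simp: box_def)
  show "mbound (w x) 1" "mbound (w' x) 1"
    unfolding mbound_def w_def w'_def using xM b by auto
qed

lemma four_block_near_one:
  fixes k :: "'a mat"
  assumes "k \<in> near_one N e" "0 \<le> e"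
  obtains k1 k2 k3 k4 where "k = four_block_mat k1 k2 k3 k4" "k1 \<in> near_one n e" "k4 \<in> near_one n e"
    "k2 \<in> box n e" "k3 \<in> box n e"
proof -
  have kc: "k \<in> carrier_mat (n + n) (n + n)" using assms unfolding near_one_def rs by blast
  obtain k1 k2 k3 k4 where k: "k = four_block_mat k1 k2 k3 k4" "k1 \<in> M" "k2 \<in> M" "k3 \<in> M" "k4 \<in> M"
    by (rule blocksE[OF kc])
  have b: "absv ((k - 1\<^sub>m (n + n)) $$ (i, j)) \<le> e" if "i < n + n" "j < n + n" for i j
    using assms(1) that kc unfolding near_one_def rs by (intro mboundD[of _ e "n + n" "n + n"]) auto
  have "absv ((k1 - 1\<^sub>m n) $$ (i, j)) \<le> e" if "i < n" "j < n" for i j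
    using b[of i j] that k by (auto split: if_splits)
  then have 1: "k1 \<in> near_one n e" using k by (auto simp: near_one_def mbound_def)
  have "absv ((k4 - 1\<^sub>m n) $$ (i, j)) \<le> e" if "i < n" "j < n" for i j
    using b[of "i + n" "j + n"] that k by (auto split: if_splits)
  then have 4: "k4 \<in> near_one n e" using k by (auto simp: near_one_def mbound_def)
  have "absv (k2 $$ (i, j)) \<le> e" if "i < n" "j < n" for i j
    using b[of i "j + n"] that k by (auto split: if_splits)
  then have 2: "k2 \<in> box n e" using k by (auto simp: box_def mbound_def)
  have "absv (k3 $$ (i, j)) \<le> e" if "i < n" "j < n" for i j
    using b[of "i + n" j] that k by (auto split: if_splits)
  then have 3: "k3 \<in> box n e" using k by (auto simp: box_def mbound_def)
  show thesis using that[OF k(1) 1 4 2 3] .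
qed

text \<open>Right multiplication by matrices close to 1 moves the coordinate \<open>x\<close> of \<open>w x\<close> and its
  component in the parabolic only a little, uniformly for integral \<open>x\<close>.\<close>

lemma w_perturb:
  assumes x: "x \<in> box n 1" and k: "k \<in> near_one N e" and e: "0 < e" "e < 1"
  shows "cell (w x * k)" "coord (w x * k) - x \<in> box n e" "pcomp (w x * k) \<in> near_one N e"
proof -
  have e0: "0 \<le> e" and e1: "e \<le> 1" using e by auto
  have xM: "x \<in> M" by (rule box_carrier[OF x])
  have xb: "mbound x 1" using x by (simp add: box_def)
  obtain k1 k2 k3 k4 where kb: "k = four_block_mat k1 k2 k3 k4" "k1 \<in> near_one n e" "k4 \<in> near_one n e"
    "k2 \<in> box n e" "k3 \<in> box n e" by (rule four_block_near_one[OF k e0])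
  have kM: "k1 \<in> M" "k2 \<in> M" "k3 \<in> M" "k4 \<in> M" using kb by (auto simp: near_one_def box_def)
  have xk3: "x * k3 \<in> box n e" using xM kM kb xb e0 by (auto simp: box_def intro!: mbound_mult1)
  have wk: "w x * k = four_block_mat (0\<^sub>m n n * k1 + 1\<^sub>m n * k3) (0\<^sub>m n n * k2 + 1\<^sub>m n * k4) (1\<^sub>m n * k1 + x * k3) (1\<^sub>m n * k2 + x * k4)"
    unfolding w_def kb(1) using xM kM by (intro four_block_mult) (auto simp: kb(1)[symmetric])
  let ?L = "k1 + x * k3" and ?R = "k2 + x * k4"
  have LM: "?L \<in> M" "?R \<in> M" using xM kM by auto
  have LL: "LL (w x * k) = ?L" "LR (w x * k) = ?R" unfolding wk using xM kM by (simp_all add: LL_four LR_four)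
  have Ln: "?L \<in> near_one n e"
  proof -
    have "mbound ((k1 - 1\<^sub>m n) + x * k3) e"
      using kb xk3 xM kM by (intro mbound_add[of _ _ _ n n]) (auto simp: near_one_def box_def)
    moreover have "(k1 - 1\<^sub>m n) + x * k3 = ?L - 1\<^sub>m n" using xM kM by (intro eq_matI) auto
    ultimately show ?thesis using LM by (simp add: near_one_def)
  qed
  have LG: "?L \<in> carrier (GL n)" by (rule near_one_GL[OF Ln e0 e(2)])
  show cell: "cell (w x * k)" unfolding cell_def LL by (rule GL_det[OF LG])
  let ?I = "GLinv n ?L"
  have IM: "?I \<in> M" and Ib: "mbound ?I 1"
    using LG near_one_bound[OF near_one_inv[OF Ln e0 e(2)] e1] by auto
  have diff: "mbound ((k2 + x * (k4 - 1\<^sub>m n)) - (?L - 1\<^sub>m n) * x) e"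
  proof -
    have k41: "mbound (k4 - 1\<^sub>m n) e" "k4 - 1\<^sub>m n \<in> M" using kb(3) by (auto simp: near_one_def)
    have L1: "mbound (?L - 1\<^sub>m n) e" "?L - 1\<^sub>m n \<in> M" using Ln by (auto simp: near_one_def)
    have "mbound (x * (k4 - 1\<^sub>m n)) e" by (rule mbound_mult1[OF xb k41(1) e0 xM k41(2)])
    moreover have "mbound ((?L - 1\<^sub>m n) * x) e" by (rule mbound_mult2[OF L1(1) xb e0 L1(2) xM])
    moreover have "x * (k4 - 1\<^sub>m n) \<in> M" "(?L - 1\<^sub>m n) * x \<in> M"
      by (rule mult_carrier_mat[OF xM k41(2)], rule mult_carrier_mat[OF L1(2) xM])
    ultimately show ?thesis using kb kM by (intro mbound_diff[of _ _ _ n n] mbound_add[of _ _ _ n n]) (auto simp: box_def)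
  qed
  have "(k2 + x * (k4 - 1\<^sub>m n)) - (?L - 1\<^sub>m n) * x = ?R - ?L * x"
  proof -
    have "x * (k4 - 1\<^sub>m n) = x * k4 - x" using xM kM by (simp add: mult_minus_distrib_mat[of _ n n _ n])
    moreover have "(?L - 1\<^sub>m n) * x = ?L * x - x" using xM LM by (simp add: minus_mult_distrib_mat[of _ n n _ _ n])
    moreover have "?L * x \<in> M" "x * k4 \<in> M" using LM xM kM by auto
    ultimately show ?thesis using xM kM by (intro eq_matI) auto
  qed
  with diff have RLx: "mbound (?R - ?L * x) e" by simp
  have Lx: "?L * x \<in> M" using LM xM by auto
  have "?I * (?R - ?L * x) = coord (w x * k) - x"
  proof -
    have "?I * (?L * x) = (?I * ?L) * x" using IM LM xM by (intro assoc_mult_mat[symmetric, of _ n n _ n _ n]) auto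
    also have "\<dots> = x" using LG xM by simp
    finally show ?thesis unfolding mult_minus_distrib_mat[OF IM LM(2) Lx] coord_def LL by simp
  qed
  moreover have "mbound (?I * (?R - ?L * x)) e"
    by (rule mbound_mult1[OF Ib RLx e0 IM]) (rule minus_carrier_mat[OF Lx])
  ultimately have "mbound (coord (w x * k) - x) e" by simp
  then show cx: "coord (w x * k) - x \<in> box n e" using minus_carrier_mat[OF xM] by (simp add: box_def)
  let ?x = "coord (w x * k)"
  have x'M: "?x \<in> M" by (rule coord_M[OF cell])
  have x'1: "?x \<in> box n 1"
  proof -
    have "(?x - x) + x \<in> box n 1" using box_mono[OF cx e1] x by (rule box_add)
    moreover have "(?x - x) + x = ?x" using x'M xM by (intro eq_matI) auto
    ultimately show ?thesis by simp
  qed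
  have "mbound (w x * k * w' ?x - w x * w' ?x) (1 * e * 1)"
    by (rule mult_near_one_bound[OF w_carrier(1)[OF xM] mbound_w(1)[OF x] _ w_carrier(2)[OF x'M] mbound_w(2)[OF x'1] _ k e0]) auto
  then have 1: "mbound (pcomp (w x * k) - w x * w' ?x) e" unfolding pcomp_def by simp
  have 2: "mbound (w x * w' ?x - 1\<^sub>m N) e"
  proof -
    have "x - ?x \<in> box n e"
    proof -
      have "- (?x - x) = x - ?x" using x'M xM by (intro eq_matI) auto
      then show ?thesis using box_uminus[OF cx] by simp
    qed
    then have b: "absv ((x - ?x) $$ (i,j)) \<le> e" if "i < n" "j < n" for i j
      using that mboundD[of "x - ?x" e n n i j] unfolding box_def by blast
    have "absv ((w x * w' ?x - 1\<^sub>m N) $$ (i, j)) \<le> e" if ij: "i < n + n" "j < n + n" for i j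
      unfolding w_w'[OF xM x'M] rs using ij b[of "i - n" j] xM x'M e0 by auto
    then show ?thesis unfolding mbound_def using w_w'[OF xM x'M] xM x'M by (simp add: rs)
  qed
  have c: "pcomp (w x * k) \<in> carrier_mat N N" "w x * w' ?x \<in> carrier_mat N N"
    using k w_carrier[OF xM] w_carrier[OF x'M] unfolding pcomp_def near_one_def by auto
  have "mbound ((pcomp (w x * k) - w x * w' ?x) + (w x * w' ?x - 1\<^sub>m N)) e"
    using c by (intro mbound_add[OF 1 2, of N N] minus_carrier_mat) auto
  moreover have "(pcomp (w x * k) - w x * w' ?x) + (w x * w' ?x - 1\<^sub>m N) = pcomp (w x * k) - 1\<^sub>m N"
    by (rule mat_telescope[OF c one_carrier_mat])
  ultimately show "pcomp (w x * k) \<in> near_one N e" using c by (simp add: near_one_def)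
qed

lemma bump_Ind:
  assumes \<rho>: "0 < \<rho>" "\<rho> \<le> 1" shows "bump \<rho> \<in> Ind"
proof -
  obtain e0 where e0: "0 < e0" "e0 < 1" "\<And>k. k \<in> near_one N e0 \<Longrightarrow> k \<in> parabolic r s \<Longrightarrow> \<sigma> k = 1"
    using \<sigma>_smooth by auto
  define e where "e = min e0 \<rho>"
  have e: "0 < e" "e < 1" "e \<le> e0" "e \<le> \<rho>" using e0 \<rho> by (auto simp: e_def)
  have key: "cell (g * k) \<and> coord (g * k) \<in> box n \<rho> \<and> \<sigma> (pcomp (g * k)) = \<sigma> (pcomp g)"
    if g: "g \<in> G" "cell g" "coord g \<in> box n \<rho>" and k: "k \<in> near_one N e" for g k
  proof -
    let ?x = "coord g"
    have kG: "k \<in> G" using near_one_GL[OF k] e by simp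
    have xM: "?x \<in> M" by (rule coord_M[OF g(2)])
    have x1: "?x \<in> box n 1" by (rule box_mono[OF g(3) \<rho>(2)])
    note wp = w_perturb[OF x1 k e(1,2)]
    note p = pcomp_P[OF g(1,2)]
    have pG: "pcomp g \<in> G" by (rule parabolic_GL[OF p(1)])
    have wG: "w ?x * k \<in> G" using w_G(1)[OF xM] kG by simp
    have "g * k = pcomp g * (w ?x * k)"
      using p(2) pG w_G(1)[OF xM] kG by (simp flip: G_assoc)
    then have eqs: "cell (g * k)" "coord (g * k) = coord (w ?x * k)" "pcomp (g * k) = pcomp g * pcomp (w ?x * k)"
      using cell_mult_P[OF p(1) wG] wp(1) by simp_all
    have "coord (w ?x * k) \<in> box n \<rho>"
    proof -
      have "(coord (w ?x * k) - ?x) + ?x \<in> box n \<rho>" using box_mono[OF wp(2) e(4)] g(3) by (rule box_add)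
      moreover have "(coord (w ?x * k) - ?x) + ?x = coord (w ?x * k)"
        using coord_M[OF wp(1)] xM by (intro eq_matI) auto
      ultimately show ?thesis by simp
    qed
    moreover have "\<sigma> (pcomp (w ?x * k)) = 1"
      by (rule e0(3)[OF near_one_mono[OF wp(3) e(3)] pcomp_P(1)[OF wG wp(1)]])
    then have "\<sigma> (pcomp g * pcomp (w ?x * k)) = \<sigma> (pcomp g)"
      using \<sigma>_mult[OF p(1) pcomp_P(1)[OF wG wp(1)]] by simp
    ultimately show ?thesis unfolding eqs(2,3) using eqs(1) by blast
  qed
  show ?thesis
  proof (rule IndI[of _ e])
    fix p g :: "'a mat" assume p: "p \<in> parabolic r s" and g: "g \<in> G"
    have pg: "p * g \<in> G" using parabolic_GL[OF p] g by simp
    show "bump \<rho> (p * g) = \<sigma> p * bump \<rho> g"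
    proof (cases "cell g")
      case True
      then show ?thesis
        using cell_mult_P[OF p g] \<sigma>_mult[OF p pcomp_P(1)[OF g True]] by (simp add: bump_apply[OF g] bump_apply[OF pg])
    next
      case False
      then show ?thesis using cell_mult_P(1)[OF p g] by (simp add: bump_apply[OF g] bump_apply[OF pg])
    qed
  next
    fix g k :: "'a mat" assume g: "g \<in> G" and k: "k \<in> near_one N e"
    have kG: "k \<in> G" using near_one_GL[OF k] e by simp
    have gk: "g * k \<in> G" using g kG by simp
    show "bump \<rho> (g * k) = bump \<rho> g"
    proof (cases "cell g \<and> coord g \<in> box n \<rho>")
      case True
      then show ?thesis using key[OF g _ _ k] by (simp add: bump_apply[OF g] bump_apply[OF gk])
    next
      case False
      have "\<not> (cell (g * k) \<and> coord (g * k) \<in> box n \<rho>)"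
      proof
        assume c: "cell (g * k) \<and> coord (g * k) \<in> box n \<rho>"
        have k': "GLinv N k \<in> near_one N e" by (rule near_one_inv[OF k]) (use e in auto)
        have "g * k * GLinv N k = g" using g kG by (simp add: G_assoc G_right_one)
        then show False using key[OF gk _ _ k'] c False by simp
      qed
      then show ?thesis unfolding bump_apply[OF g] bump_apply[OF gk] using False by auto
    qed
  qed (use e in \<open>auto simp: bump_def\<close>)
qed

text \<open>If \<open>x\<close> has a large entry \<open>x\<^sub>i\<^sub>j\<close>, then adding \<open>- 1 / x\<^sub>i\<^sub>j\<close> to a suitable entry of the
  identity yields a matrix \<open>k\<close> close to 1 for which \<open>w x k\<close> leaves the open cell.\<close>

lemma large_coordinate_vanishes:
  assumes f: "f \<in> Ind" "\<And>g k. g \<in> G \<Longrightarrow> k \<in> near_one N e \<Longrightarrow> f (g * k) = f g" and e: "0 < e"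
    and van: "\<And>g. g \<in> G \<Longrightarrow> \<not> cell g \<Longrightarrow> f g = 0"
    and x: "x \<in> M" "x \<notin> box n (1 / e)"
  shows "f (w x) = 0"
proof -
  obtain i j where ij: "i < n" "j < n" "absv (x $$ (i,j)) > 1 / e"
    using x unfolding box_def mbound_def by (auto simp: not_le)
  let ?z = "x $$ (i,j)"
  have z: "?z \<noteq> 0" using ij(3) e by fastforce
  have zb: "absv (1 / ?z) \<le> e" using ij(3) e z by (simp add: absv_divide field_simps)
  define y where "y = mat n n (\<lambda>(a,b). if a = j \<and> b = i then - (1 / ?z) else 0)"
  have yM: "y \<in> M" by (simp add: y_def)
  let ?k = "four_block_mat (1\<^sub>m n) (0\<^sub>m n n) y (1\<^sub>m n)"
  have kc: "?k \<in> carrier_mat N N" unfolding rs using yM by auto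
  have kn: "?k \<in> near_one N e"
  proof -
    have "absv ((?k - 1\<^sub>m (n + n)) $$ (a, b)) \<le> e" if "a < n + n" "b < n + n" for a b
      using that e zb ij by (auto simp: y_def)
    then show ?thesis using kc unfolding near_one_def mbound_def rs by auto
  qed
  have "w x * ?k = four_block_mat (0\<^sub>m n n * 1\<^sub>m n + 1\<^sub>m n * y) (0\<^sub>m n n * 0\<^sub>m n n + 1\<^sub>m n * 1\<^sub>m n)
      (1\<^sub>m n * 1\<^sub>m n + x * y) (1\<^sub>m n * 0\<^sub>m n n + x * 1\<^sub>m n)"
    unfolding w_def using x(1) yM by (intro four_block_mult) auto
  then have LL: "LL (w x * ?k) = 1\<^sub>m n + x * y" using x(1) yM by (simp add: LL_four)
  have "det (1\<^sub>m n + x * y) = 0"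
  proof (rule zero_row_kernel[of _ n i])
    show "1\<^sub>m n + x * y \<in> carrier_mat n n" using x(1) yM by auto
    fix l assume l: "l < n"
    have "(x * y) $$ (i,l) = (\<Sum>m = 0..<n. x $$ (i,m) * (if m = j \<and> l = i then - (1 / ?z) else 0))"
      using x(1) l ij by (auto simp: scalar_prod_def y_def intro!: sum.cong)
    also have "\<dots> = (\<Sum>m = 0..<n. if m = j then (if l = i then -1 else 0) else 0)"
      using z by (intro sum.cong) auto
    also have "\<dots> = (if l = i then -1 else 0)" using ij by simp
    finally show "(1\<^sub>m n + x * y) $$ (i,l) = 0" using x(1) yM l ij by auto
  qed (use ij in auto)
  then have "\<not> cell (w x * ?k)" unfolding cell_def LL by simp
  moreover have "?k \<in> G"
  proof -
    have "det ?k = 1"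
      using det_four_block_mat_upper_right_zero[of "1\<^sub>m n" n "0\<^sub>m n n" n y "1\<^sub>m n"] yM by simp
    then show ?thesis using kc by (intro GL_memI) auto
  qed
  ultimately have "f (w x * ?k) = 0" using w_G(1)[OF x(1)] by (intro van) auto
  then show ?thesis using f(2)[OF w_G(1)[OF x(1)] kn] by simp
qed

lemma bump_act_u:
  assumes g: "g \<in> G" and d: "d \<in> M"
  shows "bump \<rho> (g * u (- d)) = (if cell g \<and> coord g - d \<in> box n \<rho> then \<sigma> (pcomp g) else 0)"
proof (cases "cell g")
  case True
  have d': "- d \<in> M" using d by simp
  have "coord g + - d = coord g - d" using coord_M[OF True] d by (intro eq_matI) auto
  then show ?thesis using cell_u[OF g True d'] g u_G[OF d'] True by (simp add: bump_apply)
next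
  case False
  have d': "- d \<in> M" using d by simp
  show ?thesis using not_cell_u[OF g False d'] False g u_G[OF d'] by (simp add: bump_apply)
qed

text \<open>A function supported in the open cell is a finite combination of translates of a bump
  function, hence proportional to it modulo \<open>W\<close>.\<close>

lemma equiv_bump:
  assumes f: "f \<in> Ind" and van: "\<And>g. g \<in> G \<Longrightarrow> \<not> cell g \<Longrightarrow> f g = 0"
  obtains \<rho>0 where "0 < \<rho>0" "\<rho>0 \<le> 1"
    "\<And>\<rho>. 0 < \<rho> \<Longrightarrow> \<rho> \<le> \<rho>0 \<Longrightarrow> \<exists>R\<ge>1. \<exists>D. transversal n R \<rho> D \<and>
       (\<forall>x\<in>M. \<forall>y\<in>box n \<rho>. f (w (x + y)) = f (w x)) \<and>
       (\<lambda>g\<in>G. f g - (\<Sum>d\<in>D. \<Psi> (- d) * f (w d)) * bump \<rho> g) \<in> W"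
proof -
  obtain e where e: "0 < e" "e < 1" "\<And>g k. g \<in> G \<Longrightarrow> k \<in> near_one N e \<Longrightarrow> f (g * k) = f g"
    using Ind_smooth[OF f] by blast
  define R where "R = 1 / e"
  have R: "1 \<le> R" using e by (simp add: R_def)
  show thesis
  proof (rule that[of e])
    fix \<rho> assume \<rho>: "0 < \<rho>" "\<rho> \<le> e"
    have \<rho>1: "\<rho> \<le> 1" and \<rho>R: "\<rho> \<le> R" using \<rho> e R by auto
    obtain D :: "'a mat set" where D: "transversal n R \<rho> D" using transversal_exists[OF \<rho>(1)] by blast
    have DM: "d \<in> M" if "d \<in> D" for d using box_carrier[OF transversalD(2)[OF D that]] .
    have per: "f (w (x + y)) = f (w x)" if x: "x \<in> M" and y: "y \<in> box n \<rho>" for x y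
      using e(3)[OF w_G(1)[OF x] u_near[OF box_mono[OF y \<rho>(2)] less_imp_le[OF e(1)]]] w_u[OF x box_carrier[OF y]] by simp
    have decomp: "f g = (\<Sum>d\<in>D. f (w d) * bump \<rho> (g * u (- d)))" if g: "g \<in> G" for g
    proof (cases "cell g")
      case False
      then have "bump \<rho> (g * u (- d)) = 0" if "d \<in> D" for d using bump_act_u[OF g DM[OF that]] by simp
      then show ?thesis using van[OF g False] by simp
    next
      case True
      let ?x = "coord g"
      have xM: "?x \<in> M" by (rule coord_M[OF True])
      have fg: "f g = \<sigma> (pcomp g) * f (w ?x)"
        using Ind_equivariant[OF f pcomp_P(1)[OF g True] w_G(1)[OF xM]] pcomp_P(2)[OF g True] by simp
      show ?thesis
      proof (cases "?x \<in> box n R")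
        case True': True
        obtain d0 where "d0 \<in> D \<and> ?x - d0 \<in> box n \<rho>" "\<forall>d. d \<in> D \<and> ?x - d \<in> box n \<rho> \<longrightarrow> d = d0"
          using transversalD(3)[OF D True'] by (rule ex1E)
        then have d0: "d0 \<in> D" "?x - d0 \<in> box n \<rho>" "\<And>d. d \<in> D \<Longrightarrow> ?x - d \<in> box n \<rho> \<Longrightarrow> d = d0"
          by blast+
        have "d0 + (?x - d0) = ?x" using xM DM[OF d0(1)] by (intro eq_matI) auto
        then have fx: "f (w ?x) = f (w d0)" using per[OF DM[OF d0(1)] d0(2)] by simp
        have "(\<Sum>d\<in>D. f (w d) * bump \<rho> (g * u (- d))) = (\<Sum>d\<in>D. if d = d0 then f (w d0) * \<sigma> (pcomp g) else 0)"
        proof (rule sum.cong[OF refl])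
          fix d assume d: "d \<in> D"
          show "f (w d) * bump \<rho> (g * u (- d)) = (if d = d0 then f (w d0) * \<sigma> (pcomp g) else 0)"
          proof (cases "d = d0")
            case True
            then show ?thesis using bump_act_u[OF g DM[OF d], of \<rho>] \<open>cell g\<close> d0(2) by simp
          next
            case False
            then have "?x - d \<notin> box n \<rho>" using d0(3)[OF d] by blast
            then show ?thesis using bump_act_u[OF g DM[OF d], of \<rho>] False by simp
          qed
        qed
        also have "\<dots> = f (w d0) * \<sigma> (pcomp g)" using transversalD(1)[OF D] d0(1) by simp
        finally show ?thesis using fg fx by simp
      next
        case False
        have "f (w ?x) = 0"
          by (rule large_coordinate_vanishes[OF f e(3) e(1) van xM]) (use False in \<open>simp_all add: R_def\<close>)
        moreover have "bump \<rho> (g * u (- d)) = 0" if d: "d \<in> D" for d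
        proof -
          have "?x - d \<notin> box n \<rho>"
          proof
            assume "?x - d \<in> box n \<rho>"
            then have "(?x - d) + d \<in> box n R" using box_mono[OF _ \<rho>R] transversalD(2)[OF D d] by (intro box_add) auto
            moreover have "(?x - d) + d = ?x" using xM DM[OF d] by (intro eq_matI) auto
            ultimately show False using False by simp
          qed
          then show ?thesis using bump_act_u[OF g DM[OF d]] by simp
        qed
        ultimately show ?thesis using fg by simp
      qed
    qed
    have bI: "bump \<rho> \<in> Ind" by (rule bump_Ind[OF \<rho>(1) \<rho>1])
    have "(\<lambda>g\<in>G. \<Sum>d\<in>D. f (w d) * (\<lambda>g\<in>G. bump \<rho> (g * u (- d)) - \<Psi> (- d) * bump \<rho> g) g) \<in> W"
      by (rule W_sum[OF transversalD(1)[OF D]]) (rule W_gen[OF _ bI], use DM in simp)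
    moreover have "(\<lambda>g\<in>G. \<Sum>d\<in>D. f (w d) * (\<lambda>g\<in>G. bump \<rho> (g * u (- d)) - \<Psi> (- d) * bump \<rho> g) g) =
        (\<lambda>g\<in>G. f g - (\<Sum>d\<in>D. \<Psi> (- d) * f (w d)) * bump \<rho> g)"
    proof (rule restrict_ext)
      fix g assume g: "g \<in> G"
      have "(\<Sum>d\<in>D. f (w d) * (\<lambda>g\<in>G. bump \<rho> (g * u (- d)) - \<Psi> (- d) * bump \<rho> g) g) =
          (\<Sum>d\<in>D. f (w d) * bump \<rho> (g * u (- d)) - \<Psi> (- d) * f (w d) * bump \<rho> g)"
        using g by (intro sum.cong) (auto simp: algebra_simps)
      also have "\<dots> = f g - (\<Sum>d\<in>D. \<Psi> (- d) * f (w d)) * bump \<rho> g"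
        by (simp add: sum_subtractf decomp[OF g, symmetric] sum_distrib_right)
      finally show "(\<Sum>d\<in>D. f (w d) * (\<lambda>g\<in>G. bump \<rho> (g * u (- d)) - \<Psi> (- d) * bump \<rho> g) g) =
          f g - (\<Sum>d\<in>D. \<Psi> (- d) * f (w d)) * bump \<rho> g" .
    qed
    ultimately have inW: "(\<lambda>g\<in>G. f g - (\<Sum>d\<in>D. \<Psi> (- d) * f (w d)) * bump \<rho> g) \<in> W" by (simp only:)
    show "\<exists>R\<ge>1. \<exists>D. transversal n R \<rho> D \<and>
       (\<forall>x\<in>M. \<forall>y\<in>box n \<rho>. f (w (x + y)) = f (w x)) \<and>
       (\<lambda>g\<in>G. f g - (\<Sum>d\<in>D. \<Psi> (- d) * f (w d)) * bump \<rho> g) \<in> W"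
      by (intro exI[of _ R] exI[of _ D] conjI ballI R D per inW)
  qed (use e in auto)
qed

end

section \<open>The action of the diagonal\<close>

lemma matrix_trace_mult_comm:
  fixes A B :: "'a::comm_semiring_0 mat"
  assumes "A \<in> carrier_mat n m" "B \<in> carrier_mat m n"
  shows "(\<Sum>i<n. (A * B) $$ (i,i)) = (\<Sum>i<m. (B * A) $$ (i,i))"
proof -
  have "(\<Sum>i<n. (A * B) $$ (i,i)) = (\<Sum>i<n. \<Sum>j<m. A $$ (i,j) * B $$ (j,i))"
    using assms by (intro sum.cong) (auto simp: scalar_prod_def lessThan_atLeast0)
  also have "\<dots> = (\<Sum>j<m. \<Sum>i<n. B $$ (j,i) * A $$ (i,j))"
    by (subst sum.swap) (simp add: mult.commute)
  also have "\<dots> = (\<Sum>i<m. (B * A) $$ (i,i))"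
    using assms by (intro sum.cong) (auto simp: scalar_prod_def lessThan_atLeast0)
  finally show ?thesis .
qed

lemma scalar_GL: "z \<noteq> 0 \<Longrightarrow> z \<cdot>\<^sub>m 1\<^sub>m n \<in> carrier (GL n :: 'a::field mat monoid)"
  by (rule GL_memI) auto

context twisted_character
begin

lemma submoduleI_Ind:
  assumes "S \<subseteq> Ind" "(\<lambda>g\<in>G. 0) \<in> S" "\<And>f h. f \<in> S \<Longrightarrow> h \<in> S \<Longrightarrow> (\<lambda>g\<in>G. f g + h g) \<in> S"
    "\<And>c f. f \<in> S \<Longrightarrow> (\<lambda>g\<in>G. c * f g) \<in> S"
  shows "submodule complex_ring S V"
proof
  show "S \<subseteq> carrier V" using assms(1) by (simp add: V_simps)
qed (use assms(2-4) in \<open>simp_all add: V_simps\<close>)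

lemma W_lincomb:
  assumes "f \<in> W" "h \<in> W" shows "(\<lambda>g\<in>G. a * f g + b * h g) \<in> W"
proof -
  have "(\<lambda>g\<in>G. (\<lambda>g\<in>G. a * f g) g + (\<lambda>g\<in>G. b * h g) g) \<in> W"
    by (rule W_add[OF W_smult[OF assms(1)] W_smult[OF assms(2)]])
  moreover have "(\<lambda>g\<in>G. (\<lambda>g\<in>G. a * f g) g + (\<lambda>g\<in>G. b * h g) g) = (\<lambda>g\<in>G. a * f g + b * h g)"
    by (rule restrict_ext) simp
  ultimately show ?thesis by (simp only:)
qed

lemma \<Psi>_conj:
  assumes x: "x \<in> M" and b: "b \<in> M" "c \<in> M" "b * c = 1\<^sub>m n"
  shows "\<Psi> (c * x * b) = \<Psi> x"
proof -
  have "b * (c * x) = x"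
    using assoc_mult_mat[OF b(1,2) x, symmetric] b(3) left_mult_one_mat[OF x] by simp
  then show ?thesis
    unfolding \<Psi>_def using matrix_trace_mult_comm[OF mult_carrier_mat[OF b(2) x] b(1)] by simp
qed

definition \<Delta> :: "'a mat \<Rightarrow> 'a mat" where
  "\<Delta> a = four_block_mat a (0\<^sub>m n n) (0\<^sub>m n n) a"

lemma \<Delta>_mult: "a \<in> M \<Longrightarrow> b \<in> M \<Longrightarrow> \<Delta> (a * b) = \<Delta> a * \<Delta> b"
  unfolding \<Delta>_def using parabolic_mult_blocks[of a n "0\<^sub>m n n" n a b "0\<^sub>m n n" b]
  by (simp add: right_mult_zero_mat[of a n n] left_mult_zero_mat[of b n n])

lemma \<Delta>_scalar: "\<Delta> (z \<cdot>\<^sub>m 1\<^sub>m n) = z \<cdot>\<^sub>m 1\<^sub>m N"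
  unfolding \<Delta>_def rs by (intro eq_matI) auto

lemma \<Delta>_one: "\<Delta> (1\<^sub>m n) = 1\<^sub>m N"
  unfolding \<Delta>_def rs by (intro eq_matI) auto

lemma \<Delta>_G:
  assumes a: "a \<in> carrier (GL n)" shows "\<Delta> a \<in> G"
proof -
  have aM: "a \<in> M" "GLinv n a \<in> M" using a by auto
  have c: "\<Delta> b \<in> carrier_mat N N" if "b \<in> M" for b
    unfolding \<Delta>_def rs by (rule four_block_carrier_mat[OF that that])
  have "\<Delta> a * \<Delta> (GLinv n a) = 1\<^sub>m N" using a by (simp add: \<Delta>_one flip: \<Delta>_mult[OF aM])
  then show ?thesis by (rule GL_intro(1)[OF c[OF aM(1)] c[OF aM(2)]])
qed

lemma \<Delta>_u:
  assumes a: "a \<in> carrier (GL n)" and x: "x \<in> M"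
  shows "\<Delta> a * u x = u (a * x * GLinv n a) * \<Delta> a"
proof -
  have aM: "a \<in> M" "GLinv n a \<in> M" using a by auto
  have ax: "a * x \<in> M" "a * x * GLinv n a \<in> M" using aM x by auto
  have "a * x * GLinv n a * a = a * x"
    unfolding assoc_mult_mat[OF ax(1) aM(2,1)] using a right_mult_one_mat[OF ax(1)] by simp
  then show ?thesis
    unfolding \<Delta>_def u_def
    using parabolic_mult_blocks[of a n "0\<^sub>m n n" n a "1\<^sub>m n" x "1\<^sub>m n"]
      parabolic_mult_blocks[of "1\<^sub>m n" n "a * x * GLinv n a" n "1\<^sub>m n" a "0\<^sub>m n n" a] aM x ax
    by (simp add: right_mult_one_mat[OF aM(1)] left_mult_one_mat[OF aM(1)])
qed

lemma act_linear: "h \<in> G \<Longrightarrow> act h (\<lambda>g\<in>G. F g) = (\<lambda>g\<in>G. F (g * h))"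
  unfolding act_def by (rule restrict_ext) simp

lemma W_act:
  assumes a: "a \<in> carrier (GL n)" and f: "f \<in> W"
  shows "act (\<Delta> a) f \<in> W"
proof -
  let ?h = "\<Delta> a" and ?S = "{f \<in> Ind. act (\<Delta> a) f \<in> W}"
  have h: "?h \<in> G" by (rule \<Delta>_G[OF a])
  have aM: "a \<in> M" "GLinv n a \<in> M" using a by auto
  have "W \<subseteq> ?S"
  proof (rule W_least)
    fix x :: "'a mat" and f assume x: "x \<in> M" and f: "f \<in> Ind"
    let ?x = "a * x * GLinv n a"
    have xM: "?x \<in> M" using aM x by auto
    have "\<Psi> ?x = \<Psi> x" by (rule \<Psi>_conj[OF x aM(2,1)]) (use a in simp)
    then have "(\<lambda>g\<in>G. act ?h f (g * u ?x) - \<Psi> x * act ?h f g) \<in> W" using W_gen[OF xM Ind_act[OF f h]] by simp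
    moreover have "act ?h (\<lambda>g\<in>G. f (g * u x) - \<Psi> x * f g) = (\<lambda>g\<in>G. act ?h f (g * u ?x) - \<Psi> x * act ?h f g)"
      unfolding act_linear[OF h]
    proof (rule restrict_ext)
      fix g assume g: "g \<in> G"
      have "g * ?h * u x = g * u ?x * ?h"
        using g h u_G[OF x] u_G[OF xM] by (simp add: G_assoc \<Delta>_u[OF a x])
      then show "f (g * ?h * u x) - \<Psi> x * f (g * ?h) = act ?h f (g * u ?x) - \<Psi> x * act ?h f g"
        using g u_G[OF xM] by (simp add: act_apply)
    qed
    ultimately show "(\<lambda>g\<in>G. f (g * u x) - \<Psi> x * f g) \<in> ?S"
      using W_Ind[OF W_gen[OF x f]] by simp
  next
    show "submodule complex_ring ?S V"
    proof (rule submoduleI_Ind)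
      show "(\<lambda>g\<in>G. 0) \<in> ?S" using W_zero Ind_zero by (simp add: act_linear[OF h])
    next
      fix f k assume fk: "f \<in> ?S" "k \<in> ?S"
      have "act ?h (\<lambda>g\<in>G. f g + k g) = (\<lambda>g\<in>G. act ?h f g + act ?h k g)"
        unfolding act_linear[OF h] by (rule restrict_ext) (simp add: act_apply)
      then show "(\<lambda>g\<in>G. f g + k g) \<in> ?S" using fk Ind_add W_add by simp
    next
      fix c f assume f: "f \<in> ?S"
      have "act ?h (\<lambda>g\<in>G. c * f g) = (\<lambda>g\<in>G. c * act ?h f g)"
        unfolding act_linear[OF h] by (rule restrict_ext) (simp add: act_apply)
      then show "(\<lambda>g\<in>G. c * f g) \<in> ?S" using f Ind_smult W_smult by simp
    qed blast
  qed
  then show ?thesis using f by blast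
qed

end

context balanced_character
begin

lemma \<Delta>_P: "a \<in> carrier (GL n) \<Longrightarrow> \<Delta> a \<in> parabolic r s"
  unfolding \<Delta>_def rn sn parabolic_def
  by (intro CollectI exI[of _ a] exI[of _ "0\<^sub>m n n"]) simp

lemma \<sigma>_\<Delta>_mult: "a \<in> carrier (GL n) \<Longrightarrow> b \<in> carrier (GL n) \<Longrightarrow> \<sigma> (\<Delta> (a * b)) = \<sigma> (\<Delta> a) * \<sigma> (\<Delta> b)"
  using \<sigma>_mult[OF \<Delta>_P \<Delta>_P, of a b] \<Delta>_mult[of a b] by simp

lemma \<sigma>_\<Delta>_nonzero: "a \<in> carrier (GL n) \<Longrightarrow> \<sigma> (\<Delta> a) \<noteq> 0"
  using \<sigma>_\<Delta>_mult[of a "GLinv n a"] by (auto simp: \<Delta>_one \<sigma>_one)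

lemma w_\<Delta>:
  assumes a: "a \<in> carrier (GL n)" and x: "x \<in> M"
  shows "w x * \<Delta> a = \<Delta> a * w (GLinv n a * x * a)"
proof -
  let ?b = "GLinv n a"
  have aM: "a \<in> M" "?b \<in> M" using a by auto
  have y: "?b * x \<in> M" "?b * x * a \<in> M" using aM x by auto
  have e: "a * (?b * x * a) = x * a"
    unfolding assoc_mult_mat[OF aM(1) y(1) aM(1), symmetric] assoc_mult_mat[OF aM(1,2) x, symmetric]
    using a left_mult_one_mat[OF x] by simp
  have 1: "w x * \<Delta> a = four_block_mat (0\<^sub>m n n * a + 1\<^sub>m n * 0\<^sub>m n n) (0\<^sub>m n n * 0\<^sub>m n n + 1\<^sub>m n * a)
     (1\<^sub>m n * a + x * 0\<^sub>m n n) (1\<^sub>m n * 0\<^sub>m n n + x * a)"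
    unfolding w_def \<Delta>_def using aM x by (intro four_block_mult) simp_all
  have 2: "\<Delta> a * w (?b * x * a) = four_block_mat (a * 0\<^sub>m n n + 0\<^sub>m n n * 1\<^sub>m n) (a * 1\<^sub>m n + 0\<^sub>m n n * (?b * x * a))
     (0\<^sub>m n n * 0\<^sub>m n n + a * 1\<^sub>m n) (0\<^sub>m n n * 1\<^sub>m n + a * (?b * x * a))"
    unfolding w_def \<Delta>_def
    by (rule four_block_mult[OF aM(1) zero_carrier_mat zero_carrier_mat aM(1)
        zero_carrier_mat one_carrier_mat one_carrier_mat y(2)])
  show ?thesis
    unfolding 1 2 e
    by (rule cong_four_block_mat)
      (use aM x y in \<open>simp_all add: right_mult_zero_mat[of _ n n] left_mult_zero_mat[of _ n n]
        left_mult_one_mat[OF aM(1)] right_mult_one_mat[OF aM(1)]\<close>)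
qed

lemma cell_\<Delta>:
  assumes a: "a \<in> carrier (GL n)" and g: "g \<in> G"
  shows "cell (g * \<Delta> a) \<longleftrightarrow> cell g"
proof -
  have aM: "a \<in> M" using a by simp
  obtain b1 b2 b3 b4 where bl: "g = four_block_mat b1 b2 b3 b4" "b1 \<in> M" "b2 \<in> M" "b3 \<in> M" "b4 \<in> M"
    by (rule G_blocks[OF g])
  have "g * \<Delta> a = four_block_mat (b1 * a + b2 * 0\<^sub>m n n) (b1 * 0\<^sub>m n n + b2 * a)
     (b3 * a + b4 * 0\<^sub>m n n) (b3 * 0\<^sub>m n n + b4 * a)"
    unfolding bl(1) \<Delta>_def using aM bl(2-) by (intro four_block_mult) simp_all
  then have "LL (g * \<Delta> a) = b3 * a + b4 * 0\<^sub>m n n" using aM bl(2-) by (simp add: LL_four)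
  also have "\<dots> = b3 * a" using bl aM by simp
  finally have "LL (g * \<Delta> a) = b3 * a" .
  moreover have "LL g = b3" using bl by (simp add: LL_four)
  ultimately show ?thesis unfolding cell_def using det_mult[OF bl(4) aM] GL_det[OF a] by simp
qed

subsection \<open>One-dimensionality\<close>

context
  fixes \<rho>1 :: real
  assumes \<rho>1: "0 < \<rho>1" "\<rho>1 \<le> 1" and \<Psi>_\<rho>1: "\<And>x. x \<in> box n \<rho>1 \<Longrightarrow> \<Psi> x = 1"
begin

definition f0 :: "'a mat \<Rightarrow> complex" where
  "f0 = bump \<rho>1"

lemma f0_Ind: "f0 \<in> Ind"
  unfolding f0_def by (rule bump_Ind[OF \<rho>1])

lemma f0_off_cell: "g \<in> G \<Longrightarrow> \<not> cell g \<Longrightarrow> f0 g = 0"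
  unfolding f0_def by (simp add: bump_apply)

lemma f0_w_\<Delta>:
  assumes a: "a \<in> carrier (GL n)" and x: "x \<in> M"
  shows "act (\<Delta> a) f0 (w x) = (if GLinv n a * x * a \<in> box n \<rho>1 then \<sigma> (\<Delta> a) else 0)"
proof -
  let ?y = "GLinv n a * x * a"
  have y: "?y \<in> M" using a x by (intro mult_carrier_mat[of _ n n]) auto
  show ?thesis
    using Ind_equivariant[OF f0_Ind \<Delta>_P[OF a] w_G(1)[OF y]] w_G(1)[OF x]
    by (simp add: act_apply w_\<Delta>[OF a x] f0_def bump_w[OF y])
qed

lemma act_f0_equiv_bump:
  assumes a: "a \<in> carrier (GL n)"
  obtains \<rho>0 where "0 < \<rho>0" "\<And>\<rho>. 0 < \<rho> \<Longrightarrow> \<rho> \<le> \<rho>0 \<Longrightarrow>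
     \<exists>m>0. (\<lambda>g\<in>G. act (\<Delta> a) f0 g - \<sigma> (\<Delta> a) * of_real m * bump \<rho> g) \<in> W"
proof -
  let ?f = "act (\<Delta> a) f0" and ?b = "GLinv n a"
  have aM: "a \<in> M" "?b \<in> M" using a by auto
  have h: "\<Delta> a \<in> G" by (rule \<Delta>_G[OF a])
  have f: "?f \<in> Ind" by (rule Ind_act[OF f0_Ind h])
  have van: "?f g = 0" if "g \<in> G" "\<not> cell g" for g
    using that h cell_\<Delta>[OF a that(1)] by (simp add: act_apply f0_off_cell)
  obtain \<rho>0 where \<rho>0: "0 < \<rho>0" "\<rho>0 \<le> 1"
    "\<And>\<rho>. 0 < \<rho> \<Longrightarrow> \<rho> \<le> \<rho>0 \<Longrightarrow> \<exists>R\<ge>1. \<exists>D. transversal n R \<rho> D \<and>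
       (\<forall>x\<in>M. \<forall>y\<in>box n \<rho>. ?f (w (x + y)) = ?f (w x)) \<and>
       (\<lambda>g\<in>G. ?f g - (\<Sum>d\<in>D. \<Psi> (- d) * ?f (w d)) * bump \<rho> g) \<in> W"
    using equiv_bump[OF f van] by blast
  show thesis
  proof (rule that[OF \<rho>0(1)])
    fix \<rho> assume \<rho>: "0 < \<rho>" "\<rho> \<le> \<rho>0"
    obtain R D where R: "1 \<le> R" and D: "transversal n R \<rho> D"
      and per: "\<And>x y. x \<in> M \<Longrightarrow> y \<in> box n \<rho> \<Longrightarrow> ?f (w (x + y)) = ?f (w x)"
      and inW: "(\<lambda>g\<in>G. ?f g - (\<Sum>d\<in>D. \<Psi> (- d) * ?f (w d)) * bump \<rho> g) \<in> W"
      using \<rho>0(3)[OF \<rho>] by blast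
    have DM: "d \<in> M" if "d \<in> D" for d using box_carrier[OF transversalD(2)[OF D that]] .
    define E where "E = {d \<in> D. ?b * d * a \<in> box n \<rho>1}"
    have fin: "finite D" by (rule transversalD(1)[OF D])
    have "(\<Sum>d\<in>D. \<Psi> (- d) * ?f (w d)) = (\<Sum>d\<in>D. if d \<in> E then \<sigma> (\<Delta> a) else 0)"
    proof (rule sum.cong[OF refl])
      fix d assume d: "d \<in> D"
      have dM: "d \<in> M" "- d \<in> M" using DM[OF d] by auto
      show "\<Psi> (- d) * ?f (w d) = (if d \<in> E then \<sigma> (\<Delta> a) else 0)"
      proof (cases "?b * d * a \<in> box n \<rho>1")
        case True
        have "\<Psi> d = 1" using \<Psi>_conj[OF dM(1) aM] \<Psi>_\<rho>1[OF True] a by simp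
        then have "\<Psi> (- d) = 1" using \<Psi>_inverse[OF dM(1)] by simp
        then show ?thesis using d True f0_w_\<Delta>[OF a dM(1)] by (simp add: E_def)
      next
        case False
        then show ?thesis using f0_w_\<Delta>[OF a dM(1)] by (simp add: E_def)
      qed
    qed
    also have "\<dots> = (\<Sum>d\<in>{d \<in> D. d \<in> E}. \<sigma> (\<Delta> a))" by (simp only: sum.inter_filter[OF fin])
    also have "\<dots> = \<sigma> (\<Delta> a) * of_real (real (card E))"
      by (simp add: E_def)
    finally have sum: "(\<Sum>d\<in>D. \<Psi> (- d) * ?f (w d)) = \<sigma> (\<Delta> a) * of_real (real (card E))" .
    have "E \<noteq> {}"
    proof -
      have "0 \<le> R" using R by simp
      from transversalD(3)[OF D box_zero[OF this]] obtain d where d: "d \<in> D" "0\<^sub>m n n - d \<in> box n \<rho>" by blast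
      have dM: "d \<in> M" by (rule DM[OF d(1)])
      have "- (0\<^sub>m n n - d) = d" using dM by (intro eq_matI) auto
      then have db: "d \<in> box n \<rho>" using box_uminus[OF d(2)] by simp
      have zM: "(0\<^sub>m n n :: 'a mat) \<in> M" by simp
      have "0\<^sub>m n n + d = d" using dM by simp
      then have "?f (w d) = ?f (w (0\<^sub>m n n))" using per[OF zM db] by simp
      moreover have "?b * 0\<^sub>m n n * a = 0\<^sub>m n n"
        using right_mult_zero_mat[OF aM(2)] left_mult_zero_mat[OF aM(1)] by simp
      then have "?f (w (0\<^sub>m n n)) \<noteq> 0"
        using f0_w_\<Delta>[OF a zM] box_zero[of \<rho>1 n] \<rho>1 \<sigma>_\<Delta>_nonzero[OF a] by simp
      ultimately have "?b * d * a \<in> box n \<rho>1" using f0_w_\<Delta>[OF a dM] by (auto split: if_splits)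
      then show ?thesis using d(1) by (auto simp: E_def)
    qed
    moreover have "finite E" using fin by (simp add: E_def)
    ultimately have "0 < real (card E)" by (simp add: card_gt_0_iff)
    then show "\<exists>m>0. (\<lambda>g\<in>G. ?f g - \<sigma> (\<Delta> a) * of_real m * bump \<rho> g) \<in> W"
      using inW unfolding sum by blast
  qed
qed

lemma f0_equiv_bump:
  obtains \<rho>0 where "0 < \<rho>0" "\<And>\<rho>. 0 < \<rho> \<Longrightarrow> \<rho> \<le> \<rho>0 \<Longrightarrow>
     \<exists>m>0. (\<lambda>g\<in>G. f0 g - of_real m * bump \<rho> g) \<in> W"
  using act_f0_equiv_bump[OF GL_one_closed, unfolded \<Delta>_one act_one[OF f0_Ind] \<sigma>_one mult_1_left] by blast

lemma compare_bumps:
  assumes "(\<lambda>g\<in>G. f g - c * b g) \<in> W" "(\<lambda>g\<in>G. f0 g - of_real m * b g) \<in> W" "0 < m"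
  shows "(\<lambda>g\<in>G. f g - c / of_real m * f0 g) \<in> W"
proof -
  have "(\<lambda>g\<in>G. 1 * (\<lambda>g\<in>G. f g - c * b g) g + (- c / of_real m) * (\<lambda>g\<in>G. f0 g - of_real m * b g) g) \<in> W"
    by (rule W_lincomb[OF assms(1,2)])
  moreover have "(\<lambda>g\<in>G. 1 * (\<lambda>g\<in>G. f g - c * b g) g + (- c / of_real m) * (\<lambda>g\<in>G. f0 g - of_real m * b g) g) =
     (\<lambda>g\<in>G. f g - c / of_real m * f0 g)"
    by (rule restrict_ext) (use assms(3) in \<open>simp add: field_simps\<close>)
  ultimately show ?thesis by (simp only:)
qed

lemma act_f0_positive_multiple:
  assumes a: "a \<in> carrier (GL n)"
  shows "\<exists>m>0. (\<lambda>g\<in>G. act (\<Delta> a) f0 g - \<sigma> (\<Delta> a) * of_real m * f0 g) \<in> W"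
proof -
  obtain \<rho>a where \<rho>a: "0 < \<rho>a" "\<And>\<rho>. 0 < \<rho> \<Longrightarrow> \<rho> \<le> \<rho>a \<Longrightarrow>
     \<exists>m>0. (\<lambda>g\<in>G. act (\<Delta> a) f0 g - \<sigma> (\<Delta> a) * of_real m * bump \<rho> g) \<in> W"
    using act_f0_equiv_bump[OF a] by blast
  obtain \<rho>0 where \<rho>0: "0 < \<rho>0" "\<And>\<rho>. 0 < \<rho> \<Longrightarrow> \<rho> \<le> \<rho>0 \<Longrightarrow>
     \<exists>m>0. (\<lambda>g\<in>G. f0 g - of_real m * bump \<rho> g) \<in> W" using f0_equiv_bump by blast
  define \<rho> where "\<rho> = min \<rho>a \<rho>0"
  have \<rho>: "0 < \<rho>" "\<rho> \<le> \<rho>a" "\<rho> \<le> \<rho>0" using \<rho>a \<rho>0 by (auto simp: \<rho>_def)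
  obtain m1 where m1: "0 < m1" "(\<lambda>g\<in>G. act (\<Delta> a) f0 g - \<sigma> (\<Delta> a) * of_real m1 * bump \<rho> g) \<in> W"
    using \<rho>a(2)[OF \<rho>(1,2)] by blast
  obtain m2 where m2: "0 < m2" "(\<lambda>g\<in>G. f0 g - of_real m2 * bump \<rho> g) \<in> W"
    using \<rho>0(2)[OF \<rho>(1,3)] by blast
  have "(\<lambda>g\<in>G. act (\<Delta> a) f0 g - \<sigma> (\<Delta> a) * of_real m1 / of_real m2 * f0 g) \<in> W"
    by (rule compare_bumps[OF m1(2) m2(2,1)])
  then show ?thesis using m1 m2 by (intro exI[of _ "m1 / m2"]) simp
qed

lemma Ind_multiple_f0:
  assumes f: "f \<in> Ind"
  shows "\<exists>c. (\<lambda>g\<in>G. f g - c * f0 g) \<in> W"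
proof -
  obtain f' where f': "f' \<in> Ind" "(\<lambda>g\<in>G. f g - f' g) \<in> W" "\<And>g. g \<in> G \<Longrightarrow> degenerate g \<Longrightarrow> f' g = 0"
    using average_exists[OF f] by blast
  have van: "f' g = 0" if "g \<in> G" "\<not> cell g" for g
    by (rule f'(3)[OF that(1) not_cell_degenerate[OF that]])
  obtain \<rho>a where \<rho>a: "0 < \<rho>a" "\<rho>a \<le> 1"
    "\<And>\<rho>. 0 < \<rho> \<Longrightarrow> \<rho> \<le> \<rho>a \<Longrightarrow> \<exists>R\<ge>1. \<exists>D. transversal n R \<rho> D \<and>
       (\<forall>x\<in>M. \<forall>y\<in>box n \<rho>. f' (w (x + y)) = f' (w x)) \<and>
       (\<lambda>g\<in>G. f' g - (\<Sum>d\<in>D. \<Psi> (- d) * f' (w d)) * bump \<rho> g) \<in> W"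
    using equiv_bump[OF f'(1) van] by blast
  obtain \<rho>0 where \<rho>0: "0 < \<rho>0" "\<And>\<rho>. 0 < \<rho> \<Longrightarrow> \<rho> \<le> \<rho>0 \<Longrightarrow>
     \<exists>m>0. (\<lambda>g\<in>G. f0 g - of_real m * bump \<rho> g) \<in> W" using f0_equiv_bump by blast
  define \<rho> where "\<rho> = min \<rho>a \<rho>0"
  have \<rho>: "0 < \<rho>" "\<rho> \<le> \<rho>a" "\<rho> \<le> \<rho>0" using \<rho>a \<rho>0 by (auto simp: \<rho>_def)
  obtain c where c: "(\<lambda>g\<in>G. f' g - c * bump \<rho> g) \<in> W" using \<rho>a(3)[OF \<rho>(1,2)] by blast
  obtain m2 where m2: "0 < m2" "(\<lambda>g\<in>G. f0 g - of_real m2 * bump \<rho> g) \<in> W"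
    using \<rho>0(2)[OF \<rho>(1,3)] by blast
  have "(\<lambda>g\<in>G. f' g - c / of_real m2 * f0 g) \<in> W"
    by (rule compare_bumps[OF c m2(2,1)])
  from W_add[OF f'(2) this]
  have "(\<lambda>g\<in>G. (\<lambda>g\<in>G. f g - f' g) g + (\<lambda>g\<in>G. f' g - c / of_real m2 * f0 g) g) \<in> W" .
  moreover have "(\<lambda>g\<in>G. (\<lambda>g\<in>G. f g - f' g) g + (\<lambda>g\<in>G. f' g - c / of_real m2 * f0 g) g) =
     (\<lambda>g\<in>G. f g - c / of_real m2 * f0 g)"
    by (rule restrict_ext) simp
  ultimately have "(\<lambda>g\<in>G. f g - c / of_real m2 * f0 g) \<in> W" by (simp only:)
  then show ?thesis by (rule exI)
qed

text \<open>The finite sums in \<open>vanishing\<close> stand for the integral of \<open>\<Psi>(- x) f (w x)\<close> over a box; on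
  \<open>W\<close> this integral vanishes over all large boxes, because translation by \<open>x\<close> does not
  change a box containing \<open>x\<close>.\<close>

definition vanishing :: "('a mat \<Rightarrow> complex) \<Rightarrow> bool" where
  "vanishing f \<longleftrightarrow> (\<exists>R0. \<forall>R\<ge>R0. \<exists>\<rho>0>0. \<forall>\<rho>. 0 < \<rho> \<longrightarrow> \<rho> \<le> \<rho>0 \<longrightarrow>
     (\<forall>D. transversal n R \<rho> D \<longrightarrow> (\<Sum>d\<in>D. \<Psi> (- d) * f (w d)) = 0))"

lemma vanishingI:
  assumes "\<And>R. R0 \<le> R \<Longrightarrow> \<exists>\<rho>0>0. \<forall>\<rho>. 0 < \<rho> \<longrightarrow> \<rho> \<le> \<rho>0 \<longrightarrow>
     (\<forall>D. transversal n R \<rho> D \<longrightarrow> (\<Sum>d\<in>D. \<Psi> (- d) * f (w d)) = 0)"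
  shows "vanishing f"
  unfolding vanishing_def using assms by blast

lemma vanishing_gen:
  assumes x: "x \<in> M" and f: "f \<in> Ind"
  shows "vanishing (\<lambda>g\<in>G. f (g * u x) - \<Psi> x * f g)"
proof -
  obtain e where e: "0 < e" "e < 1" "\<And>g k. g \<in> G \<Longrightarrow> k \<in> near_one N e \<Longrightarrow> f (g * k) = f g"
    using Ind_smooth[OF f] by blast
  obtain R0 where R0: "mbound x R0" using mbound_exists by blast
  show ?thesis
  proof (rule vanishingI)
    fix R assume R: "R0 \<le> R"
    have xR: "x \<in> box n R" using x mbound_mono[OF R0 R] by (simp add: box_def)
    show "\<exists>\<rho>0>0. \<forall>\<rho>. 0 < \<rho> \<longrightarrow> \<rho> \<le> \<rho>0 \<longrightarrow> (\<forall>D. transversal n R \<rho> D \<longrightarrow>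
        (\<Sum>d\<in>D. \<Psi> (- d) * (\<lambda>g\<in>G. f (g * u x) - \<Psi> x * f g) (w d)) = 0)"
    proof (intro exI[of _ "min \<rho>1 e"] conjI allI impI)
      show "0 < min \<rho>1 e" using \<rho>1 e by simp
      fix \<rho> :: real and D :: "'a mat set" assume \<rho>: "0 < \<rho>" "\<rho> \<le> min \<rho>1 e" and D: "transversal n R \<rho> D"
      define F where "F y = \<Psi> (- y) * f (w y)" for y
      have per: "F (y + z) = F y" if y: "y \<in> box n R" and z: "z \<in> box n \<rho>" for y z
      proof -
        have yz: "y \<in> M" "z \<in> M" using box_carrier[OF y] box_carrier[OF z] .
        have "- (y + z) = - y + - z" using yz by (intro eq_matI) auto
        moreover have "\<Psi> (- z) = 1" using \<rho> by (intro \<Psi>_\<rho>1 box_mono[OF box_uminus[OF z]]) simp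
        ultimately have "\<Psi> (- (y + z)) = \<Psi> (- y)" using yz by (simp add: \<Psi>_add)
        moreover have "f (w (y + z)) = f (w y)"
        proof -
          have "z \<in> box n e" using \<rho> by (intro box_mono[OF z]) simp
          then have "u z \<in> near_one N e" using e(1) by (intro u_near) auto
          from e(3)[OF w_G(1)[OF yz(1)] this] show ?thesis unfolding w_u[OF yz] .
        qed
        ultimately show ?thesis by (simp add: F_def)
      qed
      have tr: "(\<Sum>d\<in>D. F (x + d)) = (\<Sum>d\<in>D. F d)"
        using \<rho> by (intro transversal_translate[OF D _ per xR]) auto
      have "(\<Sum>d\<in>D. \<Psi> (- d) * (\<lambda>g\<in>G. f (g * u x) - \<Psi> x * f g) (w d)) = (\<Sum>d\<in>D. \<Psi> x * F (x + d) - \<Psi> x * F d)"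
      proof (rule sum.cong[OF refl])
        fix d assume "d \<in> D"
        then have d: "d \<in> M" by (rule box_carrier[OF transversalD(2)[OF D]])
        have "- (x + d) = - x + - d" using x d by (intro eq_matI) auto
        then have "\<Psi> x * F (x + d) = (\<Psi> (- x) * \<Psi> x) * (\<Psi> (- d) * f (w (x + d)))"
          using x d by (simp add: F_def \<Psi>_add)
        then have 1: "\<Psi> x * F (x + d) = \<Psi> (- d) * f (w (x + d))" by (simp add: \<Psi>_inverse[OF x])
        have "d + x = x + d" by (rule comm_add_mat[OF d x])
        then have 2: "(\<lambda>g\<in>G. f (g * u x) - \<Psi> x * f g) (w d) = f (w (x + d)) - \<Psi> x * f (w d)"
          using w_G(1)[OF d] w_u[OF d x] by simp
        show "\<Psi> (- d) * (\<lambda>g\<in>G. f (g * u x) - \<Psi> x * f g) (w d) = \<Psi> x * F (x + d) - \<Psi> x * F d"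
          unfolding 1 2 by (simp only: F_def right_diff_distrib mult.left_commute)
      qed
      also have "\<dots> = 0" by (simp add: sum_subtractf tr flip: sum_distrib_left)
      finally show "(\<Sum>d\<in>D. \<Psi> (- d) * (\<lambda>g\<in>G. f (g * u x) - \<Psi> x * f g) (w d)) = 0" .
    qed
  qed
qed

lemma vanishing_lincomb:
  assumes f: "vanishing f" and h: "vanishing h"
  shows "vanishing (\<lambda>g\<in>G. a * f g + b * h g)"
proof -
  obtain R1 where R1: "\<And>R. R1 \<le> R \<Longrightarrow> \<exists>\<rho>0>0. \<forall>\<rho>. 0 < \<rho> \<longrightarrow> \<rho> \<le> \<rho>0 \<longrightarrow>
     (\<forall>D. transversal n R \<rho> D \<longrightarrow> (\<Sum>d\<in>D. \<Psi> (- d) * f (w d)) = 0)"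
    using f unfolding vanishing_def by blast
  obtain R2 where R2: "\<And>R. R2 \<le> R \<Longrightarrow> \<exists>\<rho>0>0. \<forall>\<rho>. 0 < \<rho> \<longrightarrow> \<rho> \<le> \<rho>0 \<longrightarrow>
     (\<forall>D. transversal n R \<rho> D \<longrightarrow> (\<Sum>d\<in>D. \<Psi> (- d) * h (w d)) = 0)"
    using h unfolding vanishing_def by blast
  show ?thesis
  proof (rule vanishingI[of "max R1 R2"])
    fix R assume R: "max R1 R2 \<le> R"
    have R12: "R1 \<le> R" "R2 \<le> R" using R by auto
    obtain \<rho>a where a: "\<rho>a > 0" "\<And>\<rho> D. 0 < \<rho> \<Longrightarrow> \<rho> \<le> \<rho>a \<Longrightarrow> transversal n R \<rho> D \<Longrightarrow> (\<Sum>d\<in>D. \<Psi> (- d) * f (w d)) = 0"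
      using R1[OF R12(1)] by blast
    obtain \<rho>b where b: "\<rho>b > 0" "\<And>\<rho> D. 0 < \<rho> \<Longrightarrow> \<rho> \<le> \<rho>b \<Longrightarrow> transversal n R \<rho> D \<Longrightarrow> (\<Sum>d\<in>D. \<Psi> (- d) * h (w d)) = 0"
      using R2[OF R12(2)] by blast
    show "\<exists>\<rho>0>0. \<forall>\<rho>. 0 < \<rho> \<longrightarrow> \<rho> \<le> \<rho>0 \<longrightarrow> (\<forall>D. transversal n R \<rho> D \<longrightarrow>
        (\<Sum>d\<in>D. \<Psi> (- d) * (\<lambda>g\<in>G. a * f g + b * h g) (w d)) = 0)"
    proof (intro exI[of _ "min \<rho>a \<rho>b"] conjI allI impI)
      fix \<rho> :: real and D :: "'a mat set" assume \<rho>: "0 < \<rho>" "\<rho> \<le> min \<rho>a \<rho>b" and D: "transversal n R \<rho> D"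
      have "(\<Sum>d\<in>D. \<Psi> (- d) * (\<lambda>g\<in>G. a * f g + b * h g) (w d)) =
          (\<Sum>d\<in>D. a * (\<Psi> (- d) * f (w d)) + b * (\<Psi> (- d) * h (w d)))"
        using w_G(1)[OF box_carrier[OF transversalD(2)[OF D]]] by (intro sum.cong) (auto simp: algebra_simps)
      also have "\<dots> = a * (\<Sum>d\<in>D. \<Psi> (- d) * f (w d)) + b * (\<Sum>d\<in>D. \<Psi> (- d) * h (w d))"
        by (simp add: sum.distrib sum_distrib_left)
      also have "\<dots> = 0" using a(2)[OF \<rho>(1) _ D] b(2)[OF \<rho>(1) _ D] \<rho>(2) by simp
      finally show "(\<Sum>d\<in>D. \<Psi> (- d) * (\<lambda>g\<in>G. a * f g + b * h g) (w d)) = 0" .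
    qed (use a b in simp)
  qed
qed

lemma W_vanishing: "f \<in> W \<Longrightarrow> vanishing f"
proof -
  let ?S = "{f \<in> Ind. vanishing f}"
  have zero: "vanishing (\<lambda>g\<in>G. 0)"
  proof -
    have "(\<Sum>d\<in>D. \<Psi> (- d) * (\<lambda>g\<in>G. 0) (w d)) = 0" if D: "transversal n R \<rho> D" for R \<rho> D
      using w_G(1)[OF box_carrier[OF transversalD(2)[OF D]]] by (intro sum.neutral) auto
    then show ?thesis unfolding vanishing_def by (intro exI[of _ 0] allI impI exI[of _ 1]) auto
  qed
  have "W \<subseteq> ?S"
  proof (rule W_least)
    show "(\<lambda>g\<in>G. f (g * u x) - \<Psi> x * f g) \<in> ?S" if "x \<in> M" "f \<in> Ind" for x f
      using vanishing_gen[OF that] W_Ind[OF W_gen[OF that]] by simp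
    show "submodule complex_ring ?S V"
    proof (rule submoduleI_Ind)
      show "(\<lambda>g\<in>G. 0) \<in> ?S" using zero Ind_zero by simp
      show "(\<lambda>g\<in>G. f g + h g) \<in> ?S" if "f \<in> ?S" "h \<in> ?S" for f h
        using that Ind_add vanishing_lincomb[of f h 1 1] by simp
      show "(\<lambda>g\<in>G. c * f g) \<in> ?S" if "f \<in> ?S" for c f
        using that Ind_smult vanishing_lincomb[of f f c 0] by simp
    qed blast
  qed
  then show "f \<in> W \<Longrightarrow> vanishing f" by blast
qed

lemma f0_not_W: "f0 \<notin> W"
proof
  assume "f0 \<in> W"
  then have "vanishing f0" by (rule W_vanishing)
  then obtain R0 where R0: "\<And>R. R0 \<le> R \<Longrightarrow> \<exists>\<rho>0>0. \<forall>\<rho>. 0 < \<rho> \<longrightarrow> \<rho> \<le> \<rho>0 \<longrightarrow>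
     (\<forall>D. transversal n R \<rho> D \<longrightarrow> (\<Sum>d\<in>D. \<Psi> (- d) * f0 (w d)) = 0)"
    unfolding vanishing_def by blast
  define R where "R = max R0 1"
  have "R0 \<le> R" by (simp add: R_def)
  then obtain \<rho>0 where \<rho>0: "\<rho>0 > 0" "\<And>\<rho> D. 0 < \<rho> \<Longrightarrow> \<rho> \<le> \<rho>0 \<Longrightarrow> transversal n R \<rho> D \<Longrightarrow> (\<Sum>d\<in>D. \<Psi> (- d) * f0 (w d)) = 0"
    using R0 by blast
  define \<rho> where "\<rho> = min \<rho>0 \<rho>1"
  have \<rho>: "0 < \<rho>" "\<rho> \<le> \<rho>0" "\<rho> \<le> \<rho>1" using \<rho>0 \<rho>1 by (auto simp: \<rho>_def)
  obtain D :: "'a mat set" where D: "transversal n R \<rho> D" using transversal_exists[OF \<rho>(1)] by blast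
  have fin: "finite D" by (rule transversalD(1)[OF D])
  define E where "E = {d \<in> D. d \<in> box n \<rho>1}"
  have "(\<Sum>d\<in>D. \<Psi> (- d) * f0 (w d)) = (\<Sum>d\<in>D. if d \<in> box n \<rho>1 then 1 else 0)"
  proof (rule sum.cong[OF refl])
    fix d assume "d \<in> D"
    then have d: "d \<in> M" by (rule box_carrier[OF transversalD(2)[OF D]])
    show "\<Psi> (- d) * f0 (w d) = (if d \<in> box n \<rho>1 then 1 else 0)"
      using bump_w[OF d] \<Psi>_\<rho>1[OF box_uminus, of d] by (simp add: f0_def)
  qed
  also have "\<dots> = of_nat (card E)" by (simp add: E_def fin flip: sum.inter_filter)
  finally have "card E = 0" using \<rho>0(2)[OF \<rho>(1,2) D] by simp
  moreover have "0 \<le> R" by (simp add: R_def)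
  from transversalD(3)[OF D box_zero[OF this]] obtain d where d: "d \<in> D" "0\<^sub>m n n - d \<in> box n \<rho>" by blast
  have "- (0\<^sub>m n n - d) = d" using box_carrier[OF transversalD(2)[OF D d(1)]] by (intro eq_matI) auto
  then have "d \<in> box n \<rho>1" using box_mono[OF box_uminus[OF d(2)] \<rho>(3)] by simp
  then have "d \<in> E" using d(1) by (simp add: E_def)
  ultimately show False using fin by (auto simp: E_def)
qed

subsection \<open>The coefficient functional\<close>

definition coef :: "('a mat \<Rightarrow> complex) \<Rightarrow> complex" where
  "coef f = (THE c. (\<lambda>g\<in>G. f g - c * f0 g) \<in> W)"

lemma coef_unique:
  assumes "(\<lambda>g\<in>G. f g - c * f0 g) \<in> W" "(\<lambda>g\<in>G. f g - d * f0 g) \<in> W"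
  shows "c = d"
proof (rule ccontr)
  assume ne: "c \<noteq> d"
  let ?k = "1 / (d - c)"
  have "(\<lambda>g\<in>G. ?k * (\<lambda>g\<in>G. f g - c * f0 g) g + (- ?k) * (\<lambda>g\<in>G. f g - d * f0 g) g) \<in> W"
    by (rule W_lincomb[OF assms])
  moreover have "(\<lambda>g\<in>G. ?k * (\<lambda>g\<in>G. f g - c * f0 g) g + (- ?k) * (\<lambda>g\<in>G. f g - d * f0 g) g) = (\<lambda>g\<in>G. f0 g)"
  proof (rule restrict_ext)
    fix g assume g: "g \<in> G"
    have "?k * (f g - c * f0 g) + (- ?k) * (f g - d * f0 g) = ((f g - c * f0 g) - (f g - d * f0 g)) / (d - c)"
      by (simp add: diff_divide_distrib)
    also have "\<dots> = (d - c) * f0 g / (d - c)" by (simp add: algebra_simps)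
    also have "\<dots> = f0 g" using ne by simp
    finally show "?k * (\<lambda>g\<in>G. f g - c * f0 g) g + (- ?k) * (\<lambda>g\<in>G. f g - d * f0 g) g = f0 g" using g by simp
  qed
  moreover have "(\<lambda>g\<in>G. f0 g) = f0" by (rule extensional_restrict[OF Ind_ext[OF f0_Ind]])
  ultimately show False using f0_not_W by (simp only:)
qed

lemma coefI: "(\<lambda>g\<in>G. f g - c * f0 g) \<in> W \<Longrightarrow> coef f = c"
  unfolding coef_def by (rule the_equality, assumption) (rule coef_unique)

lemma coef_W: "f \<in> Ind \<Longrightarrow> (\<lambda>g\<in>G. f g - coef f * f0 g) \<in> W"
proof -
  assume "f \<in> Ind"
  then have "\<exists>c. (\<lambda>g\<in>G. f g - c * f0 g) \<in> W" by (rule Ind_multiple_f0)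
  then obtain c where c: "(\<lambda>g\<in>G. f g - c * f0 g) \<in> W" by (rule exE)
  show ?thesis unfolding coefI[OF c] by (rule c)
qed

lemma coef_lincomb:
  assumes "f \<in> Ind" "h \<in> Ind" shows "coef (\<lambda>g\<in>G. a * f g + b * h g) = a * coef f + b * coef h"
proof (rule coefI)
  have "(\<lambda>g\<in>G. a * (\<lambda>g\<in>G. f g - coef f * f0 g) g + b * (\<lambda>g\<in>G. h g - coef h * f0 g) g) \<in> W"
    by (rule W_lincomb[OF coef_W[OF assms(1)] coef_W[OF assms(2)]])
  moreover have "(\<lambda>g\<in>G. a * (\<lambda>g\<in>G. f g - coef f * f0 g) g + b * (\<lambda>g\<in>G. h g - coef h * f0 g) g) =
     (\<lambda>g\<in>G. (\<lambda>g\<in>G. a * f g + b * h g) g - (a * coef f + b * coef h) * f0 g)"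
    by (rule restrict_ext) (simp add: algebra_simps)
  ultimately show "(\<lambda>g\<in>G. (\<lambda>g\<in>G. a * f g + b * h g) g - (a * coef f + b * coef h) * f0 g) \<in> W" by (simp only:)
qed

lemma coef_add: "f \<in> Ind \<Longrightarrow> h \<in> Ind \<Longrightarrow> coef (\<lambda>g\<in>G. f g + h g) = coef f + coef h"
  using coef_lincomb[of f h 1 1] by simp

lemma coef_smult: "f \<in> Ind \<Longrightarrow> coef (\<lambda>g\<in>G. c * f g) = c * coef f"
  using coef_lincomb[of f f c 0] by simp

lemma coef_eq_0: "f \<in> Ind \<Longrightarrow> coef f = 0 \<longleftrightarrow> f \<in> W"
proof -
  assume f: "f \<in> Ind"
  have eq: "(\<lambda>g\<in>G. f g - 0 * f0 g) = f" using extensional_restrict[OF Ind_ext[OF f]] by simp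
  show ?thesis
  proof
    assume "coef f = 0" then show "f \<in> W" using coef_W[OF f] eq by simp
  next
    assume "f \<in> W" then show "coef f = 0" using eq by (intro coefI) simp
  qed
qed

lemma coef_f0: "coef f0 = 1"
  using W_zero by (intro coefI) simp

definition \<omega> :: "'a mat \<Rightarrow> complex" where
  "\<omega> a = coef (act (\<Delta> a) f0)"

lemma coef_act:
  assumes a: "a \<in> carrier (GL n)" and f: "f \<in> Ind"
  shows "coef (act (\<Delta> a) f) = \<omega> a * coef f"
proof (rule coefI)
  let ?h = "\<Delta> a"
  have h: "?h \<in> G" by (rule \<Delta>_G[OF a])
  have 1: "act ?h (\<lambda>g\<in>G. f g - coef f * f0 g) \<in> W" by (rule W_act[OF a coef_W[OF f]])
  have 2: "(\<lambda>g\<in>G. act ?h f0 g - \<omega> a * f0 g) \<in> W" unfolding \<omega>_def by (rule coef_W[OF Ind_act[OF f0_Ind h]])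
  have "(\<lambda>g\<in>G. 1 * act ?h (\<lambda>g\<in>G. f g - coef f * f0 g) g + coef f * (\<lambda>g\<in>G. act ?h f0 g - \<omega> a * f0 g) g) \<in> W"
    by (rule W_lincomb[OF 1 2])
  moreover have "(\<lambda>g\<in>G. 1 * act ?h (\<lambda>g\<in>G. f g - coef f * f0 g) g + coef f * (\<lambda>g\<in>G. act ?h f0 g - \<omega> a * f0 g) g) =
     (\<lambda>g\<in>G. act ?h f g - \<omega> a * coef f * f0 g)"
    by (rule restrict_ext) (simp add: act_apply h algebra_simps)
  ultimately show "(\<lambda>g\<in>G. act ?h f g - \<omega> a * coef f * f0 g) \<in> W" by (simp only:)
qed

lemma \<omega>_mult:
  assumes a: "a \<in> carrier (GL n)" and b: "b \<in> carrier (GL n)"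
  shows "\<omega> (a * b) = \<omega> a * \<omega> b"
proof -
  have ab: "a \<in> M" "b \<in> M" using a b by auto
  have "act (\<Delta> (a * b)) f0 = act (\<Delta> a) (act (\<Delta> b) f0)"
    unfolding \<Delta>_mult[OF ab] by (rule act_mult[OF \<Delta>_G[OF a] \<Delta>_G[OF b]])
  then have "\<omega> (a * b) = coef (act (\<Delta> a) (act (\<Delta> b) f0))" by (simp add: \<omega>_def)
  then show ?thesis using coef_act[OF a Ind_act[OF f0_Ind \<Delta>_G[OF b]]] by (simp add: \<omega>_def)
qed

lemma \<omega>_positive_multiple: "a \<in> carrier (GL n) \<Longrightarrow> \<exists>m>0. \<omega> a = \<sigma> (\<Delta> a) * of_real m"
proof -
  assume "a \<in> carrier (GL n)"
  then obtain m where m: "0 < m" "(\<lambda>g\<in>G. act (\<Delta> a) f0 g - \<sigma> (\<Delta> a) * of_real m * f0 g) \<in> W"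
    using act_f0_positive_multiple by blast
  show ?thesis unfolding \<omega>_def using m(1) coefI[OF m(2)] by blast
qed

lemma \<omega>_scalar:
  assumes z: "z \<noteq> 0"
  shows "\<omega> (z \<cdot>\<^sub>m 1\<^sub>m n) = \<sigma> (\<Delta> (z \<cdot>\<^sub>m 1\<^sub>m n))"
proof -
  let ?h = "\<Delta> (z \<cdot>\<^sub>m 1\<^sub>m n)"
  have "act ?h f0 g = \<sigma> ?h * f0 g" if g: "g \<in> G" for g
  proof -
    have gc: "g \<in> carrier_mat N N" using g by simp
    have "g * ?h = ?h * g"
      unfolding \<Delta>_scalar using mult_smult_distrib[OF gc one_carrier_mat] mult_smult_assoc_mat[OF one_carrier_mat gc]
        right_mult_one_mat[OF gc] left_mult_one_mat[OF gc] by simp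
    then show ?thesis using Ind_equivariant[OF f0_Ind \<Delta>_P[OF scalar_GL[OF z]] g] by (simp add: act_apply g)
  qed
  then have "(\<lambda>g\<in>G. act ?h f0 g - \<sigma> ?h * f0 g) = (\<lambda>g\<in>G. 0)" by (intro restrict_ext) simp
  then show ?thesis unfolding \<omega>_def using W_zero by (intro coefI) simp
qed

text \<open>The diagonal acts by some character \<open>\<omega>\<close>, which is a positive multiple of \<open>\<sigma>\<close>, hence of
  \<open>\<kappa>\<close>. The ratio is a positive character of \<open>GL n\<close> that is trivial on scalars, so it is trivial
  and no explicit modulus has to be computed.\<close>

lemma \<omega>_eq:
  assumes \<kappa>_mult: "\<And>a b. a \<in> carrier (GL n) \<Longrightarrow> b \<in> carrier (GL n) \<Longrightarrow> \<kappa> (a * b) = \<kappa> a * \<kappa> b"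
    and \<kappa>: "\<And>a. a \<in> carrier (GL n) \<Longrightarrow> 0 < c a \<and> \<sigma> (\<Delta> a) = of_real (c a) * \<kappa> a"
    and \<kappa>_scalar: "\<And>z. z \<noteq> 0 \<Longrightarrow> \<sigma> (\<Delta> (z \<cdot>\<^sub>m 1\<^sub>m n)) = \<kappa> (z \<cdot>\<^sub>m 1\<^sub>m n)"
    and a: "a \<in> carrier (GL n)"
  shows "\<omega> a = \<kappa> a"
proof -
  define \<theta> where "\<theta> a = Re (\<omega> a / \<kappa> a)" for a
  have \<kappa>0: "\<kappa> a \<noteq> 0" if "a \<in> carrier (GL n)" for a
    using \<kappa>[OF that] \<sigma>_\<Delta>_nonzero[OF that] by auto
  have pos: "0 < \<theta> a" and eq: "\<omega> a = of_real (\<theta> a) * \<kappa> a" if a: "a \<in> carrier (GL n)" for a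
  proof -
    obtain m where m: "m > 0" "\<omega> a = \<sigma> (\<Delta> a) * of_real m" using \<omega>_positive_multiple[OF a] by blast
    have "\<omega> a / \<kappa> a = of_real (c a * m)" using m \<kappa>[OF a] \<kappa>0[OF a] by simp
    then have "\<theta> a = c a * m" unfolding \<theta>_def by (simp only: Re_complex_of_real)
    then show "0 < \<theta> a" "\<omega> a = of_real (\<theta> a) * \<kappa> a" using m \<kappa>[OF a] by simp_all
  qed
  have "\<theta> a = 1"
  proof (rule \<theta>_trivial[OF _ pos _ a])
    fix g h :: "'a mat" assume g: "g \<in> carrier (GL n)" and h: "h \<in> carrier (GL n)"
    have gh: "g * h \<in> carrier (GL n)" using g h by simp
    have "complex_of_real (\<theta> (g * h)) * \<kappa> (g * h) = of_real (\<theta> g * \<theta> h) * \<kappa> (g * h)"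
      using eq[OF g] eq[OF h] eq[OF gh] \<omega>_mult[OF g h] \<kappa>_mult[OF g h] by (auto simp: algebra_simps)
    then have "complex_of_real (\<theta> (g * h)) = of_real (\<theta> g * \<theta> h)" by (simp only: mult_right_cancel[OF \<kappa>0[OF gh]])
    then show "\<theta> (g * h) = \<theta> g * \<theta> h" by (simp only: of_real_eq_iff)
  next
    fix z :: 'a assume z: "z \<noteq> 0"
    have "\<omega> (z \<cdot>\<^sub>m 1\<^sub>m n) / \<kappa> (z \<cdot>\<^sub>m 1\<^sub>m n) = 1"
      using \<omega>_scalar[OF z] \<kappa>_scalar[OF z] \<kappa>0[OF scalar_GL[OF z]] by simp
    then show "\<theta> (z \<cdot>\<^sub>m 1\<^sub>m n) = 1" unfolding \<theta>_def by simp
  qed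
  then show ?thesis using eq[OF a] by simp
qed

end

lemma coefficient_functional:
  assumes \<kappa>_mult: "\<And>a b. a \<in> carrier (GL n) \<Longrightarrow> b \<in> carrier (GL n) \<Longrightarrow> \<kappa> (a * b) = \<kappa> a * \<kappa> b"
    and \<kappa>: "\<And>a. a \<in> carrier (GL n) \<Longrightarrow> 0 < c a \<and> \<sigma> (\<Delta> a) = of_real (c a) * \<kappa> a"
    and \<kappa>_scalar: "\<And>z. z \<noteq> 0 \<Longrightarrow> \<sigma> (\<Delta> (z \<cdot>\<^sub>m 1\<^sub>m n)) = \<kappa> (z \<cdot>\<^sub>m 1\<^sub>m n)"
  obtains l h where "h \<in> Ind" "l h = 1" "\<And>f. f \<in> Ind \<Longrightarrow> l f = 0 \<longleftrightarrow> f \<in> W"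
    "\<And>f h. f \<in> Ind \<Longrightarrow> h \<in> Ind \<Longrightarrow> l (\<lambda>g\<in>G. f g + h g) = l f + l h"
    "\<And>c f. f \<in> Ind \<Longrightarrow> l (\<lambda>g\<in>G. c * f g) = c * l f"
    "\<And>a f. a \<in> carrier (GL n) \<Longrightarrow> f \<in> Ind \<Longrightarrow> l (act (\<Delta> a) f) = \<kappa> a * l f"
proof -
  obtain e where e: "e > 0" "\<And>x. x \<in> box n e \<Longrightarrow> \<Psi> x = 1" using \<Psi>_smooth by blast
  define \<rho>1 where "\<rho>1 = min e 1"
  have \<rho>1: "0 < \<rho>1" "\<rho>1 \<le> 1" using e by (auto simp: \<rho>1_def)
  have \<Psi>1: "\<Psi> x = 1" if "x \<in> box n \<rho>1" for x by (rule e(2)[OF box_mono[OF that]]) (simp add: \<rho>1_def)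
  note assms1 = \<rho>1 \<Psi>1
  show thesis
  proof (rule that[of "f0 \<rho>1" "coef \<rho>1"])
    show "f0 \<rho>1 \<in> Ind" by (rule f0_Ind[OF assms1])
    show "coef \<rho>1 (f0 \<rho>1) = 1" by (rule coef_f0[OF assms1])
    show "coef \<rho>1 f = 0 \<longleftrightarrow> f \<in> W" if "f \<in> Ind" for f by (rule coef_eq_0[OF assms1 that])
    show "coef \<rho>1 (\<lambda>g\<in>G. f g + h g) = coef \<rho>1 f + coef \<rho>1 h" if "f \<in> Ind" "h \<in> Ind" for f h
      by (rule coef_add[OF assms1 that])
    show "coef \<rho>1 (\<lambda>g\<in>G. c * f g) = c * coef \<rho>1 f" if "f \<in> Ind" for c f by (rule coef_smult[OF assms1 that])
    show "coef \<rho>1 (act (\<Delta> a) f) = \<kappa> a * coef \<rho>1 f" if "a \<in> carrier (GL n)" "f \<in> Ind" for a f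
      using coef_act[OF assms1 that] \<omega>_eq[OF assms1 \<kappa>_mult \<kappa> \<kappa>_scalar that(1)] by simp
  qed
qed

end

section \<open>Quotients by the kernel of a functional\<close>

text \<open>The cosets of the kernel of \<open>l\<close> are the fibres of \<open>l\<close>, so \<open>l\<close> induces an isomorphism from
  the quotient to its image.\<close>

lemma quotient_by_kernel:
  fixes V :: "(complex, 'v) module" and l :: "'v \<Rightarrow> complex"
  assumes V: "module complex_ring V" and W: "submodule complex_ring W V"
    and l_add: "\<And>v w. v \<in> carrier V \<Longrightarrow> w \<in> carrier V \<Longrightarrow> l (v \<oplus>\<^bsub>V\<^esub> w) = l v + l w"
    and l_smult: "\<And>c v. v \<in> carrier V \<Longrightarrow> l (c \<odot>\<^bsub>V\<^esub> v) = c * l v"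
    and kernel: "\<And>v. v \<in> carrier V \<Longrightarrow> l v = 0 \<longleftrightarrow> v \<in> W"
    and \<pi>: "\<And>h v. h \<in> H \<Longrightarrow> v \<in> carrier V \<Longrightarrow> \<pi> h v \<in> carrier V"
    and l_\<pi>: "\<And>h v. h \<in> H \<Longrightarrow> v \<in> carrier V \<Longrightarrow> l (\<pi> h v) = \<kappa> h * l v"
  shows "rep_iso H (quotient_module V W, \<lambda>h X. \<Union>v\<in>X. W +>\<^bsub>V\<^esub> \<pi> h v)
    (complex_line\<lparr>carrier := l ` carrier V\<rparr>, \<lambda>h z. \<kappa> h * z)"
proof -
  interpret V: module complex_ring V by (rule V)
  define fibre where "fibre v = {x \<in> carrier V. l x = l v}" for v
  have WV: "w \<in> W \<Longrightarrow> w \<in> carrier V" for w using submodule.subset[OF W] by blast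
  have coset: "W +>\<^bsub>V\<^esub> v = fibre v" if v: "v \<in> carrier V" for v
  proof (intro equalityI subsetI)
    fix x assume "x \<in> W +>\<^bsub>V\<^esub> v"
    then obtain w where w: "w \<in> W" "x = w \<oplus>\<^bsub>V\<^esub> v" unfolding a_r_coset_def' by blast
    show "x \<in> fibre v"
      using kernel[OF WV[OF w(1)]] w(1) l_add[OF WV[OF w(1)] v] V.a_closed[OF WV[OF w(1)] v] by (simp add: fibre_def w(2))
  next
    fix x assume "x \<in> fibre v"
    then have x: "x \<in> carrier V" "l x = l v" by (simp_all add: fibre_def)
    have d: "x \<ominus>\<^bsub>V\<^esub> v \<in> carrier V" using x v by (intro V.M.minus_closed)
    have xd: "(x \<ominus>\<^bsub>V\<^esub> v) \<oplus>\<^bsub>V\<^esub> v = x" using x v by (simp add: a_minus_def V.a_assoc V.M.l_neg)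
    then have "l (x \<ominus>\<^bsub>V\<^esub> v) = 0" using l_add[OF d v] x(2) by simp
    then have "x \<ominus>\<^bsub>V\<^esub> v \<in> W" using kernel[OF d] by simp
    then show "x \<in> W +>\<^bsub>V\<^esub> v" unfolding a_r_coset_def' using xd by force
  qed
  define Q where "Q = fibre ` carrier V"
  have Q: "a_rcosets\<^bsub>V\<^esub> W = Q"
    unfolding A_RCOSETS_def' Q_def using coset by auto
  define \<Phi> where "\<Phi> X = l (SOME x. x \<in> X)" for X
  have \<Phi>: "\<Phi> X = c" if x: "x \<in> X" and X: "\<And>x. x \<in> X \<Longrightarrow> l x = c" for x X c
    unfolding \<Phi>_def by (rule X[OF someI[of "\<lambda>x. x \<in> X", OF x]])
  have self: "v \<in> fibre v" if "v \<in> carrier V" for v using that by (simp add: fibre_def)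
  have \<Phi>_fibre: "\<Phi> (fibre v) = l v" if v: "v \<in> carrier V" for v
    by (rule \<Phi>[OF self[OF v]]) (simp add: fibre_def)
  have union: "\<Phi> (\<Union>x\<in>fibre v. W +>\<^bsub>V\<^esub> F x) = c"
    if v: "v \<in> carrier V" and F: "\<And>x. x \<in> fibre v \<Longrightarrow> F x \<in> carrier V \<and> l (F x) = c" for v F c
  proof (rule \<Phi>)
    have "F v \<in> W +>\<^bsub>V\<^esub> F v" using coset self F[OF self[OF v]] by simp
    then show "F v \<in> (\<Union>x\<in>fibre v. W +>\<^bsub>V\<^esub> F x)" using self[OF v] by blast
    fix y assume "y \<in> (\<Union>x\<in>fibre v. W +>\<^bsub>V\<^esub> F x)"
    then obtain x where x: "x \<in> fibre v" "y \<in> W +>\<^bsub>V\<^esub> F x" by blast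
    then have "y \<in> fibre (F x)" using coset F[OF x(1)] by simp
    then show "l y = c" using F[OF x(1)] by (simp add: fibre_def)
  qed
  have hom: "\<Phi> \<in> module_hom complex_ring (quotient_module V W) (complex_line\<lparr>carrier := l ` carrier V\<rparr>)"
    unfolding module_hom_def
  proof (intro CollectI conjI allI impI)
    show "\<Phi> \<in> carrier (quotient_module V W) \<rightarrow> carrier (complex_line\<lparr>carrier := l ` carrier V\<rparr>)"
      by (auto simp: quotient_module_def Q Q_def \<Phi>_fibre)
  next
    fix X Y assume "X \<in> carrier (quotient_module V W) \<and> Y \<in> carrier (quotient_module V W)"
    then obtain v w where vw: "v \<in> carrier V" "w \<in> carrier V" "X = fibre v" "Y = fibre w"
      by (auto simp: quotient_module_def Q Q_def)
    have "\<Phi> (X <+>\<^bsub>V\<^esub> Y) = l v + l w"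
    proof (rule \<Phi>)
      show "v \<oplus>\<^bsub>V\<^esub> w \<in> X <+>\<^bsub>V\<^esub> Y" unfolding set_add_def' vw using self vw by blast
      fix x assume "x \<in> X <+>\<^bsub>V\<^esub> Y"
      then obtain a b where "a \<in> fibre v" "b \<in> fibre w" "x = a \<oplus>\<^bsub>V\<^esub> b" unfolding set_add_def' vw by blast
      then show "l x = l v + l w" using l_add[of a b] by (simp add: fibre_def)
    qed
    then show "\<Phi> (X \<oplus>\<^bsub>quotient_module V W\<^esub> Y) = \<Phi> X \<oplus>\<^bsub>complex_line\<lparr>carrier := l ` carrier V\<rparr>\<^esub> \<Phi> Y"
      using vw \<Phi>_fibre by (simp add: quotient_module_def complex_line_def)
  next
    fix c :: complex and X assume "c \<in> carrier complex_ring \<and> X \<in> carrier (quotient_module V W)"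
    then obtain v where v: "v \<in> carrier V" "X = fibre v" by (auto simp: quotient_module_def Q Q_def)
    have "\<Phi> (\<Union>x\<in>X. W +>\<^bsub>V\<^esub> (c \<odot>\<^bsub>V\<^esub> x)) = c * l v"
      unfolding v(2)
    proof (rule union[OF v(1)])
      fix x assume "x \<in> fibre v"
      then show "c \<odot>\<^bsub>V\<^esub> x \<in> carrier V \<and> l (c \<odot>\<^bsub>V\<^esub> x) = c * l v" using l_smult[of x c] by (simp add: fibre_def)
    qed
    then show "\<Phi> (c \<odot>\<^bsub>quotient_module V W\<^esub> X) = c \<odot>\<^bsub>complex_line\<lparr>carrier := l ` carrier V\<rparr>\<^esub> \<Phi> X"
      using v \<Phi>_fibre by (simp add: quotient_module_def complex_line_def)
  qed
  have bij: "bij_betw \<Phi> (carrier (quotient_module V W)) (l ` carrier V)"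
  proof (rule bij_betw_imageI)
    have carrier: "carrier (quotient_module V W) = fibre ` carrier V" by (simp add: quotient_module_def Q Q_def)
    show "inj_on \<Phi> (carrier (quotient_module V W))"
    proof (rule inj_onI)
      fix X Y assume "X \<in> carrier (quotient_module V W)" "Y \<in> carrier (quotient_module V W)" and eq: "\<Phi> X = \<Phi> Y"
      then obtain v w where vw: "v \<in> carrier V" "w \<in> carrier V" "X = fibre v" "Y = fibre w"
        unfolding carrier by (elim imageE)
      then have "l v = l w" using eq \<Phi>_fibre by simp
      then show "X = Y" unfolding vw(3,4) fibre_def by simp
    qed
    show "\<Phi> ` carrier (quotient_module V W) = l ` carrier V"
      unfolding carrier image_image by (rule image_cong[OF refl \<Phi>_fibre])
  qed
  have equi: "\<Phi> (\<Union>v\<in>X. W +>\<^bsub>V\<^esub> \<pi> h v) = \<kappa> h * \<Phi> X" if h: "h \<in> H" and X: "X \<in> carrier (quotient_module V W)" for h X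
  proof -
    obtain v where v: "v \<in> carrier V" "X = fibre v" using X by (auto simp: quotient_module_def Q Q_def)
    have "\<Phi> (\<Union>x\<in>X. W +>\<^bsub>V\<^esub> \<pi> h x) = \<kappa> h * l v"
      unfolding v(2)
    proof (rule union[OF v(1)])
      fix x assume "x \<in> fibre v"
      then show "\<pi> h x \<in> carrier V \<and> l (\<pi> h x) = \<kappa> h * l v"
        using \<pi>[OF h, of x] l_\<pi>[OF h, of x] by (simp add: fibre_def)
    qed
    then show ?thesis using v \<Phi>_fibre by simp
  qed
  show ?thesis
    unfolding rep_iso_def prod.case
    by (rule bexI[OF _ hom]) (use bij equi in simp)
qed

section \<open>The twisted Jacquet module\<close>

context twisted_character
begin

lemma twisted_jacquet_eq:
  "twisted_jacquet (V, act) (N_subgroup n) (psi_N n \<psi>) =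
    (quotient_module V W, \<lambda>h X. \<Union>f\<in>X. W +>\<^bsub>V\<^esub> act h f)"
proof -
  have psi: "psi_N n \<psi> (u x) = \<Psi> x" if "x \<in> M" for x
    unfolding psi_N_def u_def \<Psi>_def
      split_block_four_block[OF one_carrier_mat that zero_carrier_mat one_carrier_mat] prod.case ..
  have N: "N_subgroup n = u ` M" by (auto simp: N_subgroup_def u_def)
  have "{act h f \<ominus>\<^bsub>V\<^esub> psi_N n \<psi> h \<odot>\<^bsub>V\<^esub> f | h f. h \<in> N_subgroup n \<and> f \<in> carrier V} = gens"
  proof (intro equalityI subsetI)
    fix k assume "k \<in> {act h f \<ominus>\<^bsub>V\<^esub> psi_N n \<psi> h \<odot>\<^bsub>V\<^esub> f | h f. h \<in> N_subgroup n \<and> f \<in> carrier V}"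
    then obtain x f where x: "x \<in> M" "f \<in> Ind" "k = act (u x) f \<ominus>\<^bsub>V\<^esub> psi_N n \<psi> (u x) \<odot>\<^bsub>V\<^esub> f"
      unfolding N V_simps(1) by blast
    show "k \<in> gens"
      unfolding gens_def x(3) psi[OF x(1)] using x(1,2) by (intro CollectI exI[of _ x] exI[of _ f]) simp
  next
    fix k assume "k \<in> gens"
    then obtain x f where x: "x \<in> M" "f \<in> Ind" "k = act (u x) f \<ominus>\<^bsub>V\<^esub> \<Psi> x \<odot>\<^bsub>V\<^esub> f"
      unfolding gens_def by blast
    show "k \<in> {act h f \<ominus>\<^bsub>V\<^esub> psi_N n \<psi> h \<odot>\<^bsub>V\<^esub> f | h f. h \<in> N_subgroup n \<and> f \<in> carrier V}"
      unfolding N V_simps(1) x(3) using x(1,2) psi[OF x(1)]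
      by (intro CollectI exI[of _ "u x"] exI[of _ f]) simp
  qed
  then have "twisted_span (V, act) (N_subgroup n) (psi_N n \<psi>) = W"
    unfolding twisted_span_def prod.case W_def by simp
  then show ?thesis by (simp add: twisted_jacquet_def Let_def)
qed

lemma Delta_GL_eq: "Delta_GL n = \<Delta> ` carrier (GL n)"
  by (auto simp: Delta_GL_def \<Delta>_def)

lemma jacquet_zero:
  assumes "r \<noteq> n"
  shows "rep_iso (Delta_GL n) (twisted_jacquet (V, act) (N_subgroup n) (psi_N n \<psi>)) zero_rep"
proof -
  have W: "W = carrier V" using Ind_eq_W[OF assms] by (simp add: V_simps)
  have "rep_iso (Delta_GL n) (quotient_module V W, \<lambda>h X. \<Union>f\<in>X. W +>\<^bsub>V\<^esub> act h f)
    (complex_line\<lparr>carrier := (\<lambda>_. 0) ` carrier V\<rparr>, \<lambda>h z. 1 * z)"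
  proof (rule quotient_by_kernel[OF V_module W_submodule])
    fix h :: "'a mat" and f assume "h \<in> Delta_GL n" and f: "f \<in> carrier V"
    then obtain a where a: "a \<in> carrier (GL n)" "h = \<Delta> a" unfolding Delta_GL_eq by blast
    then show "act h f \<in> carrier V" using Ind_act[OF _ \<Delta>_G[OF a(1)]] f by (simp add: V_simps)
  qed (use W in simp_all)
  moreover have "(\<lambda>_. 0) ` carrier V = {0::complex}"
    using Ind_zero by (auto simp: V_simps)
  ultimately show ?thesis unfolding twisted_jacquet_eq zero_rep_def by simp
qed

end

lemma (in balanced_character) jacquet_character:
  assumes \<kappa>_mult: "\<And>a b. a \<in> carrier (GL n) \<Longrightarrow> b \<in> carrier (GL n) \<Longrightarrow> \<kappa> (a * b) = \<kappa> a * \<kappa> b"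
    and \<kappa>: "\<And>a. a \<in> carrier (GL n) \<Longrightarrow> 0 < c a \<and> \<sigma> (\<Delta> a) = of_real (c a) * \<kappa> a"
    and \<kappa>_scalar: "\<And>z. z \<noteq> 0 \<Longrightarrow> \<sigma> (\<Delta> (z \<cdot>\<^sub>m 1\<^sub>m n)) = \<kappa> (z \<cdot>\<^sub>m 1\<^sub>m n)"
    and \<tau>: "\<And>a. a \<in> carrier (GL n) \<Longrightarrow> \<tau> (\<Delta> a) = \<kappa> a"
  shows "rep_iso (Delta_GL n) (twisted_jacquet (V, act) (N_subgroup n) (psi_N n \<psi>)) (char_rep \<tau>)"
proof (rule coefficient_functional[OF \<kappa>_mult \<kappa> \<kappa>_scalar])
  fix l h assume h: "h \<in> Ind" "l h = 1" and l: "\<And>f. f \<in> Ind \<Longrightarrow> l f = 0 \<longleftrightarrow> f \<in> W"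
    "\<And>f h. f \<in> Ind \<Longrightarrow> h \<in> Ind \<Longrightarrow> l (\<lambda>g\<in>G. f g + h g) = l f + l h"
    "\<And>c f. f \<in> Ind \<Longrightarrow> l (\<lambda>g\<in>G. c * f g) = c * l f"
    "\<And>a f. a \<in> carrier (GL n) \<Longrightarrow> f \<in> Ind \<Longrightarrow> l (act (\<Delta> a) f) = \<kappa> a * l f"
  have "rep_iso (Delta_GL n) (quotient_module V W, \<lambda>h X. \<Union>f\<in>X. W +>\<^bsub>V\<^esub> act h f)
    (complex_line\<lparr>carrier := l ` carrier V\<rparr>, \<lambda>h z. \<tau> h * z)"
  proof (rule quotient_by_kernel[OF V_module W_submodule])
    fix h :: "'a mat" and f assume "h \<in> Delta_GL n" and f: "f \<in> carrier V"
    then obtain a where a: "a \<in> carrier (GL n)" "h = \<Delta> a" unfolding Delta_GL_eq by blast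
    show "act h f \<in> carrier V" "l (act h f) = \<tau> h * l f"
      using Ind_act[OF _ \<Delta>_G[OF a(1)]] l(4)[OF a(1)] \<tau>[OF a(1)] f by (simp_all add: V_simps a(2))
  qed (use l in \<open>simp_all add: V_simps\<close>)
  moreover have "l ` carrier V = UNIV"
  proof -
    have "z = l (\<lambda>g\<in>G. z * h g)" for z using l(3)[OF h(1), of z] h(2) by simp
    then show ?thesis using Ind_smult[OF h(1)] unfolding V_simps by blast
  qed
  ultimately show "rep_iso (Delta_GL n) (twisted_jacquet (V, act) (N_subgroup n) (psi_N n \<psi>)) (char_rep \<tau>)"
    unfolding twisted_jacquet_eq char_rep_def by (simp add: complex_line_def)
qed

lemma scalar_mat_commute:
  fixes x :: "'a::comm_semiring_1 mat"
  assumes x: "x \<in> carrier_mat m m" shows "x * (z \<cdot>\<^sub>m 1\<^sub>m m) = (z \<cdot>\<^sub>m 1\<^sub>m m) * x"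
  using mult_smult_distrib[OF x one_carrier_mat] mult_smult_assoc_mat[OF one_carrier_mat x]
    right_mult_one_mat[OF x] left_mult_one_mat[OF x] by simp

lemma parabolic_modulus_scalar:
  fixes z :: "'a::nonarch_local_field"
  assumes z: "z \<noteq> 0" and p: "z \<cdot>\<^sub>m 1\<^sub>m (r + s) \<in> parabolic r s"
  shows "parabolic_modulus r s (z \<cdot>\<^sub>m 1\<^sub>m (r + s)) = 1"
proof (rule parabolic_modulus_central[OF p])
  let ?N = "r + s"
  fix x :: "'a mat" assume x: "x \<in> parabolic r s"
  have xc: "x \<in> carrier_mat ?N ?N" by (rule GL_carrier_mat[OF parabolic_GL[OF x]])
  have "(z \<cdot>\<^sub>m 1\<^sub>m ?N) * ((1 / z) \<cdot>\<^sub>m 1\<^sub>m ?N) = (1\<^sub>m ?N :: 'a mat)"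
    using z by (intro eq_matI) (auto simp: mult_smult_distrib[of _ ?N ?N _ ?N])
  then have "GLinv ?N (z \<cdot>\<^sub>m 1\<^sub>m ?N) = (1 / z) \<cdot>\<^sub>m 1\<^sub>m ?N" by (intro GL_intro(3)) auto
  then show "x * GLinv ?N (z \<cdot>\<^sub>m 1\<^sub>m ?N) = GLinv ?N (z \<cdot>\<^sub>m 1\<^sub>m ?N) * x"
    using scalar_mat_commute[OF xc] by simp
qed

theorem theorem1p3:
  fixes chi mu :: "'a::nonarch_local_field mat \<Rightarrow> complex"
    and \<psi>\<^sub>0 :: "'a \<Rightarrow> complex"
    and n r :: nat
  assumes "1 \<le> r" and "r < 2 * n"
    and "smooth_character (GL r) (GL_topology r) chi"
    and "smooth_character (GL (2 * n - r)) (GL_topology (2 * n - r)) mu"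
    and "smooth_character additive_group euclidean \<psi>\<^sub>0"
    and "\<exists>x. \<psi>\<^sub>0 x \<noteq> 1"
  shows "(r \<noteq> n \<longrightarrow>
      rep_iso (Delta_GL n)
        (twisted_jacquet (parabolic_ind r (2 * n - r) chi mu) (N_subgroup n) (psi_N n \<psi>\<^sub>0))
        zero_rep) \<and>
    (r = n \<longrightarrow>
      rep_iso (Delta_GL n)
        (twisted_jacquet (parabolic_ind r (2 * n - r) chi mu) (N_subgroup n) (psi_N n \<psi>\<^sub>0))
        (char_rep (levi_char n chi mu)))"
proof -
  define s where "s = 2 * n - r"
  define \<sigma> where "\<sigma> = ind_char r s chi mu"
  obtain t where t: "\<psi>\<^sub>0 t \<noteq> 1" using assms(6) by blast
  note chi = assms(3) and mu = assms(4)[folded s_def]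
  interpret T: twisted_character r s \<sigma> n \<psi>\<^sub>0 t
  proof (intro twisted_character.intro twisted_character_axioms.intro)
    show "parabolic_character r s \<sigma>"
      unfolding \<sigma>_def by (rule ind_char_parabolic_character[OF chi mu])
    show "r + s = n + n" using assms(2) by (simp add: s_def)
    show "\<psi>\<^sub>0 (x + y) = \<psi>\<^sub>0 x * \<psi>\<^sub>0 y" for x y
      using smooth_characterD(2)[OF assms(5), of x y] by (simp add: additive_group_def)
    have "open {x. \<psi>\<^sub>0 x = 1}" "\<psi>\<^sub>0 0 = 1"
      using smooth_characterD(3)[OF assms(5)] smooth_characterD(1)[OF assms(5)] by (simp_all add: additive_group_def)
    then obtain e where e: "e > 0" "\<And>y. dist y 0 < e \<Longrightarrow> \<psi>\<^sub>0 y = 1"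
      unfolding open_dist by blast
    have "\<psi>\<^sub>0 x = 1" if "absv x \<le> e / 2" for x using that e by (intro e(2)) (simp add: dist_absv)
    then show "\<exists>e>0. \<forall>x. absv x \<le> e \<longrightarrow> \<psi>\<^sub>0 x = 1" using e(1) by (intro exI[of _ "e / 2"]) simp
    show "\<psi>\<^sub>0 t \<noteq> 1" by (rule t)
  qed
  have rep: "parabolic_ind r (2 * n - r) chi mu = (T.V, T.act)"
  proof -
    have "ind_space (GL (r + s)) (GL_topology (r + s)) (parabolic r s) (levi_char r chi mu) = T.Ind"
      by (rule T.ind_space_eq_Ind) (simp add: \<sigma>_def ind_char_def)
    moreover have "(\<lambda>g f. \<lambda>x\<in>carrier (GL (r + s)). f (x \<otimes>\<^bsub>GL (r + s)\<^esub> g)) = T.act"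
      unfolding T.act_def GL_mult ..
    ultimately show ?thesis
      unfolding parabolic_ind_def normalized_ind_def T.V_def s_def[symmetric] by (simp only:)
  qed
  show ?thesis
    unfolding rep
  proof (intro conjI impI)
    assume "r \<noteq> n"
    then show "rep_iso (Delta_GL n) (twisted_jacquet (T.V, T.act) (N_subgroup n) (psi_N n \<psi>\<^sub>0)) zero_rep"
      by (rule T.jacquet_zero)
  next
    assume rn: "r = n"
    interpret B: balanced_character r s \<sigma> n \<psi>\<^sub>0 t by unfold_locales (rule rn)
    have sn: "s = n" by (rule B.sn)
    have \<Delta>: "levi_char n chi mu (T.\<Delta> a) = chi a * mu a" if "a \<in> carrier (GL n)" for a
      unfolding T.\<Delta>_def using that by (intro levi_char_four_block) auto
    have \<sigma>\<Delta>: "\<sigma> (T.\<Delta> a) = of_real (sqrt (parabolic_modulus r s (T.\<Delta> a))) * (chi a * mu a)"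
      if "a \<in> carrier (GL n)" for a
      using \<Delta>[OF that] by (simp add: \<sigma>_def ind_char_def rn)
    show "rep_iso (Delta_GL n) (twisted_jacquet (T.V, T.act) (N_subgroup n) (psi_N n \<psi>\<^sub>0)) (char_rep (levi_char n chi mu))"
    proof (rule B.jacquet_character[where \<kappa> = "\<lambda>a. chi a * mu a" and c = "\<lambda>a. sqrt (parabolic_modulus r s (T.\<Delta> a))"])
      fix a b :: "'a mat" assume ab: "a \<in> carrier (GL n)" "b \<in> carrier (GL n)"
      show "chi (a * b) * mu (a * b) = chi a * mu a * (chi b * mu b)"
        using smooth_GL_characterD(2)[OF chi[unfolded rn] ab] smooth_GL_characterD(2)[OF mu[unfolded sn] ab] by simp
    next
      fix a :: "'a mat" assume a: "a \<in> carrier (GL n)"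
      show "0 < sqrt (parabolic_modulus r s (T.\<Delta> a)) \<and>
          \<sigma> (T.\<Delta> a) = of_real (sqrt (parabolic_modulus r s (T.\<Delta> a))) * (chi a * mu a)"
        using parabolic_modulus_pos[OF B.\<Delta>_P[OF a]] \<sigma>\<Delta>[OF a] by simp
      show "levi_char n chi mu (T.\<Delta> a) = chi a * mu a" by (rule \<Delta>[OF a])
    next
      fix z :: 'a assume z: "z \<noteq> 0"
      note zG = scalar_GL[OF z, of n]
      have "parabolic_modulus r s (T.\<Delta> (z \<cdot>\<^sub>m 1\<^sub>m n)) = 1"
        using parabolic_modulus_scalar[OF z] B.\<Delta>_P[OF zG] unfolding T.\<Delta>_scalar by blast
      then show "\<sigma> (T.\<Delta> (z \<cdot>\<^sub>m 1\<^sub>m n)) = chi (z \<cdot>\<^sub>m 1\<^sub>m n) * mu (z \<cdot>\<^sub>m 1\<^sub>m n)"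
        using \<sigma>\<Delta>[OF zG] by simp
    qed
  qed
qed

end
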